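(* Let $K$ be a field and let $G$ be a finite nonmodular group acting faithfully via $\beta$ on $Y=\operatorname{Spec}S$ by $K$-algebra automorphisms, with quotient scheme $X=\operatorname{Spec}R$. Let $P\in X$ be a closed point with maximal ideal $\mathfrak m_P$, let $Q\in Y$ be a preimage of $P$, and let $S/\mathfrak m_PS\cong S_1\times\cdots\times S_r$ be the decomposition of the fiber ring $S/\mathfrak m_PS$ into local rings, with $Q$ corresponding to $S_1$. Let $H$ denote the stabilizer group of the point $Q$. Let $\rho$ be a linear action of $G$ on $\mathbb A^m$, let $Z_\rho=(Y\times\mathbb A^m)/(\beta\times\rho)$ be the quotient scheme, and let $\tilde\rho$ be the induced action of $H$ on $\mathbb A^m$. Then the fiber ring of $Z_\rho$ over $P$ is $(S_1[W_1,\ldots,W_m])^{\tilde\rho}$.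
   Context: $S$ is a $K$-algebra, $R=S^G$ is the invariant ring. Nonmodular means that $|G|$ is not $0$ in $K$. The linear action $\rho$ of $G$ on $\mathbb A^m$ induces a linear action on $K[W_1,\ldots,W_m]$; $\beta\times\rho$ denotes the product action on $S[W_1,\ldots,W_m]=S\otimes_K K[W_1,\ldots,W_m]$ (acting on both factors), and $Z_\rho=\operatorname{Spec}\big(S[W_1,\ldots,W_m]^{\beta\times\rho}\big)$, a scheme over $X$. The fiber ring over $P$ is the tensor product with $\kappa(P)=R/\mathfrak m_P$ over $R$. The stabilizer $H$ of $Q$ is the subgroup of all group elements mapping the point $Q$ to itself (no requirement on the residue class field). $(S_1[W_1,\ldots,W_m])^{\tilde\rho}$ denotes the invariants under the action of $H$ on $S_1[W_1,\ldots,W_m]$ given by the action of $H$ on $S_1$ induced by $\beta$ together with the restriction $\tilde\rho$ of $\rho$ to $H$ on the variables. *)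

theory Defs
  imports "HOL-Algebra.Algebra"
begin

text \<open>
  The algebra \<open>R[M]\<close> of a monoid \<open>M\<close> over a commutative ring \<open>R\<close>: finitely supported functions with
  convolution.  They are functions on the whole type that vanish outside \<open>carrier M\<close>.
  \<open>single R x c\<close> is the element \<open>c\<cdot>x\<close>.
\<close>

definition monoid_ring :: "('r, 'a) ring_scheme \<Rightarrow> ('x, 'b) monoid_scheme \<Rightarrow> ('x \<Rightarrow> 'r) ring" where
  "monoid_ring R M =
    \<lparr>carrier = {f. (\<forall>x. f x \<in> carrier R) \<and> finite {x. f x \<noteq> \<zero>\<^bsub>R\<^esub>} \<and> {x. f x \<noteq> \<zero>\<^bsub>R\<^esub>} \<subseteq> carrier M},
     monoid.mult = (\<lambda>f g z. \<Oplus>\<^bsub>R\<^esub>p\<in>{(x, y). f x \<noteq> \<zero>\<^bsub>R\<^esub> \<and> g y \<noteq> \<zero>\<^bsub>R\<^esub> \<and> x \<otimes>\<^bsub>M\<^esub> y = z}. f (fst p) \<otimes>\<^bsub>R\<^esub> g (snd p)),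
     one = (\<lambda>x. if x = \<one>\<^bsub>M\<^esub> then \<one>\<^bsub>R\<^esub> else \<zero>\<^bsub>R\<^esub>),
     ring.zero = (\<lambda>x. \<zero>\<^bsub>R\<^esub>),
     ring.add = (\<lambda>f g x. f x \<oplus>\<^bsub>R\<^esub> g x)\<rparr>"

definition single :: "('r, 'a) ring_scheme \<Rightarrow> 'x \<Rightarrow> 'r \<Rightarrow> 'x \<Rightarrow> 'r" where
  "single R x c = (\<lambda>y. if y = x then c else \<zero>\<^bsub>R\<^esub>)"

text \<open>
  \<open>T[W\<^sub>0, \<dots>, W\<^sub>m\<^sub>-\<^sub>1]\<close>, a monomial being the multiset of its variables: \<open>single T {#} c\<close> is
  the constant \<open>c\<close> and \<open>single T {#i#} c\<close> is \<open>c W\<^sub>i\<close>.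
\<close>

definition monomials :: "nat \<Rightarrow> nat multiset monoid" where
  "monomials m = \<lparr>carrier = {\<mu>. set_mset \<mu> \<subseteq> {..<m}}, monoid.mult = (+), one = {#}\<rparr>"

definition mpoly_ring :: "('r, 'a) ring_scheme \<Rightarrow> nat \<Rightarrow> (nat multiset \<Rightarrow> 'r) ring" where
  "mpoly_ring T m = monoid_ring T (monomials m)"

text \<open>
  The tensor product \<open>A \<otimes>\<^sub>R B\<close> of commutative \<open>R\<close>-algebras with structure maps \<open>\<phi>\<close> and \<open>\<psi>\<close>.
  The additive group of \<open>\<Z>[A \<times> B]\<close> (monoid ring of the multiplicative monoid \<open>A \<times> B\<close>) is the free
  abelian group on the pairs, and the subgroup spanned by the bilinearity relations is stable under
  multiplication by pairs.  So that subgroup is an ideal, and the quotient is the usual tensor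
  product with multiplication \<open>(a \<otimes> b)(a' \<otimes> b') = aa' \<otimes> bb'\<close>.
\<close>

definition tensor_relations ::
  "('r, 'u) ring_scheme \<Rightarrow> ('a, 'v) ring_scheme \<Rightarrow> ('r \<Rightarrow> 'a) \<Rightarrow> ('b, 'w) ring_scheme \<Rightarrow> ('r \<Rightarrow> 'b)
    \<Rightarrow> ('a \<times> 'b \<Rightarrow> int) set" where
  "tensor_relations R A \<phi> B \<psi> =
    (let F = monoid_ring \<Z> (A \<times>\<times> B); gen = (\<lambda>a b. single \<Z> (a, b) \<one>\<^bsub>\<Z>\<^esub>) in
      {gen (a \<oplus>\<^bsub>A\<^esub> a') b \<ominus>\<^bsub>F\<^esub> (gen a b \<oplus>\<^bsub>F\<^esub> gen a' b) | a a' b.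
          a \<in> carrier A \<and> a' \<in> carrier A \<and> b \<in> carrier B} \<union>
      {gen a (b \<oplus>\<^bsub>B\<^esub> b') \<ominus>\<^bsub>F\<^esub> (gen a b \<oplus>\<^bsub>F\<^esub> gen a b') | a b b'.
          a \<in> carrier A \<and> b \<in> carrier B \<and> b' \<in> carrier B} \<union>
      {gen (\<phi> r \<otimes>\<^bsub>A\<^esub> a) b \<ominus>\<^bsub>F\<^esub> gen a (\<psi> r \<otimes>\<^bsub>B\<^esub> b) | r a b.
          r \<in> carrier R \<and> a \<in> carrier A \<and> b \<in> carrier B})"

definition tensor_ring ::
  "('r, 'u) ring_scheme \<Rightarrow> ('a, 'v) ring_scheme \<Rightarrow> ('r \<Rightarrow> 'a) \<Rightarrow> ('b, 'w) ring_scheme \<Rightarrow> ('r \<Rightarrow> 'b)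
    \<Rightarrow> ('a \<times> 'b \<Rightarrow> int) set ring" where
  "tensor_ring R A \<phi> B \<psi> =
    (let F = monoid_ring \<Z> (A \<times>\<times> B) in F Quot (Idl\<^bsub>F\<^esub> (tensor_relations R A \<phi> B \<psi>)))"

definition pure_tensor ::
  "('r, 'u) ring_scheme \<Rightarrow> ('a, 'v) ring_scheme \<Rightarrow> ('r \<Rightarrow> 'a) \<Rightarrow> ('b, 'w) ring_scheme \<Rightarrow> ('r \<Rightarrow> 'b)
    \<Rightarrow> 'a \<Rightarrow> 'b \<Rightarrow> ('a \<times> 'b \<Rightarrow> int) set" where
  "pure_tensor R A \<phi> B \<psi> a b =
    (let F = monoid_ring \<Z> (A \<times>\<times> B)
      in Idl\<^bsub>F\<^esub> (tensor_relations R A \<phi> B \<psi>) +>\<^bsub>F\<^esub> single \<Z> (a, b) \<one>\<^bsub>\<Z>\<^esub>)"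

text \<open>
  For an \<open>R\<close>-algebra \<open>A\<close> with structure map \<open>\<phi>\<close> and a maximal ideal \<open>I\<close> of \<open>R\<close>: the fiber ring
  \<open>A \<otimes>\<^sub>R R/I\<close>, and its structure map \<open>c \<mapsto> 1 \<otimes> c\<close> as an algebra over the residue field \<open>R/I\<close>.
\<close>

definition fiber_ring ::
  "('r, 'u) ring_scheme \<Rightarrow> ('a, 'v) ring_scheme \<Rightarrow> ('r \<Rightarrow> 'a) \<Rightarrow> 'r set
    \<Rightarrow> ('a \<times> 'r set \<Rightarrow> int) set ring" where
  "fiber_ring R A \<phi> I = tensor_ring R A \<phi> (R Quot I) (\<lambda>r. I +>\<^bsub>R\<^esub> r)"

definition fiber_scalar ::
  "('r, 'u) ring_scheme \<Rightarrow> ('a, 'v) ring_scheme \<Rightarrow> ('r \<Rightarrow> 'a) \<Rightarrow> 'r set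
    \<Rightarrow> 'r set \<Rightarrow> ('a \<times> 'r set \<Rightarrow> int) set" where
  "fiber_scalar R A \<phi> I c = pure_tensor R A \<phi> (R Quot I) (\<lambda>r. I +>\<^bsub>R\<^esub> r) \<one>\<^bsub>A\<^esub> c"

definition local_ring :: "('a, 'u) ring_scheme \<Rightarrow> bool" where
  "local_ring A \<longleftrightarrow> cring A \<and> (\<exists>!M. maximalideal M A)"

definition invariant_ring :: "('a, 'u) ring_scheme \<Rightarrow> 'g set \<Rightarrow> ('g \<Rightarrow> 'a \<Rightarrow> 'a) \<Rightarrow> ('a, 'u) ring_scheme" where
  "invariant_ring A H \<gamma> = A\<lparr>carrier := {a \<in> carrier A. \<forall>h\<in>H. \<gamma> h a = a}\<rparr>"

text \<open>
  The action induced on the image of \<open>A\<close> under \<open>\<pi>\<close> by an action \<open>\<beta>\<close> on \<open>A\<close> that respects the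
  fibers of \<open>\<pi>\<close>: \<open>h \<cdot> \<pi> s = \<pi> (h \<cdot> s)\<close>.
\<close>

definition induced_action :: "('a, 'u) ring_scheme \<Rightarrow> ('a \<Rightarrow> 'b) \<Rightarrow> ('g \<Rightarrow> 'a \<Rightarrow> 'a) \<Rightarrow> 'g \<Rightarrow> 'b \<Rightarrow> 'b" where
  "induced_action A \<pi> \<beta> h x = (THE y. \<exists>s\<in>carrier A. x = \<pi> s \<and> y = \<pi> (\<beta> h s))"

definition matrix_monoid :: "('k, 'u) ring_scheme \<Rightarrow> nat \<Rightarrow> (nat \<Rightarrow> nat \<Rightarrow> 'k) monoid" where
  "matrix_monoid K m =
    \<lparr>carrier = {..<m} \<rightarrow>\<^sub>E {..<m} \<rightarrow>\<^sub>E carrier K,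
     monoid.mult = (\<lambda>A B. \<lambda>i\<in>{..<m}. \<lambda>j\<in>{..<m}. \<Oplus>\<^bsub>K\<^esub>k\<in>{..<m}. A i k \<otimes>\<^bsub>K\<^esub> B k j),
     one = (\<lambda>i\<in>{..<m}. \<lambda>j\<in>{..<m}. if i = j then \<one>\<^bsub>K\<^esub> else \<zero>\<^bsub>K\<^esub>)\<rparr>"

abbreviation GL :: "nat \<Rightarrow> ('k, 'u) ring_scheme \<Rightarrow> (nat \<Rightarrow> nat \<Rightarrow> 'k) monoid" where
  "GL m K \<equiv> units_of (matrix_monoid K m)"

text \<open>
  The product of an action \<open>\<alpha>\<close> on a \<open>K\<close>-algebra \<open>T\<close> (structure map \<open>\<iota>\<close>) with the action on
  \<open>K[W\<^sub>0, \<dots>, W\<^sub>m\<^sub>-\<^sub>1]\<close> that a matrix representation \<open>\<rho>\<close> induces on the coordinate functions of affine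
  \<open>m\<close>-space: \<open>(g \<cdot> W\<^sub>i)(w) = W\<^sub>i(g\<^sup>-\<^sup>1 w)\<close>, hence \<open>g \<cdot> W\<^sub>i = \<Sum>\<^sub>j \<rho>(g\<^sup>-\<^sup>1)\<^sub>i\<^sub>j W\<^sub>j\<close>, and
  \<open>g \<cdot> \<Sum>\<^sub>\<mu> f\<^sub>\<mu> W\<^sup>\<mu> = \<Sum>\<^sub>\<mu> \<alpha>\<^sub>g(f\<^sub>\<mu>) \<Prod>\<^sub>i (g \<cdot> W\<^sub>i)\<^sup>\<mu>\<^sup>(\<^sup>i\<^sup>)\<close>.
\<close>

definition product_action ::
  "('g, 'v) monoid_scheme \<Rightarrow> ('t, 'u) ring_scheme \<Rightarrow> ('k \<Rightarrow> 't) \<Rightarrow> ('g \<Rightarrow> 't \<Rightarrow> 't)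
    \<Rightarrow> nat \<Rightarrow> ('g \<Rightarrow> nat \<Rightarrow> nat \<Rightarrow> 'k) \<Rightarrow> 'g \<Rightarrow> (nat multiset \<Rightarrow> 't) \<Rightarrow> nat multiset \<Rightarrow> 't" where
  "product_action G T \<iota> \<alpha> m \<rho> g f =
    (let P = mpoly_ring T m; W = (\<lambda>i. \<Oplus>\<^bsub>P\<^esub>j\<in>{..<m}. single T {#j#} (\<iota> (\<rho> (inv\<^bsub>G\<^esub> g) i j))) in
      \<Oplus>\<^bsub>P\<^esub>\<mu>\<in>{\<mu>. f \<mu> \<noteq> \<zero>\<^bsub>T\<^esub>}. single T {#} (\<alpha> g (f \<mu>)) \<otimes>\<^bsub>P\<^esub> (\<Otimes>\<^bsub>P\<^esub>i\<in>{..<m}. W i [^]\<^bsub>P\<^esub> count \<mu> i))"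

end

theory Submission
  imports Defs
begin

text \<open>
  Write \<open>U = S[W]\<close>, \<open>V = S\<^sub>1[W]\<close>, and let \<open>\<theta> : U \<rightarrow> V\<close> apply the projection \<open>\<pi> : S \<rightarrow> S\<^sub>1\<close> to all
  coefficients.  The fiber ring of \<open>A = U\<^sup>G\<close> over \<open>P\<close> is \<open>A/PA\<close> (\<open>fiber_ring_iso\<close>), so the claim is that
  \<open>\<theta>\<close> maps \<open>A\<close> onto \<open>V\<^sup>H\<close> with kernel \<open>PA\<close>.

  Let \<open>e \<in> S\<close> lift the idempotent \<open>(1, 0, \<dots>, 0)\<close> of \<open>S/PS = S\<^sub>1 \<times> \<dots> \<times> S\<^sub>r\<close>.  For \<open>g \<in> G\<close> the element
  \<open>\<pi>(g e)\<close> is an idempotent of the local ring \<open>S\<^sub>1\<close>, hence \<open>0\<close> or \<open>1\<close>.  It is \<open>1\<close> if \<open>g\<close> fixes the point \<open>Q\<close>,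
  since then \<open>g e \<notin> Q\<close>.  Conversely, if it is \<open>1\<close>, then \<open>g\<close> preserves \<open>ker \<pi>\<close> and induces an
  endomorphism of \<open>S\<^sub>1\<close>.  This maps units to units, so \<open>Q \<subseteq> g Q\<close>, and \<open>g Q = Q\<close> as \<open>g\<close> has finite order
  (\<open>stabilizer_fixes_e\<close>, \<open>outside_stabilizer_kills_e\<close>).

  Surjectivity (\<open>invariants_onto_local_invariants\<close>): given \<open>b \<in> V\<^sup>H\<close>, choose \<open>u\<close> with \<open>\<theta> u = b\<close> and sum
  the translates of \<open>e u\<close> over \<open>G\<close>.  Under \<open>\<theta>\<close> the summands with \<open>g \<notin> H\<close> vanish and those with \<open>g \<in> H\<close> all equal \<open>b\<close>, so the
  sum maps to \<open>|H| b\<close>, and \<open>|H|\<close> is invertible because it divides \<open>|G|\<close>.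

  Kernel: if \<open>a \<in> A\<close> and \<open>\<theta> a = 0\<close>, then \<open>e a \<in> PU\<close>, and translating gives \<open>(g e) a \<in> PU\<close> for every \<open>g\<close>.
  Therefore \<open>a\<close> is congruent modulo \<open>PU\<close> to \<open>a E\<close> with \<open>E = \<Prod>\<^sub>g (1 - g e)\<close>.  The element \<open>E\<close> is invariant
  and lies in \<open>Q\<close>, because its factor \<open>1 - e\<close> does; so \<open>E \<in> Q \<inter> R = P\<close> and \<open>a \<in> PU\<close>
  (\<open>orbit_product_mem\<close>, \<open>mem_ideal_of_orbit_product\<close>).  Finally \<open>PU \<inter> A = PA\<close> by the Reynolds operator,
  as \<open>|G|\<close> is invertible (\<open>extended_ideal_invariants\<close>).
\<close>

section \<open>Finite sums\<close>

lemma (in abelian_monoid) finsum_Times: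
  assumes "finite A" "finite B" "\<And>a b. a \<in> A \<Longrightarrow> b \<in> B \<Longrightarrow> f (a, b) \<in> carrier G"
  shows "(\<Oplus>p\<in>A \<times> B. f p) = (\<Oplus>a\<in>A. \<Oplus>b\<in>B. f (a, b))"
  using assms(1,3)
proof (induction A)
  case empty then show ?case by simp
next
  case (insert a A)
  have eq: "insert a A \<times> B = Pair a ` B \<union> A \<times> B" by auto
  have "(\<Oplus>p\<in>insert a A \<times> B. f p) = (\<Oplus>p\<in>Pair a ` B. f p) \<oplus> (\<Oplus>p\<in>A \<times> B. f p)"
    unfolding eq using insert assms(2) by (intro finsum_Un_disjoint) auto
  also have "(\<Oplus>p\<in>Pair a ` B. f p) = (\<Oplus>b\<in>B. f (a, b))"
    using insert by (subst finsum_reindex) (auto simp: inj_on_def)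
  also have "(\<Oplus>p\<in>A \<times> B. f p) = (\<Oplus>a\<in>A. \<Oplus>b\<in>B. f (a, b))"
    using insert by auto
  finally show ?case
    using insert by (subst finsum_insert) auto
qed

lemma (in abelian_monoid) finsum_swap:
  assumes "finite A" "finite B" "\<And>a b. a \<in> A \<Longrightarrow> b \<in> B \<Longrightarrow> f a b \<in> carrier G"
  shows "(\<Oplus>a\<in>A. \<Oplus>b\<in>B. f a b) = (\<Oplus>b\<in>B. \<Oplus>a\<in>A. f a b)"
  using assms(1,3)
proof (induction A)
  case empty
  have "(\<Oplus>b\<in>B. \<zero>) = \<zero>" by simp
  then show ?case by simp
next
  case (insert a A)
  have "(\<Oplus>b\<in>B. \<Oplus>a\<in>insert a A. f a b) = (\<Oplus>b\<in>B. f a b \<oplus> (\<Oplus>a\<in>A. f a b))"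
    using insert by (intro finsum_cong' finsum_insert) auto
  also have "\<dots> = (\<Oplus>b\<in>B. f a b) \<oplus> (\<Oplus>b\<in>B. \<Oplus>a\<in>A. f a b)"
    using insert by (intro finsum_addf) auto
  also have "\<dots> = (\<Oplus>b\<in>B. f a b) \<oplus> (\<Oplus>a\<in>A. \<Oplus>b\<in>B. f a b)"
    using insert by auto
  finally show ?case
    using insert by (subst finsum_insert) auto
qed

lemma (in abelian_monoid) finsum_superset:
  assumes "finite B" "A \<subseteq> B" "\<And>x. x \<in> A \<Longrightarrow> f x \<in> carrier G" "\<And>x. x \<in> B - A \<Longrightarrow> f x = \<zero>"
  shows "finsum G f A = finsum G f B"
proof (rule add.finprod_mono_neutral_cong_left)
  show "f \<in> B \<rightarrow> carrier G"
  proof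
    fix x assume "x \<in> B"
    then show "f x \<in> carrier G" using assms(3,4) by (cases "x \<in> A") auto
  qed
qed (use assms in auto)

lemma (in abelian_monoid) finsum_delta:
  assumes "finite A" "a \<in> A" "f a \<in> carrier G"
  shows "(\<Oplus>x\<in>A. if x = a then f x else \<zero>) = f a"
proof -
  have "(\<Oplus>x\<in>A. if x = a then f x else \<zero>) = (\<Oplus>x\<in>{a}. if x = a then f x else \<zero>)"
    using assms by (intro finsum_superset[symmetric]) auto
  then show ?thesis using assms by simp
qed

lemma (in ideal) finsum_mem:
  assumes "\<And>x. x \<in> A \<Longrightarrow> f x \<in> I"
  shows "finsum R f A \<in> I"
proof (cases "finite A")
  case True
  then show ?thesis using assms
  proof (induction A)
    case (insert x A)
    then have "finsum R f (insert x A) = f x \<oplus> finsum R f A"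
      by (intro finsum_insert) (auto intro: Icarr)
    then show ?case using insert by (simp add: a_closed)
  qed simp
qed simp

section \<open>Monoid rings\<close>

lemma ring_hom_cringI2:
  assumes "cring R" "cring T" "h \<in> ring_hom R T"
  shows "ring_hom_cring R T h"
  using assms by (intro ring_hom_cring.intro ring_hom_cring_axioms.intro)

text \<open>
  The extension of a coefficient map \<open>\<phi>\<close> and a map \<open>\<theta>\<close> on the monoid to the monoid ring.  For a ring
  homomorphism \<open>\<phi>\<close> and a multiplicative \<open>\<theta>\<close> it is a ring homomorphism; for arbitrary \<open>\<theta>\<close> it is the additive
  pairing of \<open>f\<close> with \<open>\<theta>\<close>, and this case yields associativity of the multiplication.
\<close>
definition monoid_ring_lift ::
  "('r, 'u) ring_scheme \<Rightarrow> ('t, 'v) ring_scheme \<Rightarrow> ('r \<Rightarrow> 't) \<Rightarrow> ('x \<Rightarrow> 't) \<Rightarrow> ('x \<Rightarrow> 'r) \<Rightarrow> 't" where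
  "monoid_ring_lift R T \<phi> \<theta> f = (\<Oplus>\<^bsub>T\<^esub>x\<in>{x. f x \<noteq> \<zero>\<^bsub>R\<^esub>}. \<phi> (f x) \<otimes>\<^bsub>T\<^esub> \<theta> x)"

locale monoid_algebra = R?: cring R + M: comm_monoid M for R (structure) and M
begin

abbreviation "RM \<equiv> monoid_ring R M"
abbreviation "supp f \<equiv> {x. f x \<noteq> \<zero>}"

lemma RM_simps:
  "f \<in> carrier RM \<longleftrightarrow> (\<forall>x. f x \<in> carrier R) \<and> finite (supp f) \<and> supp f \<subseteq> carrier M"
  "\<zero>\<^bsub>RM\<^esub> = (\<lambda>x. \<zero>)"
  "\<one>\<^bsub>RM\<^esub> = single R \<one>\<^bsub>M\<^esub> \<one>"
  "f \<oplus>\<^bsub>RM\<^esub> g = (\<lambda>x. f x \<oplus> g x)"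
  by (auto simp: monoid_ring_def single_def)

lemma coeff_closed [simp]: "f \<in> carrier RM \<Longrightarrow> f x \<in> carrier R"
  and finite_supp: "f \<in> carrier RM \<Longrightarrow> finite (supp f)"
  and supp_subset: "f \<in> carrier RM \<Longrightarrow> supp f \<subseteq> carrier M"
  by (auto simp: RM_simps)

text \<open>
  Summing over fixed finite sets \<open>U\<close> and \<open>V\<close> instead of the supports of \<open>f\<close> and \<open>g\<close> makes products with
  different factors comparable, and turns identities between products into exchanges of finite sums.
\<close>
lemma mult_coeff:
  assumes f: "f \<in> carrier RM" and g: "g \<in> carrier RM"
    and "finite U" "supp f \<subseteq> U" "finite V" "supp g \<subseteq> V"
  shows "(f \<otimes>\<^bsub>RM\<^esub> g) z = (\<Oplus>x\<in>U. \<Oplus>y\<in>V. if x \<otimes>\<^bsub>M\<^esub> y = z then f x \<otimes> g y else \<zero>)"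
proof -
  let ?A = "{(x, y). f x \<noteq> \<zero> \<and> g y \<noteq> \<zero> \<and> x \<otimes>\<^bsub>M\<^esub> y = z}"
  have "(f \<otimes>\<^bsub>RM\<^esub> g) z = (\<Oplus>p\<in>?A. f (fst p) \<otimes> g (snd p))"
    by (simp only: monoid_ring_def monoid.select_convs)
  also have "\<dots> = (\<Oplus>p\<in>?A. if fst p \<otimes>\<^bsub>M\<^esub> snd p = z then f (fst p) \<otimes> g (snd p) else \<zero>)"
    using f g by (intro finsum_cong') auto
  also have "\<dots> = (\<Oplus>p\<in>U \<times> V. if fst p \<otimes>\<^bsub>M\<^esub> snd p = z then f (fst p) \<otimes> g (snd p) else \<zero>)"
  proof (intro finsum_superset)
    show "(if fst p \<otimes>\<^bsub>M\<^esub> snd p = z then f (fst p) \<otimes> g (snd p) else \<zero>) = \<zero>"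
      if "p \<in> U \<times> V - ?A" for p
      using that f g by (cases "f (fst p) = \<zero>"; cases "g (snd p) = \<zero>") auto
  qed (use assms in auto)
  also have "\<dots> = (\<Oplus>x\<in>U. \<Oplus>y\<in>V. if x \<otimes>\<^bsub>M\<^esub> y = z then f x \<otimes> g y else \<zero>)"
    using assms by (subst finsum_Times) (simp_all only: fst_conv snd_conv, simp_all)
  finally show ?thesis .
qed

lemma mult_supp:
  assumes "f \<in> carrier RM" "g \<in> carrier RM"
  shows "supp (f \<otimes>\<^bsub>RM\<^esub> g) \<subseteq> (\<lambda>(x, y). x \<otimes>\<^bsub>M\<^esub> y) ` (supp f \<times> supp g)"
proof
  fix z assume z: "z \<in> supp (f \<otimes>\<^bsub>RM\<^esub> g)"
  show "z \<in> (\<lambda>(x, y). x \<otimes>\<^bsub>M\<^esub> y) ` (supp f \<times> supp g)"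
  proof (rule ccontr)
    assume "z \<notin> (\<lambda>(x, y). x \<otimes>\<^bsub>M\<^esub> y) ` (supp f \<times> supp g)"
    then have "{(x, y). f x \<noteq> \<zero> \<and> g y \<noteq> \<zero> \<and> x \<otimes>\<^bsub>M\<^esub> y = z} = {}" by auto
    then have "(f \<otimes>\<^bsub>RM\<^esub> g) z = \<zero>" by (simp only: monoid_ring_def monoid.select_convs finsum_empty)
    then show False using z by simp
  qed
qed

lemma mult_closed:
  assumes "f \<in> carrier RM" "g \<in> carrier RM"
  shows "f \<otimes>\<^bsub>RM\<^esub> g \<in> carrier RM"
proof -
  have fin: "finite (supp f)" "finite (supp g)" and sub: "supp f \<subseteq> carrier M" "supp g \<subseteq> carrier M"
    using assms by (auto simp: RM_simps)
  have "(f \<otimes>\<^bsub>RM\<^esub> g) z \<in> carrier R" for z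
    using mult_coeff[OF assms fin(1) _ fin(2)] assms by auto
  moreover have "finite (supp (f \<otimes>\<^bsub>RM\<^esub> g))"
    by (rule finite_subset[OF mult_supp[OF assms]]) (use fin in auto)
  moreover have "supp (f \<otimes>\<^bsub>RM\<^esub> g) \<subseteq> carrier M"
    using mult_supp[OF assms] sub by fastforce
  ultimately show ?thesis by (simp add: RM_simps)
qed

lemma lift_superset:
  assumes T: "cring T" and \<phi>: "\<phi> \<in> ring_hom R T"
    and \<theta>: "\<And>x. x \<in> carrier M \<Longrightarrow> \<theta> x \<in> carrier T" and f: "f \<in> carrier RM"
    and U: "finite U" "supp f \<subseteq> U" "U \<subseteq> carrier M"
  shows "monoid_ring_lift R T \<phi> \<theta> f = (\<Oplus>\<^bsub>T\<^esub>x\<in>U. \<phi> (f x) \<otimes>\<^bsub>T\<^esub> \<theta> x)"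
proof -
  interpret T: cring T by fact
  interpret h: ring_hom_cring R T \<phi>
    using \<phi> T R.is_cring by (intro ring_hom_cringI2) 
  show ?thesis unfolding monoid_ring_lift_def
    using U supp_subset[OF f] f
    by (intro T.finsum_superset) (auto intro!: T.m_closed T.l_null \<theta> h.hom_closed)
qed

text \<open>
  The terms of \<open>f g\<close> at \<open>z\<close> come from the pairs with product \<open>z\<close>; collecting all \<open>z\<close> leaves one term for
  each pair.  With multiplicative \<open>\<theta>\<close> this is multiplicativity of the lift; with the coefficient functional
  \<open>z \<mapsto> (z h)\<^sub>w\<close> it computes \<open>((f g) h)\<^sub>w\<close>.
\<close>
lemma lift_mult_double_sum:
  assumes T: "cring T" and \<phi>: "\<phi> \<in> ring_hom R T"
    and \<theta>: "\<And>x. x \<in> carrier M \<Longrightarrow> \<theta> x \<in> carrier T" and f: "f \<in> carrier RM" and g: "g \<in> carrier RM"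
  shows "monoid_ring_lift R T \<phi> \<theta> (f \<otimes>\<^bsub>RM\<^esub> g)
    = (\<Oplus>\<^bsub>T\<^esub>x\<in>supp f. \<Oplus>\<^bsub>T\<^esub>y\<in>supp g. \<phi> (f x) \<otimes>\<^bsub>T\<^esub> \<phi> (g y) \<otimes>\<^bsub>T\<^esub> \<theta> (x \<otimes>\<^bsub>M\<^esub> y))"
proof -
  interpret T: cring T by fact
  interpret h: ring_hom_cring R T \<phi>
    using \<phi> T R.is_cring by (intro ring_hom_cringI2)
  let ?Z = "(\<lambda>(x, y). x \<otimes>\<^bsub>M\<^esub> y) ` (supp f \<times> supp g)"
  have fin: "finite (supp f)" "finite (supp g)" and sub: "supp f \<subseteq> carrier M" "supp g \<subseteq> carrier M"
    using f g by (auto simp: RM_simps)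
  have Z: "finite ?Z" "?Z \<subseteq> carrier M" using fin sub by auto
  let ?F = "\<lambda>x y z. if z = x \<otimes>\<^bsub>M\<^esub> y then \<phi> (f x) \<otimes>\<^bsub>T\<^esub> \<phi> (g y) \<otimes>\<^bsub>T\<^esub> \<theta> z else \<zero>\<^bsub>T\<^esub>"
  have FT: "?F x y z \<in> carrier T" if "z \<in> carrier M" for x y z
    using that f g \<theta> by auto
  have "monoid_ring_lift R T \<phi> \<theta> (f \<otimes>\<^bsub>RM\<^esub> g) = (\<Oplus>\<^bsub>T\<^esub>z\<in>?Z. \<phi> ((f \<otimes>\<^bsub>RM\<^esub> g) z) \<otimes>\<^bsub>T\<^esub> \<theta> z)"
    using mult_closed[OF f g] mult_supp[OF f g] Z by (intro lift_superset T \<phi> \<theta>) auto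
  also have "\<dots> = (\<Oplus>\<^bsub>T\<^esub>z\<in>?Z. \<Oplus>\<^bsub>T\<^esub>x\<in>supp f. \<Oplus>\<^bsub>T\<^esub>y\<in>supp g. ?F x y z)"
  proof (intro T.finsum_cong' refl)
    fix z assume "z \<in> ?Z"
    then have z: "z \<in> carrier M" using Z by auto
    have "\<phi> ((f \<otimes>\<^bsub>RM\<^esub> g) z) \<otimes>\<^bsub>T\<^esub> \<theta> z
      = \<phi> (\<Oplus>x\<in>supp f. \<Oplus>y\<in>supp g. if x \<otimes>\<^bsub>M\<^esub> y = z then f x \<otimes> g y else \<zero>) \<otimes>\<^bsub>T\<^esub> \<theta> z"
      using mult_coeff[OF f g fin(1) order.refl fin(2) order.refl] by simp
    also have "\<phi> (\<Oplus>x\<in>supp f. \<Oplus>y\<in>supp g. if x \<otimes>\<^bsub>M\<^esub> y = z then f x \<otimes> g y else \<zero>)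
      = (\<Oplus>\<^bsub>T\<^esub>x\<in>supp f. \<phi> (\<Oplus>y\<in>supp g. if x \<otimes>\<^bsub>M\<^esub> y = z then f x \<otimes> g y else \<zero>))"
      using f g by (subst h.hom_finsum) (auto simp: o_def)
    also have "\<dots> = (\<Oplus>\<^bsub>T\<^esub>x\<in>supp f. \<Oplus>\<^bsub>T\<^esub>y\<in>supp g. if z = x \<otimes>\<^bsub>M\<^esub> y then \<phi> (f x) \<otimes>\<^bsub>T\<^esub> \<phi> (g y) else \<zero>\<^bsub>T\<^esub>)"
      using f g by (intro T.finsum_cong' refl) (auto simp: h.hom_finsum o_def intro!: T.finsum_cong')
    also have "\<dots> \<otimes>\<^bsub>T\<^esub> \<theta> z = (\<Oplus>\<^bsub>T\<^esub>x\<in>supp f. \<Oplus>\<^bsub>T\<^esub>y\<in>supp g. ?F x y z)"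
      using f g \<theta>[OF z] fin
      by (subst T.finsum_ldistr)
        (auto intro!: T.finsum_cong' T.m_closed T.finsum_closed simp: T.finsum_ldistr)
    finally show "\<phi> ((f \<otimes>\<^bsub>RM\<^esub> g) z) \<otimes>\<^bsub>T\<^esub> \<theta> z = (\<Oplus>\<^bsub>T\<^esub>x\<in>supp f. \<Oplus>\<^bsub>T\<^esub>y\<in>supp g. ?F x y z)" .
  qed (use Z FT in \<open>auto intro!: T.finsum_closed\<close>)
  also have "\<dots> = (\<Oplus>\<^bsub>T\<^esub>x\<in>supp f. \<Oplus>\<^bsub>T\<^esub>z\<in>?Z. \<Oplus>\<^bsub>T\<^esub>y\<in>supp g. ?F x y z)"
    using Z fin FT by (intro T.finsum_swap T.finsum_closed) auto
  also have "\<dots> = (\<Oplus>\<^bsub>T\<^esub>x\<in>supp f. \<Oplus>\<^bsub>T\<^esub>y\<in>supp g. \<Oplus>\<^bsub>T\<^esub>z\<in>?Z. ?F x y z)"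
  proof (rule T.finsum_cong'[OF refl])
    fix x
    show "(\<Oplus>\<^bsub>T\<^esub>z\<in>?Z. \<Oplus>\<^bsub>T\<^esub>y\<in>supp g. ?F x y z) = (\<Oplus>\<^bsub>T\<^esub>y\<in>supp g. \<Oplus>\<^bsub>T\<^esub>z\<in>?Z. ?F x y z)"
    proof (rule T.finsum_swap)
      fix z y assume "z \<in> ?Z"
      then have "z \<in> carrier M" using Z by blast
      then show "?F x y z \<in> carrier T" by (rule FT)
    qed (use Z fin in auto)
  qed (use Z FT in \<open>auto intro!: T.finsum_closed\<close>)
  also have "\<dots> = (\<Oplus>\<^bsub>T\<^esub>x\<in>supp f. \<Oplus>\<^bsub>T\<^esub>y\<in>supp g. \<phi> (f x) \<otimes>\<^bsub>T\<^esub> \<phi> (g y) \<otimes>\<^bsub>T\<^esub> \<theta> (x \<otimes>\<^bsub>M\<^esub> y))"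
  proof (intro T.finsum_cong' refl)
    fix x y assume xy: "x \<in> supp f" "y \<in> supp g"
    then have "x \<in> carrier M" "y \<in> carrier M" using sub by auto
    then show "(\<Oplus>\<^bsub>T\<^esub>z\<in>?Z. ?F x y z) = \<phi> (f x) \<otimes>\<^bsub>T\<^esub> \<phi> (g y) \<otimes>\<^bsub>T\<^esub> \<theta> (x \<otimes>\<^bsub>M\<^esub> y)"
      using Z xy f g by (intro T.finsum_delta) (auto intro!: \<theta>)
  qed (use f g sub \<theta> in \<open>auto intro!: T.finsum_closed T.m_closed simp: subset_iff\<close>)
  finally show ?thesis .
qed

lemma lift_closed:
  assumes T: "cring T" and \<phi>: "\<phi> \<in> ring_hom R T"
    and \<theta>: "\<And>x. x \<in> carrier M \<Longrightarrow> \<theta> x \<in> carrier T" and f: "f \<in> carrier RM"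
  shows "monoid_ring_lift R T \<phi> \<theta> f \<in> carrier T"
proof -
  interpret T: cring T by fact
  interpret h: ring_hom_cring R T \<phi>
    using \<phi> T R.is_cring by (intro ring_hom_cringI2)
  show ?thesis unfolding monoid_ring_lift_def
    using supp_subset[OF f] f by (intro T.finsum_closed) (auto intro!: T.m_closed \<theta>)
qed

lemma mult_comm:
  assumes f: "f \<in> carrier RM" and g: "g \<in> carrier RM"
  shows "f \<otimes>\<^bsub>RM\<^esub> g = g \<otimes>\<^bsub>RM\<^esub> f"
proof
  fix z
  have fin: "finite (supp f)" "finite (supp g)" and sub: "supp f \<subseteq> carrier M" "supp g \<subseteq> carrier M"
    using f g by (auto simp: RM_simps)
  have "(f \<otimes>\<^bsub>RM\<^esub> g) z = (\<Oplus>y\<in>supp g. \<Oplus>x\<in>supp f. if x \<otimes>\<^bsub>M\<^esub> y = z then f x \<otimes> g y else \<zero>)"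
    using f g fin by (subst mult_coeff[OF f g fin(1) order.refl fin(2) order.refl], intro finsum_swap) auto
  also have "\<dots> = (\<Oplus>y\<in>supp g. \<Oplus>x\<in>supp f. if y \<otimes>\<^bsub>M\<^esub> x = z then g y \<otimes> f x else \<zero>)"
  proof (intro finsum_cong' refl)
    fix x y assume "x \<in> supp f" "y \<in> supp g"
    then have "x \<in> carrier M" "y \<in> carrier M" using sub by auto
    then show "(if x \<otimes>\<^bsub>M\<^esub> y = z then f x \<otimes> g y else \<zero>) = (if y \<otimes>\<^bsub>M\<^esub> x = z then g y \<otimes> f x else \<zero>)"
      using f g by (simp add: M.m_comm R.m_comm)
  qed (use f g in \<open>auto intro!: finsum_closed\<close>)
  also have "\<dots> = (g \<otimes>\<^bsub>RM\<^esub> f) z"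
    by (rule mult_coeff[OF g f fin(2) order.refl fin(1) order.refl, symmetric])
  finally show "(f \<otimes>\<^bsub>RM\<^esub> g) z = (g \<otimes>\<^bsub>RM\<^esub> f) z" .
qed

text \<open>
  The right-hand side is symmetric in \<open>f\<close>, \<open>g\<close>, \<open>h\<close> up to reordering of finite sums, so associativity
  follows from this formula and commutativity.
\<close>
lemma mult_triple_sum:
  assumes f: "f \<in> carrier RM" and g: "g \<in> carrier RM" and h: "h \<in> carrier RM"
  shows "((f \<otimes>\<^bsub>RM\<^esub> g) \<otimes>\<^bsub>RM\<^esub> h) w
    = (\<Oplus>x\<in>supp f. \<Oplus>y\<in>supp g. \<Oplus>t\<in>supp h.
        if x \<otimes>\<^bsub>M\<^esub> y \<otimes>\<^bsub>M\<^esub> t = w then f x \<otimes> g y \<otimes> h t else \<zero>)"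
proof -
  note fg = mult_closed[OF f g]
  define \<theta> where "\<theta> = (\<lambda>z. \<Oplus>t\<in>supp h. if z \<otimes>\<^bsub>M\<^esub> t = w then h t else \<zero>)"
  have \<theta>: "\<theta> z \<in> carrier R" for z
    unfolding \<theta>_def using h by (auto intro!: finsum_closed)
  have id: "(\<lambda>x. x) \<in> ring_hom R R" by (auto simp: ring_hom_def)
  have \<theta>_mult: "a \<otimes> \<theta> z = (\<Oplus>t\<in>supp h. if z \<otimes>\<^bsub>M\<^esub> t = w then a \<otimes> h t else \<zero>)"
    if "a \<in> carrier R" for a z
    unfolding \<theta>_def using that h finite_supp[OF h]
    by (subst finsum_rdistr) (auto intro!: finsum_cong')
  have "((f \<otimes>\<^bsub>RM\<^esub> g) \<otimes>\<^bsub>RM\<^esub> h) w = monoid_ring_lift R R (\<lambda>x. x) \<theta> (f \<otimes>\<^bsub>RM\<^esub> g)"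
    unfolding monoid_ring_lift_def using fg \<theta>
    by (subst mult_coeff[OF fg h finite_supp[OF fg] order.refl finite_supp[OF h] order.refl])
      (auto simp: \<theta>_mult[symmetric] intro!: finsum_cong')
  also have "\<dots> = (\<Oplus>x\<in>supp f. \<Oplus>y\<in>supp g. f x \<otimes> g y \<otimes> \<theta> (x \<otimes>\<^bsub>M\<^esub> y))"
    using \<theta> by (rule lift_mult_double_sum[OF R.is_cring id _ f g])
  finally show ?thesis
    using f g h by (simp add: \<theta>_mult)
qed

lemma mult_assoc:
  assumes f: "f \<in> carrier RM" and g: "g \<in> carrier RM" and h: "h \<in> carrier RM"
  shows "(f \<otimes>\<^bsub>RM\<^esub> g) \<otimes>\<^bsub>RM\<^esub> h = f \<otimes>\<^bsub>RM\<^esub> (g \<otimes>\<^bsub>RM\<^esub> h)"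
proof
  fix w
  have sub: "supp f \<subseteq> carrier M" "supp g \<subseteq> carrier M" "supp h \<subseteq> carrier M"
    using f g h by (auto simp: RM_simps)
  note fin = finite_supp[OF f] finite_supp[OF g] finite_supp[OF h]
  let ?F = "\<lambda>x y t. if x \<otimes>\<^bsub>M\<^esub> y \<otimes>\<^bsub>M\<^esub> t = w then f x \<otimes> g y \<otimes> h t else \<zero>"
  have F: "?F x y t \<in> carrier R" for x y t using f g h by auto
  have "(f \<otimes>\<^bsub>RM\<^esub> (g \<otimes>\<^bsub>RM\<^esub> h)) w = ((g \<otimes>\<^bsub>RM\<^esub> h) \<otimes>\<^bsub>RM\<^esub> f) w"
    using mult_comm[OF f mult_closed[OF g h]] by simp
  also have "\<dots> = (\<Oplus>y\<in>supp g. \<Oplus>t\<in>supp h. \<Oplus>x\<in>supp f.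
        if y \<otimes>\<^bsub>M\<^esub> t \<otimes>\<^bsub>M\<^esub> x = w then g y \<otimes> h t \<otimes> f x else \<zero>)"
    by (rule mult_triple_sum[OF g h f])
  also have "\<dots> = (\<Oplus>y\<in>supp g. \<Oplus>t\<in>supp h. \<Oplus>x\<in>supp f. ?F x y t)"
  proof (intro finsum_cong' refl)
    fix x y t assume "x \<in> supp f" "y \<in> supp g" "t \<in> supp h"
    then have "x \<in> carrier M" "y \<in> carrier M" "t \<in> carrier M" using sub by auto
    then have "y \<otimes>\<^bsub>M\<^esub> t \<otimes>\<^bsub>M\<^esub> x = x \<otimes>\<^bsub>M\<^esub> y \<otimes>\<^bsub>M\<^esub> t" by (simp add: M.m_ac)
    moreover have "g y \<otimes> h t \<otimes> f x = f x \<otimes> g y \<otimes> h t"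
      using f g h by (simp add: R.m_ac)
    ultimately show "(if y \<otimes>\<^bsub>M\<^esub> t \<otimes>\<^bsub>M\<^esub> x = w then g y \<otimes> h t \<otimes> f x else \<zero>) = ?F x y t" by simp
  qed (use F in \<open>auto intro!: finsum_closed\<close>)
  also have "\<dots> = (\<Oplus>y\<in>supp g. \<Oplus>x\<in>supp f. \<Oplus>t\<in>supp h. ?F x y t)"
  proof (rule finsum_cong'[OF refl])
    fix y
    show "(\<Oplus>t\<in>supp h. \<Oplus>x\<in>supp f. ?F x y t) = (\<Oplus>x\<in>supp f. \<Oplus>t\<in>supp h. ?F x y t)"
      using F fin by (intro finsum_swap) auto
  qed (use F in \<open>auto intro!: finsum_closed\<close>)
  also have "\<dots> = (\<Oplus>x\<in>supp f. \<Oplus>y\<in>supp g. \<Oplus>t\<in>supp h. ?F x y t)"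
    using F fin by (intro finsum_swap finsum_closed) auto
  also have "\<dots> = ((f \<otimes>\<^bsub>RM\<^esub> g) \<otimes>\<^bsub>RM\<^esub> h) w"
    by (rule mult_triple_sum[OF f g h, symmetric])
  finally show "((f \<otimes>\<^bsub>RM\<^esub> g) \<otimes>\<^bsub>RM\<^esub> h) w = (f \<otimes>\<^bsub>RM\<^esub> (g \<otimes>\<^bsub>RM\<^esub> h)) w" by simp
qed

lemma single_closed [simp]:
  "x \<in> carrier M \<Longrightarrow> c \<in> carrier R \<Longrightarrow> single R x c \<in> carrier RM"
  by (auto simp: RM_simps single_def)

lemma single_mult_coeff:
  assumes x: "x \<in> carrier M" "c \<in> carrier R" and g: "g \<in> carrier RM" and V: "finite V" "supp g \<subseteq> V"
  shows "(single R x c \<otimes>\<^bsub>RM\<^esub> g) z = (\<Oplus>y\<in>V. if x \<otimes>\<^bsub>M\<^esub> y = z then c \<otimes> g y else \<zero>)"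
proof -
  have "(single R x c \<otimes>\<^bsub>RM\<^esub> g) z
      = (\<Oplus>x'\<in>{x}. \<Oplus>y\<in>V. if x' \<otimes>\<^bsub>M\<^esub> y = z then single R x c x' \<otimes> g y else \<zero>)"
    using x by (intro mult_coeff[OF single_closed g _ _ V]) (auto simp: single_def)
  also have "\<dots> = (\<Oplus>y\<in>V. if x \<otimes>\<^bsub>M\<^esub> y = z then single R x c x \<otimes> g y else \<zero>)"
    using x g by simp
  also have "\<dots> = (\<Oplus>y\<in>V. if x \<otimes>\<^bsub>M\<^esub> y = z then c \<otimes> g y else \<zero>)"
    by (simp add: single_def cong: if_cong)
  finally show ?thesis .
qed

lemma single_mult:
  assumes "x \<in> carrier M" "c \<in> carrier R" "y \<in> carrier M" "d \<in> carrier R"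
  shows "single R x c \<otimes>\<^bsub>RM\<^esub> single R y d = single R (x \<otimes>\<^bsub>M\<^esub> y) (c \<otimes> d)"
proof
  fix z
  have "(single R x c \<otimes>\<^bsub>RM\<^esub> single R y d) z
      = (\<Oplus>y'\<in>{y}. if x \<otimes>\<^bsub>M\<^esub> y' = z then c \<otimes> single R y d y' else \<zero>)"
    using assms by (intro single_mult_coeff single_closed) (auto simp: single_def)
  then show "(single R x c \<otimes>\<^bsub>RM\<^esub> single R y d) z = single R (x \<otimes>\<^bsub>M\<^esub> y) (c \<otimes> d) z"
    using assms by (auto simp: single_def)
qed

lemma one_mult:
  assumes g: "g \<in> carrier RM"
  shows "\<one>\<^bsub>RM\<^esub> \<otimes>\<^bsub>RM\<^esub> g = g"
proof
  fix z
  have sub: "supp g \<subseteq> carrier M" using g by (auto simp: RM_simps)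
  have "(\<one>\<^bsub>RM\<^esub> \<otimes>\<^bsub>RM\<^esub> g) z
      = (\<Oplus>y\<in>insert z (supp g). if \<one>\<^bsub>M\<^esub> \<otimes>\<^bsub>M\<^esub> y = z then \<one> \<otimes> g y else \<zero>)"
    unfolding RM_simps(3) using g finite_supp[OF g] by (intro single_mult_coeff) auto
  also have "\<dots> = (\<Oplus>y\<in>insert z (supp g). if y = z then g y else \<zero>)"
  proof (intro finsum_cong' refl)
    fix y assume "y \<in> insert z (supp g)"
    show "(if \<one>\<^bsub>M\<^esub> \<otimes>\<^bsub>M\<^esub> y = z then \<one> \<otimes> g y else \<zero>) = (if y = z then g y else \<zero>)"
    proof (cases "y \<in> carrier M")
      case False
      then have "g y = \<zero>" using sub by auto
      then show ?thesis by auto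
    qed (use g in auto)
  qed (use g in auto)
  also have "\<dots> = g z"
    using g finite_supp[OF g] by (intro finsum_delta) auto
  finally show "(\<one>\<^bsub>RM\<^esub> \<otimes>\<^bsub>RM\<^esub> g) z = g z" .
qed

lemma add_closed:
  assumes f: "f \<in> carrier RM" and g: "g \<in> carrier RM"
  shows "f \<oplus>\<^bsub>RM\<^esub> g \<in> carrier RM"
proof -
  have "supp (\<lambda>x. f x \<oplus> g x) \<subseteq> supp f \<union> supp g" by auto
  moreover have "finite (supp f \<union> supp g)" "supp f \<union> supp g \<subseteq> carrier M"
    using f g by (auto simp: RM_simps)
  ultimately show ?thesis
    using f g by (simp add: RM_simps finite_subset subset_trans)
qed

lemma add_mult:
  assumes f: "f \<in> carrier RM" and f': "f' \<in> carrier RM" and g: "g \<in> carrier RM"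
  shows "(f \<oplus>\<^bsub>RM\<^esub> f') \<otimes>\<^bsub>RM\<^esub> g = f \<otimes>\<^bsub>RM\<^esub> g \<oplus>\<^bsub>RM\<^esub> f' \<otimes>\<^bsub>RM\<^esub> g"
proof
  fix z
  let ?U = "supp f \<union> supp f'"
  have ff: "f \<oplus>\<^bsub>RM\<^esub> f' \<in> carrier RM"
    by (rule add_closed[OF f f'])
  have fin: "finite ?U"
    using f f' by (auto simp: RM_simps)
  have sub: "supp (f \<oplus>\<^bsub>RM\<^esub> f') \<subseteq> ?U" by (auto simp: RM_simps)
  note fin_g = finite_supp[OF g]
  let ?F = "\<lambda>f x y. if x \<otimes>\<^bsub>M\<^esub> y = z then f x \<otimes> g y else \<zero>"
  have F: "?F h x y \<in> carrier R" if "h \<in> carrier RM" for h x y using that g by auto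
  have "((f \<oplus>\<^bsub>RM\<^esub> f') \<otimes>\<^bsub>RM\<^esub> g) z = (\<Oplus>x\<in>?U. \<Oplus>y\<in>supp g. ?F (f \<oplus>\<^bsub>RM\<^esub> f') x y)"
    by (rule mult_coeff[OF ff g fin sub fin_g order.refl])
  also have "\<dots> = (\<Oplus>x\<in>?U. (\<Oplus>y\<in>supp g. ?F f x y) \<oplus> (\<Oplus>y\<in>supp g. ?F f' x y))"
  proof (intro finsum_cong' refl)
    fix x
    have "(\<Oplus>y\<in>supp g. ?F (f \<oplus>\<^bsub>RM\<^esub> f') x y) = (\<Oplus>y\<in>supp g. ?F f x y \<oplus> ?F f' x y)"
      using f f' g by (intro finsum_cong') (auto simp: RM_simps(4) R.l_distr)
    also have "\<dots> = (\<Oplus>y\<in>supp g. ?F f x y) \<oplus> (\<Oplus>y\<in>supp g. ?F f' x y)"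
      using F[OF f] F[OF f'] by (intro finsum_addf) auto
    finally show "(\<Oplus>y\<in>supp g. ?F (f \<oplus>\<^bsub>RM\<^esub> f') x y)
      = (\<Oplus>y\<in>supp g. ?F f x y) \<oplus> (\<Oplus>y\<in>supp g. ?F f' x y)" .
  qed (use F[OF f] F[OF f'] in \<open>auto intro!: finsum_closed\<close>)
  also have "\<dots> = (\<Oplus>x\<in>?U. \<Oplus>y\<in>supp g. ?F f x y) \<oplus> (\<Oplus>x\<in>?U. \<Oplus>y\<in>supp g. ?F f' x y)"
    using F[OF f] F[OF f'] by (intro finsum_addf) (auto intro!: finsum_closed)
  also have "\<dots> = (f \<otimes>\<^bsub>RM\<^esub> g \<oplus>\<^bsub>RM\<^esub> f' \<otimes>\<^bsub>RM\<^esub> g) z"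
    using mult_coeff[OF f g fin _ fin_g order.refl] mult_coeff[OF f' g fin _ fin_g order.refl]
    by (simp add: RM_simps(4))
  finally show "((f \<oplus>\<^bsub>RM\<^esub> f') \<otimes>\<^bsub>RM\<^esub> g) z = (f \<otimes>\<^bsub>RM\<^esub> g \<oplus>\<^bsub>RM\<^esub> f' \<otimes>\<^bsub>RM\<^esub> g) z" .
qed

sublocale RM: cring RM
proof (rule cringI)
  show "abelian_group RM"
  proof (rule abelian_groupI)
    fix f g assume "f \<in> carrier RM" "g \<in> carrier RM"
    then show "f \<oplus>\<^bsub>RM\<^esub> g \<in> carrier RM" by (rule add_closed)
  next
    fix f assume f: "f \<in> carrier RM"
    have "supp (\<lambda>x. \<ominus> f x) \<subseteq> supp f" by auto
    then have "(\<lambda>x. \<ominus> f x) \<in> carrier RM"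
      using f finite_supp[OF f] supp_subset[OF f] by (auto simp: RM_simps intro: finite_subset)
    moreover have "(\<lambda>x. \<ominus> f x) \<oplus>\<^bsub>RM\<^esub> f = \<zero>\<^bsub>RM\<^esub>"
      using f by (auto simp: RM_simps R.l_neg)
    ultimately show "\<exists>g\<in>carrier RM. g \<oplus>\<^bsub>RM\<^esub> f = \<zero>\<^bsub>RM\<^esub>" by blast
  qed (auto simp: RM_simps R.a_ac)
  show "comm_monoid RM"
    using mult_closed mult_assoc one_mult mult_comm
    by (intro comm_monoidI) (auto simp: RM_simps(3))
qed (simp add: add_mult)

lemma RM_is_cring: "cring RM" ..

lemma coeff_finsum:
  assumes "finite A" "\<And>a. a \<in> A \<Longrightarrow> F a \<in> carrier RM"
  shows "(\<Oplus>\<^bsub>RM\<^esub>a\<in>A. F a) x = (\<Oplus>a\<in>A. F a x)"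
  using assms
proof (induction A)
  case (insert a A)
  then have "(\<Oplus>\<^bsub>RM\<^esub>a\<in>insert a A. F a) = F a \<oplus>\<^bsub>RM\<^esub> (\<Oplus>\<^bsub>RM\<^esub>a\<in>A. F a)"
    by (intro RM.finsum_insert) auto
  moreover have "(\<Oplus>a\<in>insert a A. F a x) = F a x \<oplus> (\<Oplus>a\<in>A. F a x)"
    using insert by (intro R.finsum_insert) auto
  ultimately show ?case using insert by (simp add: RM_simps(4))
qed (simp add: RM_simps)

text \<open>
  A set \<open>U\<close> larger than the support is allowed, since applying a ring homomorphism to the coefficients
  can make the support smaller.
\<close>
lemma sum_of_terms:
  assumes f: "f \<in> carrier RM" and "finite U" "supp f \<subseteq> U" "U \<subseteq> carrier M"
  shows "f = (\<Oplus>\<^bsub>RM\<^esub>x\<in>U. single R \<one>\<^bsub>M\<^esub> (f x) \<otimes>\<^bsub>RM\<^esub> single R x \<one>)"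
proof
  fix z
  have s: "single R \<one>\<^bsub>M\<^esub> (f x) \<otimes>\<^bsub>RM\<^esub> single R x \<one> = single R x (f x)" if "x \<in> U" for x
    using f that assms by (subst single_mult) auto
  have "(\<Oplus>\<^bsub>RM\<^esub>x\<in>U. single R \<one>\<^bsub>M\<^esub> (f x) \<otimes>\<^bsub>RM\<^esub> single R x \<one>) = (\<Oplus>\<^bsub>RM\<^esub>x\<in>U. single R x (f x))"
    using assms s by (intro RM.finsum_cong') auto
  then have "(\<Oplus>\<^bsub>RM\<^esub>x\<in>U. single R \<one>\<^bsub>M\<^esub> (f x) \<otimes>\<^bsub>RM\<^esub> single R x \<one>) z = (\<Oplus>\<^bsub>RM\<^esub>x\<in>U. single R x (f x)) z"
    by simp
  also have "\<dots> = (\<Oplus>x\<in>U. single R x (f x) z)"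
    using assms by (intro coeff_finsum) auto
  also have "\<dots> = (\<Oplus>x\<in>U. if x = z then f x else \<zero>)"
    using f by (intro finsum_cong') (auto simp: single_def)
  also have "\<dots> = (\<Oplus>x\<in>insert z U. if x = z then f x else \<zero>)"
    using assms by (intro finsum_superset) auto
  also have "\<dots> = f z" using assms by (intro finsum_delta) auto
  finally show "f z = (\<Oplus>\<^bsub>RM\<^esub>x\<in>U. single R \<one>\<^bsub>M\<^esub> (f x) \<otimes>\<^bsub>RM\<^esub> single R x \<one>) z" by simp
qed

lemma const_hom: "single R \<one>\<^bsub>M\<^esub> \<in> ring_hom R RM"
  
proof (rule ring_hom_memI)
  fix a b assume "a \<in> carrier R" "b \<in> carrier R"
  then show "single R \<one>\<^bsub>M\<^esub> (a \<otimes> b) = single R \<one>\<^bsub>M\<^esub> a \<otimes>\<^bsub>RM\<^esub> single R \<one>\<^bsub>M\<^esub> b"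
    by (simp add: single_mult)
  from \<open>a \<in> carrier R\<close> \<open>b \<in> carrier R\<close>
  show "single R \<one>\<^bsub>M\<^esub> (a \<oplus> b) = single R \<one>\<^bsub>M\<^esub> a \<oplus>\<^bsub>RM\<^esub> single R \<one>\<^bsub>M\<^esub> b"
    by (auto simp: RM_simps(4) single_def)
qed (simp_all add: RM_simps(3))

text \<open>
  Uniqueness in the universal property: a ring homomorphism is determined by its values on constants and
  on monoid elements, because every element is a sum of products of these.
\<close>
lemma hom_eq_lift:
  assumes T: "cring T" and \<Lambda>: "\<Lambda> \<in> ring_hom RM T" and f: "f \<in> carrier RM"
  shows "\<Lambda> f = monoid_ring_lift R T (\<lambda>c. \<Lambda> (single R \<one>\<^bsub>M\<^esub> c)) (\<lambda>x. \<Lambda> (single R x \<one>)) f"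
proof -
  interpret h: ring_hom_cring RM T \<Lambda>
    using T \<Lambda> RM_is_cring by (intro ring_hom_cringI2)
  have cl: "x \<in> supp f \<Longrightarrow> x \<in> carrier M" for x using supp_subset[OF f] by auto
  have "\<Lambda> f = \<Lambda> (\<Oplus>\<^bsub>RM\<^esub>x\<in>supp f. single R \<one>\<^bsub>M\<^esub> (f x) \<otimes>\<^bsub>RM\<^esub> single R x \<one>)"
    using sum_of_terms[OF f finite_supp[OF f] order.refl supp_subset[OF f]] by (rule arg_cong)
  also have "\<dots> = monoid_ring_lift R T (\<lambda>c. \<Lambda> (single R \<one>\<^bsub>M\<^esub> c)) (\<lambda>x. \<Lambda> (single R x \<one>)) f"
    unfolding monoid_ring_lift_def using f cl
    by (subst h.hom_finsum) (auto intro!: h.S.finsum_cong' simp: o_def)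
  finally show ?thesis .
qed

lemma lift_hom:
  assumes T: "cring T" and \<phi>: "\<phi> \<in> ring_hom R T"
    and \<theta>: "\<And>x. x \<in> carrier M \<Longrightarrow> \<theta> x \<in> carrier T"
      "\<And>x y. x \<in> carrier M \<Longrightarrow> y \<in> carrier M \<Longrightarrow> \<theta> (x \<otimes>\<^bsub>M\<^esub> y) = \<theta> x \<otimes>\<^bsub>T\<^esub> \<theta> y"
      "\<theta> \<one>\<^bsub>M\<^esub> = \<one>\<^bsub>T\<^esub>"
  shows "monoid_ring_lift R T \<phi> \<theta> \<in> ring_hom RM T"
proof -
  interpret T: cring T by fact
  interpret h: ring_hom_cring R T \<phi>
    using \<phi> T R.is_cring by (intro ring_hom_cringI2)
  show ?thesis
  proof (rule ring_hom_memI)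
    fix f assume "f \<in> carrier RM"
    then show "monoid_ring_lift R T \<phi> \<theta> f \<in> carrier T" by (intro lift_closed T \<phi> \<theta>)
  next
    fix f g assume f: "f \<in> carrier RM" and g: "g \<in> carrier RM"
    have cl: "x \<in> supp f \<Longrightarrow> x \<in> carrier M" "x \<in> supp g \<Longrightarrow> x \<in> carrier M" for x
      using supp_subset f g by auto
    let ?L = "monoid_ring_lift R T \<phi> \<theta>"
    let ?U = "supp f \<union> supp g"
    have U: "finite ?U" "?U \<subseteq> carrier M" using f g by (auto simp: RM_simps)
    have "?L f \<otimes>\<^bsub>T\<^esub> ?L g
      = (\<Oplus>\<^bsub>T\<^esub>x\<in>supp f. \<Oplus>\<^bsub>T\<^esub>y\<in>supp g. (\<phi> (f x) \<otimes>\<^bsub>T\<^esub> \<theta> x) \<otimes>\<^bsub>T\<^esub> (\<phi> (g y) \<otimes>\<^bsub>T\<^esub> \<theta> y))"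
      unfolding monoid_ring_lift_def using f g cl \<theta> finite_supp
      by (subst T.finsum_ldistr) (auto intro!: T.finsum_cong' T.finsum_closed T.m_closed simp: T.finsum_rdistr)
    also have "\<dots> = (\<Oplus>\<^bsub>T\<^esub>x\<in>supp f. \<Oplus>\<^bsub>T\<^esub>y\<in>supp g. \<phi> (f x) \<otimes>\<^bsub>T\<^esub> \<phi> (g y) \<otimes>\<^bsub>T\<^esub> \<theta> (x \<otimes>\<^bsub>M\<^esub> y))"
      using f g cl \<theta> by (intro T.finsum_cong' refl) (auto intro!: T.finsum_closed T.m_closed simp: T.m_ac)
    also have "\<dots> = ?L (f \<otimes>\<^bsub>RM\<^esub> g)"
      by (rule lift_mult_double_sum[OF T \<phi> \<theta>(1) f g, symmetric])
    finally show "?L (f \<otimes>\<^bsub>RM\<^esub> g) = ?L f \<otimes>\<^bsub>T\<^esub> ?L g" by simp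
    have "?L (f \<oplus>\<^bsub>RM\<^esub> g) = (\<Oplus>\<^bsub>T\<^esub>x\<in>?U. \<phi> ((f \<oplus>\<^bsub>RM\<^esub> g) x) \<otimes>\<^bsub>T\<^esub> \<theta> x)"
      using U RM.a_closed[OF f g] by (intro lift_superset T \<phi> \<theta>(1)) (auto simp: RM_simps(4))
    also have "\<dots> = (\<Oplus>\<^bsub>T\<^esub>x\<in>?U. \<phi> (f x) \<otimes>\<^bsub>T\<^esub> \<theta> x \<oplus>\<^bsub>T\<^esub> \<phi> (g x) \<otimes>\<^bsub>T\<^esub> \<theta> x)"
      using f g U \<theta> by (intro T.finsum_cong') (auto simp: RM_simps(4) T.l_distr)
    also have "\<dots> = (\<Oplus>\<^bsub>T\<^esub>x\<in>?U. \<phi> (f x) \<otimes>\<^bsub>T\<^esub> \<theta> x) \<oplus>\<^bsub>T\<^esub> (\<Oplus>\<^bsub>T\<^esub>x\<in>?U. \<phi> (g x) \<otimes>\<^bsub>T\<^esub> \<theta> x)"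
      using f g U \<theta> by (intro T.finsum_addf) auto
    also have "\<dots> = ?L f \<oplus>\<^bsub>T\<^esub> ?L g"
      using f g U by (subst (1 2) lift_superset[OF T \<phi> \<theta>(1), where U = ?U]) auto
    finally show "?L (f \<oplus>\<^bsub>RM\<^esub> g) = ?L f \<oplus>\<^bsub>T\<^esub> ?L g" .
  next
    have "monoid_ring_lift R T \<phi> \<theta> \<one>\<^bsub>RM\<^esub> = (\<Oplus>\<^bsub>T\<^esub>x\<in>{\<one>\<^bsub>M\<^esub>}. \<phi> (\<one>\<^bsub>RM\<^esub> x) \<otimes>\<^bsub>T\<^esub> \<theta> x)"
      by (intro lift_superset T \<phi> \<theta>(1) RM.one_closed) (auto simp: RM_simps(3) single_def)
    then show "monoid_ring_lift R T \<phi> \<theta> \<one>\<^bsub>RM\<^esub> = \<one>\<^bsub>T\<^esub>"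
      using \<theta> by (simp add: RM_simps(3) single_def)
  qed
qed

lemma lift_single:
  assumes T: "cring T" and \<phi>: "\<phi> \<in> ring_hom R T"
    and \<theta>: "\<And>x. x \<in> carrier M \<Longrightarrow> \<theta> x \<in> carrier T" and "x \<in> carrier M" "c \<in> carrier R"
  shows "monoid_ring_lift R T \<phi> \<theta> (single R x c) = \<phi> c \<otimes>\<^bsub>T\<^esub> \<theta> x"
proof -
  interpret T: cring T by fact
  interpret h: ring_hom_cring R T \<phi>
    using \<phi> T R.is_cring by (intro ring_hom_cringI2)
  have "monoid_ring_lift R T \<phi> \<theta> (single R x c) = (\<Oplus>\<^bsub>T\<^esub>x'\<in>{x}. \<phi> (single R x c x') \<otimes>\<^bsub>T\<^esub> \<theta> x')"
    using assms by (intro lift_superset T \<phi> \<theta> single_closed) (auto simp: single_def)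
  then show ?thesis using assms by (simp add: single_def)
qed

end

context monoid_algebra
begin

lemma hom_unique:
  assumes T: "cring T" and "\<Lambda> \<in> ring_hom RM T" "\<Lambda>' \<in> ring_hom RM T"
    and "\<And>c. c \<in> carrier R \<Longrightarrow> \<Lambda> (single R \<one>\<^bsub>M\<^esub> c) = \<Lambda>' (single R \<one>\<^bsub>M\<^esub> c)"
    and eq: "\<And>x. x \<in> carrier M \<Longrightarrow> \<Lambda> (single R x \<one>) = \<Lambda>' (single R x \<one>)"
    and f: "f \<in> carrier RM"
  shows "\<Lambda> f = \<Lambda>' f"
proof -
  interpret T: cring T by fact
  have cl: "\<Lambda>' u \<in> carrier T" if "u \<in> carrier RM" for u using that assms(3) by (rule ring_hom_closed[rotated])
  show ?thesis
    unfolding hom_eq_lift[OF T assms(2) f] hom_eq_lift[OF T assms(3) f] monoid_ring_lift_def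
    using f supp_subset[OF f] assms(4,5) cl by (intro T.finsum_cong') auto
qed

text \<open>
  The elements of \<open>R\<close> whose constants lie in the ideal generated by the constants from \<open>Z\<close> form an ideal
  that contains \<open>Z\<close>.
\<close>
lemma const_mem_extended_ideal:
  assumes Z: "Z \<subseteq> carrier R" and t: "t \<in> Idl\<^bsub>R\<^esub> Z"
  shows "single R \<one>\<^bsub>M\<^esub> t \<in> Idl\<^bsub>RM\<^esub> (single R \<one>\<^bsub>M\<^esub> ` Z)"
proof -
  let ?c = "single R \<one>\<^bsub>M\<^esub>" and ?D = "Idl\<^bsub>RM\<^esub> (single R \<one>\<^bsub>M\<^esub> ` Z)"
  interpret c: ring_hom_cring R RM ?c
    using const_hom R.is_cring RM_is_cring by (intro ring_hom_cringI2)
  have cZ: "?c ` Z \<subseteq> carrier RM" using Z by (auto intro!: c.hom_closed)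
  have "ideal {r \<in> carrier R. ?c r \<in> ?D} R"
    by (rule c.ring.ideal_vimage) (rule RM.genideal_ideal[OF cZ])
  moreover have "Z \<subseteq> {r \<in> carrier R. ?c r \<in> ?D}"
    using Z RM.genideal_self[OF cZ] by auto
  ultimately have "Idl\<^bsub>R\<^esub> Z \<subseteq> {r \<in> carrier R. ?c r \<in> ?D}"
    by (rule R.genideal_minimal)
  then show ?thesis using t by auto
qed

text \<open>
  An element of the monoid ring whose coefficients lie in the extension of \<open>Z\<close> is a combination of
  constants from that extension.
\<close>
lemma const_mult_mem_extended_ideal:
  assumes Z: "Z \<subseteq> carrier R" and e: "e \<in> carrier R" and f: "f \<in> carrier RM"
    and ef: "\<And>x. e \<otimes> f x \<in> Idl\<^bsub>R\<^esub> Z"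
  shows "single R \<one>\<^bsub>M\<^esub> e \<otimes>\<^bsub>RM\<^esub> f \<in> Idl\<^bsub>RM\<^esub> (single R \<one>\<^bsub>M\<^esub> ` Z)"
proof -
  let ?c = "single R \<one>\<^bsub>M\<^esub>" and ?D = "Idl\<^bsub>RM\<^esub> (single R \<one>\<^bsub>M\<^esub> ` Z)"
  interpret c: ring_hom_cring R RM ?c
    using const_hom R.is_cring RM_is_cring by (intro ring_hom_cringI2)
  interpret D: ideal ?D RM
    using Z by (intro RM.genideal_ideal) (auto intro!: c.hom_closed)
  let ?t = "\<lambda>x. ?c (f x) \<otimes>\<^bsub>RM\<^esub> single R x \<one>"
  have cl: "x \<in> carrier M" if "x \<in> supp f" for x using that supp_subset[OF f] by auto
  have t: "?t x \<in> carrier RM" if "x \<in> supp f" for x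
    by (rule RM.m_closed[OF c.hom_closed[OF coeff_closed[OF f]] single_closed[OF cl[OF that] R.one_closed]])
  have "?c e \<otimes>\<^bsub>RM\<^esub> f = ?c e \<otimes>\<^bsub>RM\<^esub> (\<Oplus>\<^bsub>RM\<^esub>x\<in>supp f. ?t x)"
    using sum_of_terms[OF f finite_supp[OF f] order.refl supp_subset[OF f]] by (rule arg_cong)
  also have "\<dots> = (\<Oplus>\<^bsub>RM\<^esub>x\<in>supp f. ?c e \<otimes>\<^bsub>RM\<^esub> ?t x)"
    using t e by (intro RM.finsum_rdistr finite_supp[OF f] c.hom_closed) auto
  also have "\<dots> \<in> ?D"
  proof (rule D.finsum_mem)
    fix x assume x: "x \<in> supp f"
    have "?c e \<otimes>\<^bsub>RM\<^esub> ?t x = ?c (e \<otimes> f x) \<otimes>\<^bsub>RM\<^esub> single R x \<one>"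
      using e f cl[OF x] by (simp add: c.hom_mult RM.m_assoc)
    then show "?c e \<otimes>\<^bsub>RM\<^esub> ?t x \<in> ?D"
      using D.I_r_closed[OF const_mem_extended_ideal[OF Z ef] single_closed[OF cl[OF x] R.one_closed]]
      by simp
  qed
  finally show ?thesis .
qed

text \<open>
  Applying \<open>\<pi>\<close> to the coefficients is the lift of \<open>\<pi>\<close> and of the inclusion of the monoid.
\<close>
lemma map_coeffs_hom:
  assumes T: "cring T" and \<pi>: "\<pi> \<in> ring_hom R T"
  shows "(\<lambda>f x. \<pi> (f x)) \<in> ring_hom RM (monoid_ring T M)"
proof -
  interpret T: monoid_algebra T M
    using T M.comm_monoid_axioms by (rule monoid_algebra.intro)
  interpret \<pi>: ring_hom_cring R T \<pi> using \<pi> R.is_cring T by (intro ring_hom_cringI2)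
  have c: "(\<lambda>c. single T \<one>\<^bsub>M\<^esub> (\<pi> c)) \<in> ring_hom R T.RM"
    using ring_hom_trans[OF \<pi> T.const_hom] by (simp add: o_def)
  have eq: "(\<lambda>x. \<pi> (f x)) = monoid_ring_lift R T.RM (\<lambda>c. single T \<one>\<^bsub>M\<^esub> (\<pi> c)) (\<lambda>x. single T x \<one>\<^bsub>T\<^esub>) f"
    if f: "f \<in> carrier RM" for f
  proof -
    have "T.supp (\<lambda>x. \<pi> (f x)) \<subseteq> supp f" by auto
    moreover from this have "(\<lambda>x. \<pi> (f x)) \<in> carrier T.RM"
      using f finite_supp[OF f] supp_subset[OF f] by (auto simp: T.RM_simps(1) intro: finite_subset)
    ultimately show ?thesis
      unfolding monoid_ring_lift_def
      by (intro T.sum_of_terms finite_supp[OF f] supp_subset[OF f])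
  qed
  have "monoid_ring_lift R T.RM (\<lambda>c. single T \<one>\<^bsub>M\<^esub> (\<pi> c)) (\<lambda>x. single T x \<one>\<^bsub>T\<^esub>) \<in> ring_hom RM T.RM"
    by (rule lift_hom[OF T.RM_is_cring c]) (auto simp: T.single_mult T.RM_simps(3))
  then show ?thesis
    using eq RM.m_closed RM.a_closed RM.one_closed by (simp add: ring_hom_def Pi_def)
qed

lemma map_coeffs_single:
  assumes T: "cring T" and \<pi>: "\<pi> \<in> ring_hom R T"
  shows "(\<lambda>y. \<pi> (single R x c y)) = single T x (\<pi> c)"
proof -
  interpret \<pi>: ring_hom_cring R T \<pi> using \<pi> R.is_cring T by (intro ring_hom_cringI2)
  show ?thesis by (auto simp: single_def)
qed

lemma map_coeffs_surj:
  assumes T: "cring T" and \<pi>: "\<pi> \<in> ring_hom R T" and surj: "\<pi> ` carrier R = carrier T"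
  shows "(\<lambda>f x. \<pi> (f x)) ` carrier RM = carrier (monoid_ring T M)"
proof
  interpret T: monoid_algebra T M
    using T M.comm_monoid_axioms by (rule monoid_algebra.intro)
  interpret \<pi>: ring_hom_cring R T \<pi> using \<pi> R.is_cring T by (intro ring_hom_cringI2)
  show "(\<lambda>f x. \<pi> (f x)) ` carrier RM \<subseteq> carrier T.RM"
    using map_coeffs_hom[OF T \<pi>] by (auto dest: ring_hom_closed)
  show "carrier T.RM \<subseteq> (\<lambda>f x. \<pi> (f x)) ` carrier RM"
  proof
    fix f' assume f': "f' \<in> carrier T.RM"
    have "\<exists>c. c \<in> carrier R \<and> \<pi> c = t" if "t \<in> carrier T" for t
      using that unfolding surj[symmetric] by blast
    then obtain s where s: "s t \<in> carrier R" "\<pi> (s t) = t" if "t \<in> carrier T" for t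
      by metis
    define f where "f x = (if f' x = \<zero>\<^bsub>T\<^esub> then \<zero> else s (f' x))" for x
    have "supp f \<subseteq> T.supp f'" by (auto simp: f_def)
    moreover have "f x \<in> carrier R" for x using f' s by (simp add: f_def)
    ultimately have "f \<in> carrier RM"
      using T.finite_supp[OF f'] T.supp_subset[OF f'] by (auto simp: RM_simps(1) intro: finite_subset)
    moreover have "f' = (\<lambda>x. \<pi> (f x))" using f' s by (auto simp: f_def)
    ultimately show "f' \<in> (\<lambda>f x. \<pi> (f x)) ` carrier RM" by blast
  qed
qed

end

section \<open>The fiber of an algebra over a quotient of its base ring\<close>

text \<open>
  The tensor product is a quotient of a monoid ring over \<open>\<Z>\<close>, so homomorphisms out of it need the
  canonical homomorphism from \<open>\<Z>\<close>.
\<close>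
lemma (in ring) int_multiples_hom: "(\<lambda>n::int. [n] \<cdot> \<one>) \<in> ring_hom \<Z> R"
proof (rule ring_hom_memI)
  fix m n :: int
  have "[m] \<cdot> \<one> \<otimes> [n] \<cdot> \<one> = [m] \<cdot> ([n] \<cdot> \<one>)"
    by (simp add: add_pow_ldistr_int)
  then show "[(m \<otimes>\<^bsub>\<Z>\<^esub> n)] \<cdot> \<one> = [m] \<cdot> \<one> \<otimes> [n] \<cdot> \<one>"
    by (simp add: add.int_pow_pow mult.commute)
  show "[(m \<oplus>\<^bsub>\<Z>\<^esub> n)] \<cdot> \<one> = [m] \<cdot> \<one> \<oplus> [n] \<cdot> \<one>"
    by (simp add: add.int_pow_mult)
qed auto

lemma quotient_lift:
  assumes "ideal P R" "ring B" and f: "f \<in> ring_hom R B" and zero: "\<And>p. p \<in> P \<Longrightarrow> f p = \<zero>\<^bsub>B\<^esub>"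
  shows "\<exists>\<chi> \<in> ring_hom (R Quot P) B. \<forall>r\<in>carrier R. \<chi> (P +>\<^bsub>R\<^esub> r) = f r"
proof -
  interpret P: ideal P R by fact
  interpret B: ring B by fact
  interpret f: ring_hom_ring R B f
    using assms P.ring_axioms by (intro ring_hom_ringI2)
  interpret q: ring_hom_ring R "R Quot P" "(+>\<^bsub>R\<^esub>) P" by (rule P.rcos_ring_hom_ring)
  define \<chi> where "\<chi> c = f (SOME r. r \<in> carrier R \<and> c = P +>\<^bsub>R\<^esub> r)" for c
  have \<chi>: "\<chi> (P +>\<^bsub>R\<^esub> r) = f r" if r: "r \<in> carrier R" for r
  proof -
    let ?s = "SOME s. s \<in> carrier R \<and> P +>\<^bsub>R\<^esub> r = P +>\<^bsub>R\<^esub> s"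
    have s: "?s \<in> carrier R" "P +>\<^bsub>R\<^esub> r = P +>\<^bsub>R\<^esub> ?s"
      using someI[of "\<lambda>s. s \<in> carrier R \<and> P +>\<^bsub>R\<^esub> r = P +>\<^bsub>R\<^esub> s" r] r by auto
    then have "?s \<ominus>\<^bsub>R\<^esub> r \<in> P"
      using r P.quotient_eq_iff_same_a_r_cos[OF P.is_ideal, of ?s r] by simp
    then have "f (?s \<ominus>\<^bsub>R\<^esub> r) = \<zero>\<^bsub>B\<^esub>" by (rule zero)
    then have "f ?s \<ominus>\<^bsub>B\<^esub> f r = \<zero>\<^bsub>B\<^esub>" using s(1) r by (simp add: a_minus_def)
    then show ?thesis unfolding \<chi>_def using s(1) r by simp
  qed
  have rep: "\<exists>r\<in>carrier R. c = P +>\<^bsub>R\<^esub> r" if "c \<in> carrier (R Quot P)" for c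
    using that unfolding FactRing_def A_RCOSETS_def' partial_object.simps by blast
  have "\<chi> \<in> ring_hom (R Quot P) B"
  proof (rule ring_hom_memI)
    fix c assume "c \<in> carrier (R Quot P)"
    then obtain r where "r \<in> carrier R" "c = P +>\<^bsub>R\<^esub> r" using rep by blast
    then show "\<chi> c \<in> carrier B" by (simp add: \<chi>)
  next
    fix c d assume "c \<in> carrier (R Quot P)" "d \<in> carrier (R Quot P)"
    then obtain r s where rs: "r \<in> carrier R" "c = P +>\<^bsub>R\<^esub> r" "s \<in> carrier R" "d = P +>\<^bsub>R\<^esub> s"
      using rep by meson
    have "\<chi> (c \<otimes>\<^bsub>R Quot P\<^esub> d) = \<chi> (P +>\<^bsub>R\<^esub> (r \<otimes>\<^bsub>R\<^esub> s))" using rs by (simp only: q.hom_mult)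
    also have "\<dots> = \<chi> c \<otimes>\<^bsub>B\<^esub> \<chi> d" using rs by (simp only: \<chi> P.m_closed f.hom_mult)
    finally show "\<chi> (c \<otimes>\<^bsub>R Quot P\<^esub> d) = \<chi> c \<otimes>\<^bsub>B\<^esub> \<chi> d" .
    have "\<chi> (c \<oplus>\<^bsub>R Quot P\<^esub> d) = \<chi> (P +>\<^bsub>R\<^esub> (r \<oplus>\<^bsub>R\<^esub> s))" using rs by (simp only: q.hom_add)
    also have "\<dots> = \<chi> c \<oplus>\<^bsub>B\<^esub> \<chi> d" using rs by (simp only: \<chi> P.a_closed f.hom_add)
    finally show "\<chi> (c \<oplus>\<^bsub>R Quot P\<^esub> d) = \<chi> c \<oplus>\<^bsub>B\<^esub> \<chi> d" .
  next
    have "\<chi> \<one>\<^bsub>R Quot P\<^esub> = \<chi> (P +>\<^bsub>R\<^esub> \<one>\<^bsub>R\<^esub>)" by (simp only: q.hom_one)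
    then show "\<chi> \<one>\<^bsub>R Quot P\<^esub> = \<one>\<^bsub>B\<^esub>" by (simp only: \<chi> P.one_closed f.hom_one)
  qed
  then show ?thesis using \<chi> by blast
qed

text \<open>
  An algebra \<open>A\<close> over \<open>R\<close> with structure map \<open>\<phi>\<close>, and an ideal \<open>P\<close> of \<open>R\<close>.  Below, \<open>J\<close> is the ideal of
  bilinearity relations in the free ring on pairs, and \<open>\<tau>\<close> is the projection to \<open>A \<otimes>\<^sub>R R/P\<close>.
\<close>
locale algebra_fiber =
  R: cring R + A: cring A + \<phi>: ring_hom_cring R A \<phi> + P: ideal P R
  for R :: "('r, 'u) ring_scheme" and A :: "('a, 'v) ring_scheme" and \<phi> P
begin

abbreviation "q r \<equiv> P +>\<^bsub>R\<^esub> r"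

sublocale C: cring "R Quot P"
  by (rule P.quotient_is_cring) (rule R.is_cring)
sublocale q: ring_hom_cring R "R Quot P" "q"
  by (rule P.rcos_ring_hom_cring) (rule R.is_cring)

abbreviation "AC \<equiv> A \<times>\<times> (R Quot P)"

sublocale F: monoid_algebra \<Z> AC
proof (intro monoid_algebra.intro comm_monoid.intro comm_monoid_axioms.intro)
  show "cring \<Z>" by (rule int_is_cring)
  show "Group.monoid AC" using A.monoid_axioms C.monoid_axioms by (rule DirProd_monoid)
qed (auto simp: A.m_comm C.m_comm)

abbreviation "F \<equiv> monoid_ring \<Z> AC"
abbreviation "gen a c \<equiv> single \<Z> (a, c) \<one>\<^bsub>\<Z>\<^esub>"
definition "J = Idl\<^bsub>F\<^esub> (tensor_relations R A \<phi> (R Quot P) q)"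
abbreviation "\<tau> x \<equiv> J +>\<^bsub>F\<^esub> x"

lemma gen_closed [simp]: "a \<in> carrier A \<Longrightarrow> c \<in> carrier (R Quot P) \<Longrightarrow> gen a c \<in> carrier F"
  by (rule F.single_closed) auto

lemma relations_closed: "tensor_relations R A \<phi> (R Quot P) q \<subseteq> carrier F"
  unfolding tensor_relations_def Let_def
  using F.RM.minus_closed F.RM.a_closed gen_closed A.a_closed C.a_closed A.m_closed C.m_closed
    q.hom_closed \<phi>.hom_closed by (auto 0 0 simp only:)

sublocale J: ideal J F
  unfolding J_def by (rule F.RM.genideal_ideal[OF relations_closed])

sublocale TR: cring "F Quot J"
  by (rule J.quotient_is_cring) (rule F.RM.is_cring)
sublocale \<tau>: ring_hom_cring F "F Quot J" \<tau>
  by (rule J.rcos_ring_hom_cring) (rule F.RM.is_cring)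

lemma \<tau>_eqI:
  assumes "x \<in> carrier F" "y \<in> carrier F" "x \<ominus>\<^bsub>F\<^esub> y \<in> tensor_relations R A \<phi> (R Quot P) q"
  shows "\<tau> x = \<tau> y"
proof -
  have "x \<ominus>\<^bsub>F\<^esub> y \<in> J"
    using F.RM.genideal_self[OF relations_closed] assms(3) unfolding J_def by (rule subsetD)
  then show ?thesis
    by (rule F.RM.quotient_eq_iff_same_a_r_cos[OF J.is_ideal assms(1,2), THEN iffD1])
qed

lemma \<tau>_add_left:
  assumes "a \<in> carrier A" "a' \<in> carrier A" "c \<in> carrier (R Quot P)"
  shows "\<tau> (gen (a \<oplus>\<^bsub>A\<^esub> a') c) = \<tau> (gen a c) \<oplus>\<^bsub>F Quot J\<^esub> \<tau> (gen a' c)"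
proof -
  have "\<tau> (gen (a \<oplus>\<^bsub>A\<^esub> a') c) = \<tau> (gen a c \<oplus>\<^bsub>F\<^esub> gen a' c)"
  proof (rule \<tau>_eqI)
    show "gen (a \<oplus>\<^bsub>A\<^esub> a') c \<ominus>\<^bsub>F\<^esub> (gen a c \<oplus>\<^bsub>F\<^esub> gen a' c) \<in> tensor_relations R A \<phi> (R Quot P) q"
      unfolding tensor_relations_def Let_def using assms by blast
  qed (use assms in \<open>simp_all only: F.RM.a_closed gen_closed A.a_closed C.a_closed\<close>)
  then show ?thesis using assms gen_closed by (metis \<tau>.hom_add)
qed

lemma \<tau>_add_right:
  assumes "a \<in> carrier A" "c \<in> carrier (R Quot P)" "c' \<in> carrier (R Quot P)"
  shows "\<tau> (gen a (c \<oplus>\<^bsub>R Quot P\<^esub> c')) = \<tau> (gen a c) \<oplus>\<^bsub>F Quot J\<^esub> \<tau> (gen a c')"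
proof -
  have "\<tau> (gen a (c \<oplus>\<^bsub>R Quot P\<^esub> c')) = \<tau> (gen a c \<oplus>\<^bsub>F\<^esub> gen a c')"
  proof (rule \<tau>_eqI)
    show "gen a (c \<oplus>\<^bsub>R Quot P\<^esub> c') \<ominus>\<^bsub>F\<^esub> (gen a c \<oplus>\<^bsub>F\<^esub> gen a c') \<in> tensor_relations R A \<phi> (R Quot P) q"
      unfolding tensor_relations_def Let_def using assms by blast
  qed (use assms in \<open>simp_all only: F.RM.a_closed gen_closed A.a_closed C.a_closed\<close>)
  then show ?thesis using assms gen_closed by (metis \<tau>.hom_add)
qed

lemma \<tau>_balanced:
  assumes "r \<in> carrier R" "a \<in> carrier A" "c \<in> carrier (R Quot P)"
  shows "\<tau> (gen (\<phi> r \<otimes>\<^bsub>A\<^esub> a) c) = \<tau> (gen a (q r \<otimes>\<^bsub>R Quot P\<^esub> c))"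
proof (rule \<tau>_eqI)
  show "gen (\<phi> r \<otimes>\<^bsub>A\<^esub> a) c \<ominus>\<^bsub>F\<^esub> gen a (q r \<otimes>\<^bsub>R Quot P\<^esub> c) \<in> tensor_relations R A \<phi> (R Quot P) q"
    unfolding tensor_relations_def Let_def using assms by blast
qed (use assms in \<open>simp_all only: gen_closed A.m_closed C.m_closed q.hom_closed \<phi>.hom_closed\<close>)

text \<open>
  The map \<open>a \<mapsto> a \<otimes> 1\<close>.  It is onto, as \<open>a \<otimes> r = r a \<otimes> 1\<close>, and it kills the image of \<open>P\<close>; so it
  factors through \<open>A/PA\<close>.
\<close>
definition "\<eta> a = \<tau> (gen a \<one>\<^bsub>R Quot P\<^esub>)"

lemma gen_mult:
  assumes "a \<in> carrier A" "a' \<in> carrier A" "c \<in> carrier (R Quot P)" "c' \<in> carrier (R Quot P)"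
  shows "gen (a \<otimes>\<^bsub>A\<^esub> a') (c \<otimes>\<^bsub>R Quot P\<^esub> c') = gen a c \<otimes>\<^bsub>F\<^esub> gen a' c'"
  using assms by (subst F.single_mult) auto

lemma \<eta>_hom: "\<eta> \<in> ring_hom A (F Quot J)"
proof (rule ring_hom_memI)
  fix a b assume a: "a \<in> carrier A" and b: "b \<in> carrier A"
  have "\<eta> (a \<otimes>\<^bsub>A\<^esub> b) = \<tau> (gen (a \<otimes>\<^bsub>A\<^esub> b) (\<one>\<^bsub>R Quot P\<^esub> \<otimes>\<^bsub>R Quot P\<^esub> \<one>\<^bsub>R Quot P\<^esub>))"
    by (simp only: \<eta>_def C.l_one C.one_closed)
  also have "\<dots> = \<eta> a \<otimes>\<^bsub>F Quot J\<^esub> \<eta> b"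
    unfolding \<eta>_def gen_mult[OF a b C.one_closed C.one_closed]
    using a b gen_closed C.one_closed by (intro \<tau>.hom_mult)
  finally show "\<eta> (a \<otimes>\<^bsub>A\<^esub> b) = \<eta> a \<otimes>\<^bsub>F Quot J\<^esub> \<eta> b" .
  show "\<eta> (a \<oplus>\<^bsub>A\<^esub> b) = \<eta> a \<oplus>\<^bsub>F Quot J\<^esub> \<eta> b"
    unfolding \<eta>_def by (rule \<tau>_add_left[OF a b C.one_closed])
next
  fix a assume "a \<in> carrier A"
  then show "\<eta> a \<in> carrier (F Quot J)"
    unfolding \<eta>_def by (intro \<tau>.hom_closed gen_closed C.one_closed)
next
  have "gen \<one>\<^bsub>A\<^esub> \<one>\<^bsub>R Quot P\<^esub> = \<one>\<^bsub>F\<^esub>"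
    unfolding F.RM_simps(3) by (simp only: one_DirProd monoid.simps)
  then show "\<eta> \<one>\<^bsub>A\<^esub> = \<one>\<^bsub>F Quot J\<^esub>"
    unfolding \<eta>_def using \<tau>.hom_one by simp
qed

sublocale \<eta>: ring_hom_cring A "F Quot J" \<eta>
  using \<eta>_hom A.is_cring TR.is_cring by (intro ring_hom_cringI2)

text \<open>
  One has \<open>p \<otimes> 1 = 1 \<otimes> p = 1 \<otimes> 0\<close>, and \<open>1 \<otimes> 0\<close> equals its own double by additivity.
\<close>
lemma \<eta>_vanishes:
  assumes "p \<in> P"
  shows "\<eta> (\<phi> p) = \<zero>\<^bsub>F Quot J\<^esub>"
proof -
  have p: "p \<in> carrier R" using assms by (rule P.Icarr)
  have "q p = \<zero>\<^bsub>R Quot P\<^esub>" unfolding FactRing_def ring.simps by (rule R.a_rcos_zero[OF P.is_ideal assms])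
  then have "\<eta> (\<phi> p) = \<tau> (gen \<one>\<^bsub>A\<^esub> \<zero>\<^bsub>R Quot P\<^esub>)"
    using \<tau>_balanced[OF p A.one_closed C.one_closed] p by (simp only: \<eta>_def A.r_one \<phi>.hom_closed C.l_null C.one_closed)
  moreover have "\<tau> (gen \<one>\<^bsub>A\<^esub> \<zero>\<^bsub>R Quot P\<^esub>) \<oplus>\<^bsub>F Quot J\<^esub> \<tau> (gen \<one>\<^bsub>A\<^esub> \<zero>\<^bsub>R Quot P\<^esub>) = \<tau> (gen \<one>\<^bsub>A\<^esub> \<zero>\<^bsub>R Quot P\<^esub>)"
    using \<tau>_add_right[OF A.one_closed C.zero_closed C.zero_closed] by (simp only: C.l_zero C.zero_closed)
  moreover have "\<tau> (gen \<one>\<^bsub>A\<^esub> \<zero>\<^bsub>R Quot P\<^esub>) \<in> carrier (F Quot J)"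
    by (intro \<tau>.hom_closed gen_closed A.one_closed C.zero_closed)
  ultimately show ?thesis
    by (metis TR.add.l_cancel_one)
qed

lemma \<eta>_surj: "\<tau> x \<in> \<eta> ` carrier A" if x: "x \<in> carrier F"
proof -
  let ?I = "\<eta> ` carrier A"
  have I_add: "u \<oplus>\<^bsub>F Quot J\<^esub> v \<in> ?I" if "u \<in> ?I" "v \<in> ?I" for u v
    using that by (auto simp flip: \<eta>.hom_add)
  have I_mult: "u \<otimes>\<^bsub>F Quot J\<^esub> v \<in> ?I" if "u \<in> ?I" "v \<in> ?I" for u v
    using that by (auto simp flip: \<eta>.hom_mult)
  have I_gen: "\<tau> (gen a c) \<in> ?I" if "a \<in> carrier A" "c \<in> carrier (R Quot P)" for a c
  proof -
    obtain r where r: "r \<in> carrier R" "c = q r"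
      using \<open>c \<in> carrier (R Quot P)\<close> unfolding FactRing_def A_RCOSETS_def' partial_object.simps by blast
    have "\<tau> (gen a c) = \<eta> (\<phi> r \<otimes>\<^bsub>A\<^esub> a)"
      using \<tau>_balanced[OF r(1) that(1) C.one_closed] that(2) r by (simp only: \<eta>_def C.r_one)
    then show ?thesis using r that by (simp only: imageI A.m_closed \<phi>.hom_closed)
  qed
  have I_int: "\<tau> (single \<Z> \<one>\<^bsub>AC\<^esub> n) \<in> ?I" for n :: int
  proof -
    let ?c = "single \<Z> \<one>\<^bsub>AC\<^esub>"
    interpret \<kappa>: ring_hom_cring \<Z> F ?c
      using F.const_hom int_is_cring F.RM_is_cring by (intro ring_hom_cringI2)
    have one: "\<tau> (?c 1) = \<eta> \<one>\<^bsub>A\<^esub>" by (simp add: \<eta>_def)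
    have add: "\<tau> (?c (m + n)) = \<tau> (?c m) \<oplus>\<^bsub>F Quot J\<^esub> \<tau> (?c n)" for m n
    proof -
      have "?c (m + n) = ?c m \<oplus>\<^bsub>F\<^esub> ?c n" using \<kappa>.hom_add[of m n] by simp
      moreover have "?c m \<in> carrier F" "?c n \<in> carrier F" using \<kappa>.hom_closed by auto
      ultimately show ?thesis by (metis \<tau>.hom_add)
    qed
    have zero: "\<tau> (?c 0) = \<eta> \<zero>\<^bsub>A\<^esub>"
      using \<kappa>.hom_zero \<tau>.hom_zero by simp
    have cl: "\<tau> (?c m) \<in> carrier (F Quot J)" for m
      by (rule \<tau>.hom_closed) (simp add: \<kappa>.hom_closed)
    have neg: "\<tau> (?c (- 1)) = \<eta> (\<ominus>\<^bsub>A\<^esub> \<one>\<^bsub>A\<^esub>)"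
    proof -
      have "\<tau> (?c (-1)) \<oplus>\<^bsub>F Quot J\<^esub> \<tau> (?c 1) = \<zero>\<^bsub>F Quot J\<^esub>"
        using add[of "-1" 1] zero \<eta>.hom_zero by simp
      then have "\<tau> (?c (-1)) = \<ominus>\<^bsub>F Quot J\<^esub> \<eta> \<one>\<^bsub>A\<^esub>"
        using TR.minus_equality[OF _ cl cl, of "-1" 1] one by simp
      then show ?thesis using \<eta>.hom_a_inv by simp
    qed
    show ?thesis
    proof (induction n rule: int_induct[where k = 0])
      case base show ?case unfolding zero by (intro imageI A.zero_closed)
    next
      case (step1 i) then show ?case unfolding add one by (intro I_add imageI) auto
    next
      case (step2 i)
      have "i - 1 = i + (-1)" by simp
      then have "\<tau> (?c (i - 1)) = \<tau> (?c i) \<oplus>\<^bsub>F Quot J\<^esub> \<tau> (?c (-1))" by (simp only: add)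
      then show ?case unfolding neg using step2 by (simp only: I_add imageI A.a_inv_closed A.one_closed)
    qed
  qed
  define summand where "summand p = single \<Z> \<one>\<^bsub>AC\<^esub> (x p) \<otimes>\<^bsub>F\<^esub> single \<Z> p \<one>\<^bsub>\<Z>\<^esub>" for p
  have summand_closed: "summand p \<in> carrier F" if "p \<in> carrier AC" for p
    unfolding summand_def using that by (intro F.RM.m_closed F.single_closed) auto
  have summand_image: "\<tau> (summand p) \<in> ?I" if "p \<in> carrier AC" for p
  proof -
    have p: "fst p \<in> carrier A" "snd p \<in> carrier (R Quot P)" using that by auto
    have "\<tau> (summand p) = \<tau> (single \<Z> \<one>\<^bsub>AC\<^esub> (x p)) \<otimes>\<^bsub>F Quot J\<^esub> \<tau> (gen (fst p) (snd p))"
      unfolding summand_def prod.collapse using that by (intro \<tau>.hom_mult F.single_closed) auto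
    then show ?thesis by (simp only: I_mult I_gen[OF p] I_int)
  qed
  have "\<tau> (\<Oplus>\<^bsub>F\<^esub>p\<in>U. summand p) \<in> ?I" if "finite U" "U \<subseteq> carrier AC" for U
    using that
  proof (induction U)
    case empty
    have "\<tau> (\<Oplus>\<^bsub>F\<^esub>p\<in>{}. summand p) = \<eta> \<zero>\<^bsub>A\<^esub>" using \<tau>.hom_zero by (simp only: F.RM.finsum_empty \<eta>.hom_zero)
    then show ?case by (simp only: imageI A.zero_closed)
  next
    case (insert p U)
    have cl: "summand ` insert p U \<subseteq> carrier F" using insert summand_closed by blast
    have "(\<Oplus>\<^bsub>F\<^esub>p\<in>insert p U. summand p) = summand p \<oplus>\<^bsub>F\<^esub> (\<Oplus>\<^bsub>F\<^esub>p\<in>U. summand p)"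
      using insert cl by (intro F.RM.finsum_insert) auto
    moreover have "(\<Oplus>\<^bsub>F\<^esub>p\<in>U. summand p) \<in> carrier F" using cl by (intro F.RM.finsum_closed) auto
    ultimately have eq: "\<tau> (\<Oplus>\<^bsub>F\<^esub>p\<in>insert p U. summand p) = \<tau> (summand p) \<oplus>\<^bsub>F Quot J\<^esub> \<tau> (\<Oplus>\<^bsub>F\<^esub>p\<in>U. summand p)"
      using cl \<tau>.hom_add[of "summand p"] by (simp only: image_insert insert_subset)
    show ?case unfolding eq using insert by (intro I_add summand_image) auto
  qed
  from this[OF F.finite_supp[OF x] F.supp_subset[OF x]]
  have "\<tau> (\<Oplus>\<^bsub>F\<^esub>p\<in>F.supp x. summand p) \<in> ?I" by (simp only: ring.simps)
  moreover have "x = (\<Oplus>\<^bsub>F\<^esub>p\<in>F.supp x. summand p)"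
    unfolding summand_def ring.simps monoid.simps
    by (rule F.sum_of_terms[OF x F.finite_supp[OF x] order.refl F.supp_subset[OF x], unfolded ring.simps monoid.simps])
  ultimately show ?thesis by (rule back_subst[where P = "\<lambda>y. \<tau> y \<in> ?I", OF _ sym])
qed

text \<open>
  The fiber \<open>A \<otimes>\<^sub>R R/P\<close> is \<open>A/PA\<close>, stated for any presentation \<open>\<theta> : A \<rightarrow> B\<close> of this quotient.  The map
  \<open>a \<otimes> r \<mapsto> \<theta>(a) \<theta>(\<phi> r)\<close> is well defined because it respects the relations.  It is injective: modulo the
  relations every element is some \<open>a \<otimes> 1\<close>, and if \<open>\<theta> a = 0\<close> then \<open>a \<in> PA\<close>, whence \<open>a \<otimes> 1 = 0\<close>.
\<close>
theorem fiber_ring_iso: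
  assumes "cring B" and \<theta>: "\<theta> \<in> ring_hom A B" and surj: "\<theta> ` carrier A = carrier B"
    and vanish: "\<And>p. p \<in> P \<Longrightarrow> \<theta> (\<phi> p) = \<zero>\<^bsub>B\<^esub>"
    and kernel: "\<And>a. a \<in> carrier A \<Longrightarrow> \<theta> a = \<zero>\<^bsub>B\<^esub> \<Longrightarrow> a \<in> Idl\<^bsub>A\<^esub> (\<phi> ` P)"
  shows "\<exists>\<Phi> \<in> ring_iso (fiber_ring R A \<phi> P) B.
    \<forall>r\<in>carrier R. \<Phi> (fiber_scalar R A \<phi> P (q r)) = \<theta> (\<phi> r)"
proof -
  interpret B: cring B by fact
  interpret \<theta>: ring_hom_cring A B \<theta> using assms A.is_cring by (intro ring_hom_cringI2)
  have "(\<lambda>r. \<theta> (\<phi> r)) \<in> ring_hom R B"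
    by (rule ring_hom_memI) auto
  from quotient_lift[OF P.is_ideal B.ring_axioms this vanish]
  obtain \<chi> where \<chi>: "\<chi> \<in> ring_hom (R Quot P) B" and \<chi>_q: "\<And>r. r \<in> carrier R \<Longrightarrow> \<chi> (q r) = \<theta> (\<phi> r)"
    by blast
  interpret \<chi>: ring_hom_cring "R Quot P" B \<chi> using \<chi> C.is_cring B.is_cring by (intro ring_hom_cringI2)
  define \<Psi> where "\<Psi> = monoid_ring_lift \<Z> B (\<lambda>n. [n] \<cdot>\<^bsub>B\<^esub> \<one>\<^bsub>B\<^esub>) (\<lambda>(a, c). \<theta> a \<otimes>\<^bsub>B\<^esub> \<chi> c)"
  have \<Psi>_hom: "\<Psi> \<in> ring_hom F B"
    unfolding \<Psi>_def
  proof (rule F.lift_hom[OF B.is_cring B.int_multiples_hom])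
    fix x y assume "x \<in> carrier AC" "y \<in> carrier AC"
    then show "(case x \<otimes>\<^bsub>AC\<^esub> y of (a, c) \<Rightarrow> \<theta> a \<otimes>\<^bsub>B\<^esub> \<chi> c)
      = (case x of (a, c) \<Rightarrow> \<theta> a \<otimes>\<^bsub>B\<^esub> \<chi> c) \<otimes>\<^bsub>B\<^esub> (case y of (a, c) \<Rightarrow> \<theta> a \<otimes>\<^bsub>B\<^esub> \<chi> c)"
      by (auto simp: B.m_ac)
  qed auto
  interpret \<Psi>: ring_hom_cring F B \<Psi> using \<Psi>_hom F.RM_is_cring B.is_cring by (intro ring_hom_cringI2)
  have \<Psi>_gen: "\<Psi> (gen a c) = \<theta> a \<otimes>\<^bsub>B\<^esub> \<chi> c" if "a \<in> carrier A" "c \<in> carrier (R Quot P)" for a c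
    unfolding \<Psi>_def using that
    by (subst F.lift_single[OF B.is_cring B.int_multiples_hom]) (auto simp: B.add.int_pow_1)
  let ?ker = "a_kernel F B \<Psi>"
  have \<Psi>_minus: "\<Psi> (x \<ominus>\<^bsub>F\<^esub> y) = \<Psi> x \<ominus>\<^bsub>B\<^esub> \<Psi> y" if "x \<in> carrier F" "y \<in> carrier F" for x y
    unfolding a_minus_def using that by (simp only: \<Psi>.hom_add \<Psi>.hom_a_inv F.RM.a_inv_closed)
  have rel: "x \<ominus>\<^bsub>F\<^esub> y \<in> ?ker" if "x \<in> carrier F" "y \<in> carrier F" "\<Psi> x = \<Psi> y" for x y
  proof -
    have "\<Psi> (x \<ominus>\<^bsub>F\<^esub> y) = \<zero>\<^bsub>B\<^esub>"
      unfolding \<Psi>_minus[OF that(1,2)] using that by (simp only: B.r_right_minus_eq \<Psi>.hom_closed)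
    then show ?thesis
      using F.RM.minus_closed[OF that(1,2)] unfolding a_kernel_def' by blast
  qed
  \<comment> \<open>The map respects the three kinds of bilinearity relations.\<close>
  have J_le: "J \<subseteq> ?ker"
    unfolding J_def
  proof (rule F.RM.genideal_minimal[OF \<Psi>.ring.kernel_is_ideal])
    show "tensor_relations R A \<phi> (R Quot P) q \<subseteq> ?ker"
      unfolding tensor_relations_def Let_def
    proof (intro Un_least subsetI)
      fix x assume "x \<in> {gen (a \<oplus>\<^bsub>A\<^esub> a') b \<ominus>\<^bsub>F\<^esub> (gen a b \<oplus>\<^bsub>F\<^esub> gen a' b) | a a' b.
          a \<in> carrier A \<and> a' \<in> carrier A \<and> b \<in> carrier (R Quot P)}"
      then obtain a a' b where x: "x = gen (a \<oplus>\<^bsub>A\<^esub> a') b \<ominus>\<^bsub>F\<^esub> (gen a b \<oplus>\<^bsub>F\<^esub> gen a' b)"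
        and ab: "a \<in> carrier A" "a' \<in> carrier A" "b \<in> carrier (R Quot P)" by blast
      show "x \<in> ?ker" unfolding x using ab
        by (intro rel) (simp_all only: F.RM.a_closed gen_closed A.a_closed \<Psi>.hom_add \<Psi>_gen
            \<theta>.hom_add B.l_distr \<theta>.hom_closed \<chi>.hom_closed)
    next
      fix x assume "x \<in> {gen a (b \<oplus>\<^bsub>R Quot P\<^esub> b') \<ominus>\<^bsub>F\<^esub> (gen a b \<oplus>\<^bsub>F\<^esub> gen a b') | a b b'.
          a \<in> carrier A \<and> b \<in> carrier (R Quot P) \<and> b' \<in> carrier (R Quot P)}"
      then obtain a b b' where x: "x = gen a (b \<oplus>\<^bsub>R Quot P\<^esub> b') \<ominus>\<^bsub>F\<^esub> (gen a b \<oplus>\<^bsub>F\<^esub> gen a b')"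
        and ab: "a \<in> carrier A" "b \<in> carrier (R Quot P)" "b' \<in> carrier (R Quot P)" by blast
      show "x \<in> ?ker" unfolding x using ab
        by (intro rel) (simp_all only: F.RM.a_closed gen_closed C.a_closed \<Psi>.hom_add \<Psi>_gen
            \<chi>.hom_add B.r_distr \<theta>.hom_closed \<chi>.hom_closed)
    next
      fix x assume "x \<in> {gen (\<phi> r \<otimes>\<^bsub>A\<^esub> a) b \<ominus>\<^bsub>F\<^esub> gen a (q r \<otimes>\<^bsub>R Quot P\<^esub> b) | r a b.
          r \<in> carrier R \<and> a \<in> carrier A \<and> b \<in> carrier (R Quot P)}"
      then obtain r a b where x: "x = gen (\<phi> r \<otimes>\<^bsub>A\<^esub> a) b \<ominus>\<^bsub>F\<^esub> gen a (q r \<otimes>\<^bsub>R Quot P\<^esub> b)"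
        and ab: "r \<in> carrier R" "a \<in> carrier A" "b \<in> carrier (R Quot P)" by blast
      show "x \<in> ?ker" unfolding x using ab
        by (intro rel) (simp_all only: gen_closed A.m_closed C.m_closed \<phi>.hom_closed q.hom_closed
            \<Psi>_gen \<chi>.hom_mult \<theta>.hom_mult \<chi>_q \<theta>.hom_closed \<chi>.hom_closed B.m_ac)
    qed
  qed
  have \<Psi>_\<tau>: "\<Psi> x = \<Psi> y" if "x \<in> carrier F" "y \<in> carrier F" "\<tau> x = \<tau> y" for x y
  proof -
    have "x \<ominus>\<^bsub>F\<^esub> y \<in> ?ker"
      using J_le F.RM.quotient_eq_iff_same_a_r_cos[OF J.is_ideal that(1,2)] that(3) by blast
    then have "\<Psi> x \<ominus>\<^bsub>B\<^esub> \<Psi> y = \<zero>\<^bsub>B\<^esub>"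
      unfolding \<Psi>_minus[OF that(1,2), symmetric] a_kernel_def' by blast
    then show ?thesis using that by (simp only: B.r_right_minus_eq \<Psi>.hom_closed)
  qed
  have \<Psi>_one: "\<Psi> (gen a \<one>\<^bsub>R Quot P\<^esub>) = \<theta> a" if "a \<in> carrier A" for a
    using that by (simp only: \<Psi>_gen C.one_closed \<chi>.hom_one B.r_one \<theta>.hom_closed)
  have "?ker \<subseteq> J"
  proof
    fix x assume "x \<in> ?ker"
    then have x: "x \<in> carrier F" "\<Psi> x = \<zero>\<^bsub>B\<^esub>" unfolding a_kernel_def' by blast+
    obtain a where a: "a \<in> carrier A" "\<tau> x = \<eta> a" using \<eta>_surj[OF x(1)] by blast
    then have "\<theta> a = \<zero>\<^bsub>B\<^esub>"
      using \<Psi>_\<tau>[of x "gen a \<one>\<^bsub>R Quot P\<^esub>"] x \<Psi>_one[of a] gen_closed C.one_closed unfolding \<eta>_def by metis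
    then have "a \<in> Idl\<^bsub>A\<^esub> (\<phi> ` P)" using a kernel by blast
    also have "Idl\<^bsub>A\<^esub> (\<phi> ` P) \<subseteq> a_kernel A (F Quot J) \<eta>"
      using \<eta>_vanishes P.Icarr unfolding a_kernel_def'
      by (intro A.genideal_minimal[OF \<eta>.ring.kernel_is_ideal[unfolded a_kernel_def']]) blast
    finally have "\<tau> x = \<zero>\<^bsub>F Quot J\<^esub>" using a unfolding a_kernel_def' by blast
    then have "J +>\<^bsub>F\<^esub> x = J" unfolding FactRing_def ring.simps .
    then show "x \<in> J" using J.rcos_const_imp_mem x(1) by blast
  qed
  with J_le have J_eq: "J = ?ker" by blast
  have "carrier B \<subseteq> \<Psi> ` carrier F"
  proof
    fix b assume "b \<in> carrier B"
    then obtain a where "a \<in> carrier A" "b = \<theta> a" using surj by blast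
    then show "b \<in> \<Psi> ` carrier F"
      using \<Psi>_one gen_closed C.one_closed by (metis imageI)
  qed
  then have "\<Psi> ` carrier F = carrier B" using \<Psi>.hom_closed by blast
  then have iso: "(\<lambda>Z. the_elem (\<Psi> ` Z)) \<in> ring_iso (F Quot J) B"
    using \<Psi>.ring.FactRing_iso_set unfolding J_eq by blast
  have "fiber_ring R A \<phi> P = F Quot J"
    unfolding fiber_ring_def tensor_ring_def Let_def J_def ..
  moreover have "the_elem (\<Psi> ` fiber_scalar R A \<phi> P (q r)) = \<theta> (\<phi> r)" if r: "r \<in> carrier R" for r
  proof -
    have g: "gen \<one>\<^bsub>A\<^esub> (q r) \<in> carrier F" using r by (intro gen_closed q.hom_closed) auto
    have "fiber_scalar R A \<phi> P (q r) = \<tau> (gen \<one>\<^bsub>A\<^esub> (q r))"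
      unfolding fiber_scalar_def pure_tensor_def Let_def J_def ..
    then have "the_elem (\<Psi> ` fiber_scalar R A \<phi> P (q r)) = \<Psi> (gen \<one>\<^bsub>A\<^esub> (q r))"
      using \<Psi>.ring.the_elem_simp[OF g] unfolding J_eq by (simp only:)
    also have "\<dots> = \<theta> (\<phi> r)"
      using r by (simp only: \<Psi>_gen A.one_closed q.hom_closed \<theta>.hom_one \<chi>_q B.l_one \<theta>.hom_closed \<phi>.hom_closed)
    finally show ?thesis .
  qed
  ultimately show ?thesis using iso by metis
qed

end

section \<open>Invariants of a finite group of ring endomorphisms\<close>

lemma carrier_invariant_ring [simp]:
  "carrier (invariant_ring U H act) = {a \<in> carrier U. \<forall>h\<in>H. act h a = a}"
  by (simp add: invariant_ring_def)

lemma invariant_ring_simps [simp]: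
  "a \<otimes>\<^bsub>invariant_ring U H act\<^esub> b = a \<otimes>\<^bsub>U\<^esub> b"
  "a \<oplus>\<^bsub>invariant_ring U H act\<^esub> b = a \<oplus>\<^bsub>U\<^esub> b"
  "\<one>\<^bsub>invariant_ring U H act\<^esub> = \<one>\<^bsub>U\<^esub>"
  "\<zero>\<^bsub>invariant_ring U H act\<^esub> = \<zero>\<^bsub>U\<^esub>"
  by (simp_all add: invariant_ring_def)

lemma invariant_ring_is_cring:
  assumes "cring U" and hom: "\<And>h. h \<in> H \<Longrightarrow> act h \<in> ring_hom U U"
  shows "cring (invariant_ring U H act)"
proof -
  interpret U: cring U by fact
  have "subcring {a \<in> carrier U. \<forall>h\<in>H. act h a = a} U"
  proof (rule U.subcringI', rule U.subringI)
    fix a assume "a \<in> {a \<in> carrier U. \<forall>h\<in>H. act h a = a}"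
    moreover have "act h (\<ominus>\<^bsub>U\<^esub> a) = \<ominus>\<^bsub>U\<^esub> a" if h: "h \<in> H" and a: "a \<in> carrier U" "act h a = a" for h
    proof -
      interpret h: ring_hom_cring U U "act h" using hom[OF h] U.is_cring by (intro ring_hom_cringI2)
      show ?thesis using a by simp
    qed
    ultimately show "\<ominus>\<^bsub>U\<^esub> a \<in> {a \<in> carrier U. \<forall>h\<in>H. act h a = a}" by auto
  qed (auto simp: ring_hom_mult[OF hom] ring_hom_add[OF hom] ring_hom_one[OF hom])
  then show ?thesis
    unfolding invariant_ring_def using U.subcring_iff[of "{a \<in> carrier U. \<forall>h\<in>H. act h a = a}"] by auto
qed

text \<open>
  A finite group acting multiplicatively by ring endomorphisms.  The neutral element acts as an idempotent
  endomorphism, which is the unit of the group of all \<open>act g\<close>.  Left translation of \<open>G\<close> permutes the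
  family \<open>(act g u)\<^sub>g\<close>, and this is what makes sums and products over it invariant.
\<close>
locale group_of_endomorphisms = G: group G + U: cring U
  for G :: "('g, 'w) monoid_scheme" and U :: "('a, 'u) ring_scheme" and act :: "'g \<Rightarrow> 'a \<Rightarrow> 'a" +
  assumes finite_G: "finite (carrier G)"
    and act_hom: "\<And>g. g \<in> carrier G \<Longrightarrow> act g \<in> ring_hom U U"
    and act_mult: "\<And>g h u. g \<in> carrier G \<Longrightarrow> h \<in> carrier G \<Longrightarrow> u \<in> carrier U \<Longrightarrow>
      act (g \<otimes>\<^bsub>G\<^esub> h) u = act g (act h u)"
begin

abbreviation "Inv \<equiv> invariant_ring U (carrier G) act"

sublocale Inv: cring Inv
  using act_hom by (intro invariant_ring_is_cring U.is_cring)

lemma act_cring: "g \<in> carrier G \<Longrightarrow> ring_hom_cring U U (act g)"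
  using act_hom U.is_cring by (intro ring_hom_cringI2)

lemma act_closed [simp]: "g \<in> carrier G \<Longrightarrow> u \<in> carrier U \<Longrightarrow> act g u \<in> carrier U"
  using act_hom ring_hom_closed by fastforce

definition "trace u = (\<Oplus>\<^bsub>U\<^esub>g\<in>carrier G. act g u)"

lemma trace_closed [simp]: "u \<in> carrier U \<Longrightarrow> trace u \<in> carrier U"
  unfolding trace_def by (intro U.finsum_closed) auto

lemma inj_on_translation: "g \<in> carrier G \<Longrightarrow> inj_on ((\<otimes>\<^bsub>G\<^esub>) g) (carrier G)"
  by (auto intro: inj_onI)

lemma translation_image: "g \<in> carrier G \<Longrightarrow> (\<otimes>\<^bsub>G\<^esub>) g ` carrier G = carrier G"
proof -
  assume g: "g \<in> carrier G"
  have "x \<in> (\<otimes>\<^bsub>G\<^esub>) g ` carrier G" if "x \<in> carrier G" for x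
    using that g by (intro image_eqI[of _ _ "inv\<^bsub>G\<^esub> g \<otimes>\<^bsub>G\<^esub> x"]) (auto simp flip: G.m_assoc)
  then show ?thesis using g by auto
qed

lemma trace_invariant: "u \<in> carrier U \<Longrightarrow> trace u \<in> carrier Inv"
proof -
  assume u: "u \<in> carrier U"
  have "act h (trace u) = trace u" if h: "h \<in> carrier G" for h
  proof -
    interpret h: ring_hom_cring U U "act h" using h by (rule act_cring)
    have "act h (trace u) = (\<Oplus>\<^bsub>U\<^esub>g\<in>carrier G. act h (act g u))"
      unfolding trace_def using u by (subst h.hom_finsum) (auto simp: o_def)
    also have "\<dots> = (\<Oplus>\<^bsub>U\<^esub>g\<in>carrier G. act (h \<otimes>\<^bsub>G\<^esub> g) u)"
      using u h by (intro U.finsum_cong') (auto simp: act_mult)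
    also have "\<dots> = (\<Oplus>\<^bsub>U\<^esub>g\<in>(\<otimes>\<^bsub>G\<^esub>) h ` carrier G. act g u)"
      using u h inj_on_translation by (subst U.finsum_reindex) auto
    also have "\<dots> = trace u"
      unfolding translation_image[OF h] trace_def ..
    finally show ?thesis .
  qed
  then show ?thesis using u by simp
qed

lemma trace_add:
  "u \<in> carrier U \<Longrightarrow> v \<in> carrier U \<Longrightarrow> trace (u \<oplus>\<^bsub>U\<^esub> v) = trace u \<oplus>\<^bsub>U\<^esub> trace v"
proof -
  assume uv: "u \<in> carrier U" "v \<in> carrier U"
  then have "trace (u \<oplus>\<^bsub>U\<^esub> v) = (\<Oplus>\<^bsub>U\<^esub>g\<in>carrier G. act g u \<oplus>\<^bsub>U\<^esub> act g v)"
    unfolding trace_def by (intro U.finsum_cong') (auto simp: ring_hom_add[OF act_hom])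
  then show ?thesis unfolding trace_def using uv by (simp add: U.finsum_addf)
qed

lemma trace_invariant_mult:
  "a \<in> carrier Inv \<Longrightarrow> u \<in> carrier U \<Longrightarrow> trace (a \<otimes>\<^bsub>U\<^esub> u) = a \<otimes>\<^bsub>U\<^esub> trace u"
proof -
  assume a: "a \<in> carrier Inv" and u: "u \<in> carrier U"
  then have "trace (a \<otimes>\<^bsub>U\<^esub> u) = (\<Oplus>\<^bsub>U\<^esub>g\<in>carrier G. a \<otimes>\<^bsub>U\<^esub> act g u)"
    unfolding trace_def by (intro U.finsum_cong') (auto simp: ring_hom_mult[OF act_hom])
  then show ?thesis
    unfolding trace_def using a u finite_G by (subst U.finsum_rdistr) auto
qed

text \<open>
  Contraction of an extended ideal.  The trace is linear over the invariants, so it maps the ideal of \<open>U\<close>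
  generated by \<open>Z\<close> into the ideal of the ring of invariants generated by \<open>Z\<close>; on an invariant element it is
  multiplication by \<open>|G|\<close>, which has the inverse \<open>\<nu>\<close>.
\<close>
lemma extended_ideal_invariants:
  assumes Z: "Z \<subseteq> carrier Inv" and \<nu>: "\<nu> \<in> carrier Inv" "\<nu> \<otimes>\<^bsub>U\<^esub> [order G] \<cdot>\<^bsub>U\<^esub> \<one>\<^bsub>U\<^esub> = \<one>\<^bsub>U\<^esub>"
    and a: "a \<in> carrier Inv" "a \<in> Idl\<^bsub>U\<^esub> Z"
  shows "a \<in> Idl\<^bsub>Inv\<^esub> Z"
proof -
  have ZU: "Z \<subseteq> carrier U" using Z by auto
  interpret I: ideal "Idl\<^bsub>Inv\<^esub> Z" Inv by (rule Inv.genideal_ideal[OF Z])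
  \<comment> \<open>Quantifying over all multiples makes the preimage of the ideal under the trace an ideal of \<open>U\<close>.\<close>
  define N where "N = {f \<in> carrier U. \<forall>f'\<in>carrier U. trace (f \<otimes>\<^bsub>U\<^esub> f') \<in> Idl\<^bsub>Inv\<^esub> Z}"
  have "ideal N U"
  proof (rule idealI)
    show "subgroup N (add_monoid U)"
    proof (rule U.add.subgroupI)
      have "trace \<zero>\<^bsub>U\<^esub> = \<zero>\<^bsub>U\<^esub>"
        using trace_invariant_mult[of "\<zero>\<^bsub>U\<^esub>" "\<zero>\<^bsub>U\<^esub>"] Inv.zero_closed by simp
      then have "\<zero>\<^bsub>U\<^esub> \<in> N" using I.zero_closed by (simp add: N_def)
      then show "N \<noteq> {}" by blast
    next
      fix f assume f: "f \<in> N"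
      then have "trace (\<ominus>\<^bsub>U\<^esub> f \<otimes>\<^bsub>U\<^esub> f') \<in> Idl\<^bsub>Inv\<^esub> Z" if "f' \<in> carrier U" for f'
        using that U.l_minus[of f f'] U.r_minus[of f f'] unfolding N_def by (metis (lifting) U.a_inv_closed mem_Collect_eq)
      then show "\<ominus>\<^bsub>U\<^esub> f \<in> N" using f by (auto simp: N_def)
    next
      fix f g assume "f \<in> N" "g \<in> N"
      then show "f \<oplus>\<^bsub>U\<^esub> g \<in> N"
        using I.a_closed by (auto simp: N_def U.l_distr trace_add)
    qed (auto simp: N_def)
  next
    fix f u assume f: "f \<in> N" and u: "u \<in> carrier U"
    have *: "trace (f \<otimes>\<^bsub>U\<^esub> u \<otimes>\<^bsub>U\<^esub> f') \<in> Idl\<^bsub>Inv\<^esub> Z" if "f' \<in> carrier U" for f'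
      using f u that by (simp add: N_def U.m_assoc)
    then show "f \<otimes>\<^bsub>U\<^esub> u \<in> N" using f u by (auto simp: N_def)
    then show "u \<otimes>\<^bsub>U\<^esub> f \<in> N" using f u by (simp add: N_def U.m_comm)
  qed (rule U.ring_axioms)
  moreover have "Z \<subseteq> N"
  proof
    fix z assume z: "z \<in> Z"
    then have "trace (z \<otimes>\<^bsub>U\<^esub> f') \<in> Idl\<^bsub>Inv\<^esub> Z" if "f' \<in> carrier U" for f'
    proof -
      have "z \<otimes>\<^bsub>Inv\<^esub> trace f' \<in> Idl\<^bsub>Inv\<^esub> Z"
        using z Inv.genideal_self[OF Z] trace_invariant[OF that] by (intro I.I_r_closed) auto
      then show ?thesis using z Z that by (subst trace_invariant_mult) auto
    qed
    then show "z \<in> N" using z ZU by (auto simp: N_def)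
  qed
  ultimately have "Idl\<^bsub>U\<^esub> Z \<subseteq> N" by (rule U.genideal_minimal)
  then have "trace (a \<otimes>\<^bsub>U\<^esub> \<one>\<^bsub>U\<^esub>) \<in> Idl\<^bsub>Inv\<^esub> Z"
    using a(2) by (auto simp: N_def)
  moreover have "trace (a \<otimes>\<^bsub>U\<^esub> \<one>\<^bsub>U\<^esub>) = a \<otimes>\<^bsub>U\<^esub> [order G] \<cdot>\<^bsub>U\<^esub> \<one>\<^bsub>U\<^esub>"
  proof -
    have "trace \<one>\<^bsub>U\<^esub> = (\<Oplus>\<^bsub>U\<^esub>g\<in>carrier G. \<one>\<^bsub>U\<^esub>)"
      unfolding trace_def by (intro U.finsum_cong') (auto simp: ring_hom_one[OF act_hom])
    then have "trace \<one>\<^bsub>U\<^esub> = [order G] \<cdot>\<^bsub>U\<^esub> \<one>\<^bsub>U\<^esub>"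
      by (simp add: U.add.finprod_const order_def)
    then show ?thesis using trace_invariant_mult[OF a(1) U.one_closed] by simp
  qed
  ultimately have "\<nu> \<otimes>\<^bsub>Inv\<^esub> (a \<otimes>\<^bsub>U\<^esub> [order G] \<cdot>\<^bsub>U\<^esub> \<one>\<^bsub>U\<^esub>) \<in> Idl\<^bsub>Inv\<^esub> Z"
    using \<nu>(1) by (intro I.I_l_closed) auto
  also have "\<nu> \<otimes>\<^bsub>Inv\<^esub> (a \<otimes>\<^bsub>U\<^esub> [order G] \<cdot>\<^bsub>U\<^esub> \<one>\<^bsub>U\<^esub>) = a \<otimes>\<^bsub>U\<^esub> (\<nu> \<otimes>\<^bsub>U\<^esub> [order G] \<cdot>\<^bsub>U\<^esub> \<one>\<^bsub>U\<^esub>)"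
    using a \<nu>(1) by (simp add: U.m_lcomm)
  also have "\<dots> = a" using a \<nu> by simp
  finally show ?thesis .
qed

lemma act_preserves_extended_ideal:
  assumes Z: "Z \<subseteq> carrier Inv" and g: "g \<in> carrier G" and u: "u \<in> Idl\<^bsub>U\<^esub> Z"
  shows "act g u \<in> Idl\<^bsub>U\<^esub> Z"
proof -
  interpret g: ring_hom_cring U U "act g" using g by (rule act_cring)
  have ZU: "Z \<subseteq> carrier U" using Z by auto
  have "ideal {r \<in> carrier U. act g r \<in> Idl\<^bsub>U\<^esub> Z} U"
    by (rule g.ring.ideal_vimage) (rule U.genideal_ideal[OF ZU])
  moreover have "Z \<subseteq> {r \<in> carrier U. act g r \<in> Idl\<^bsub>U\<^esub> Z}"
  proof
    fix z assume z: "z \<in> Z"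
    then have "act g z = z" "z \<in> carrier U" using Z g by auto
    then show "z \<in> {r \<in> carrier U. act g r \<in> Idl\<^bsub>U\<^esub> Z}"
      using U.genideal_self[OF ZU] z by auto
  qed
  ultimately have "Idl\<^bsub>U\<^esub> Z \<subseteq> {r \<in> carrier U. act g r \<in> Idl\<^bsub>U\<^esub> Z}"
    by (rule U.genideal_minimal)
  then show ?thesis using u by auto
qed

text \<open>
  From \<open>e a \<in> ZU\<close> one gets \<open>(g e) a \<in> ZU\<close> for all \<open>g\<close>, because \<open>a\<close> and the generators of the ideal are
  invariant.  So multiplying \<open>a\<close> by any product of factors \<open>1 - g e\<close> does not change it modulo \<open>ZU\<close>.
\<close>
lemma mem_ideal_of_orbit_product:
  assumes Z: "Z \<subseteq> carrier Inv" and e: "e \<in> carrier U" and a: "a \<in> carrier Inv"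
    and ea: "e \<otimes>\<^bsub>U\<^esub> a \<in> Idl\<^bsub>U\<^esub> Z"
    and prod: "(\<Otimes>\<^bsub>U\<^esub>g\<in>carrier G. \<one>\<^bsub>U\<^esub> \<ominus>\<^bsub>U\<^esub> act g e) \<in> Idl\<^bsub>U\<^esub> Z"
  shows "a \<in> Idl\<^bsub>U\<^esub> Z"
proof -
  have ZU: "Z \<subseteq> carrier U" and aU: "a \<in> carrier U" using Z a by auto
  interpret D: ideal "Idl\<^bsub>U\<^esub> Z" U by (rule U.genideal_ideal[OF ZU])
  let ?f = "\<lambda>g. \<one>\<^bsub>U\<^esub> \<ominus>\<^bsub>U\<^esub> act g e"
  have f: "?f g \<in> carrier U" if "g \<in> carrier G" for g using that e by auto
  have gea: "act g e \<otimes>\<^bsub>U\<^esub> a \<in> Idl\<^bsub>U\<^esub> Z" if g: "g \<in> carrier G" for g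
  proof -
    have "act g (e \<otimes>\<^bsub>U\<^esub> a) = act g e \<otimes>\<^bsub>U\<^esub> a"
      using g e a by (simp add: ring_hom_mult[OF act_hom])
    then show ?thesis using act_preserves_extended_ideal[OF Z g ea] by simp
  qed
  have "(\<Otimes>\<^bsub>U\<^esub>g\<in>A. ?f g) \<otimes>\<^bsub>U\<^esub> a \<in> Idl\<^bsub>U\<^esub> Z \<longrightarrow> a \<in> Idl\<^bsub>U\<^esub> Z"
    if "finite A" "A \<subseteq> carrier G" for A
    using that
  proof (induction A)
    case empty then show ?case using aU by simp
  next
    case (insert g A)
    then have g: "g \<in> carrier G" and A: "A \<subseteq> carrier G" by auto
    define p where "p = (\<Otimes>\<^bsub>U\<^esub>g\<in>A. ?f g)"
    have p: "p \<in> carrier U" unfolding p_def using f A by (intro U.finprod_closed) auto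
    have "(\<Otimes>\<^bsub>U\<^esub>g\<in>insert g A. ?f g) = ?f g \<otimes>\<^bsub>U\<^esub> p"
      unfolding p_def using insert f by (intro U.finprod_insert) auto
    also have "\<dots> \<otimes>\<^bsub>U\<^esub> a = p \<otimes>\<^bsub>U\<^esub> a \<ominus>\<^bsub>U\<^esub> p \<otimes>\<^bsub>U\<^esub> (act g e \<otimes>\<^bsub>U\<^esub> a)"
      using p aU e g act_closed[OF g e] by algebra
    finally have eq: "(\<Otimes>\<^bsub>U\<^esub>g\<in>insert g A. ?f g) \<otimes>\<^bsub>U\<^esub> a = p \<otimes>\<^bsub>U\<^esub> a \<ominus>\<^bsub>U\<^esub> p \<otimes>\<^bsub>U\<^esub> (act g e \<otimes>\<^bsub>U\<^esub> a)" .
    show ?case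
    proof
      assume "(\<Otimes>\<^bsub>U\<^esub>g\<in>insert g A. ?f g) \<otimes>\<^bsub>U\<^esub> a \<in> Idl\<^bsub>U\<^esub> Z"
      then have "(p \<otimes>\<^bsub>U\<^esub> a \<ominus>\<^bsub>U\<^esub> p \<otimes>\<^bsub>U\<^esub> (act g e \<otimes>\<^bsub>U\<^esub> a)) \<oplus>\<^bsub>U\<^esub> p \<otimes>\<^bsub>U\<^esub> (act g e \<otimes>\<^bsub>U\<^esub> a) \<in> Idl\<^bsub>U\<^esub> Z"
        unfolding eq using D.I_l_closed[OF gea[OF g] p] by (rule D.a_closed)
      also have "(p \<otimes>\<^bsub>U\<^esub> a \<ominus>\<^bsub>U\<^esub> p \<otimes>\<^bsub>U\<^esub> (act g e \<otimes>\<^bsub>U\<^esub> a)) \<oplus>\<^bsub>U\<^esub> p \<otimes>\<^bsub>U\<^esub> (act g e \<otimes>\<^bsub>U\<^esub> a) = p \<otimes>\<^bsub>U\<^esub> a"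
        using p aU act_closed[OF g e] by algebra
      finally show "a \<in> Idl\<^bsub>U\<^esub> Z" using insert.IH A unfolding p_def by blast
    qed
  qed
  from this[OF finite_G order.refl] show ?thesis
    using D.I_r_closed[OF prod aU] by blast
qed

text \<open>
  The element \<open>e\<close> separates \<open>H\<close> from the rest of \<open>G\<close>: in the trace of \<open>e u\<close> the summands with \<open>g \<notin> H\<close> die under
  \<open>\<theta>\<close>, and the others are the \<open>H\<close>-translates of \<open>\<theta> u\<close>, which all equal \<open>\<theta> u\<close> if that is \<open>H\<close>-invariant.
\<close>
theorem invariants_onto_local_invariants:
  assumes V: "cring V" and H: "subgroup H G"
    and actV_hom: "\<And>h. h \<in> H \<Longrightarrow> actV h \<in> ring_hom V V"
    and \<theta>_hom: "\<theta> \<in> ring_hom U V" and \<theta>_surj: "\<theta> ` carrier U = carrier V"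
    and equivariant: "\<And>h u. h \<in> H \<Longrightarrow> u \<in> carrier U \<Longrightarrow> \<theta> (act h u) = actV h (\<theta> u)"
    and e: "e \<in> carrier U" "\<theta> e = \<one>\<^bsub>V\<^esub>"
    and e_outside: "\<And>g. g \<in> carrier G - H \<Longrightarrow> \<theta> (act g e) = \<zero>\<^bsub>V\<^esub>"
    and \<nu>: "\<nu> \<in> carrier Inv" "\<nu> \<otimes>\<^bsub>U\<^esub> [card H] \<cdot>\<^bsub>U\<^esub> \<one>\<^bsub>U\<^esub> = \<one>\<^bsub>U\<^esub>"
  shows "\<theta> ` carrier Inv = carrier (invariant_ring V H actV)"
proof
  interpret V: cring V by fact
  interpret \<theta>: ring_hom_cring U V \<theta> using \<theta>_hom U.is_cring V.is_cring by (intro ring_hom_cringI2)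
  have HG: "H \<subseteq> carrier G" using H by (rule subgroup.subset)
  show "\<theta> ` carrier Inv \<subseteq> carrier (invariant_ring V H actV)"
  proof clarify
    fix a assume a: "a \<in> carrier Inv"
    then have "actV h (\<theta> a) = \<theta> a" if "h \<in> H" for h
      using equivariant[OF that, of a] that HG by auto
    then show "\<theta> a \<in> carrier (invariant_ring V H actV)" using a by auto
  qed
  show "carrier (invariant_ring V H actV) \<subseteq> \<theta> ` carrier Inv"
  proof
    fix b assume b: "b \<in> carrier (invariant_ring V H actV)"
    then have bV: "b \<in> carrier V" by simp
    then have "b \<in> \<theta> ` carrier U" by (simp only: \<theta>_surj)
    then obtain u where u: "u \<in> carrier U" "\<theta> u = b" by (metis imageE)
    have eu: "e \<otimes>\<^bsub>U\<^esub> u \<in> carrier U" using e u by simp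
    have "\<theta> (trace (e \<otimes>\<^bsub>U\<^esub> u)) = (\<Oplus>\<^bsub>V\<^esub>g\<in>carrier G. \<theta> (act g (e \<otimes>\<^bsub>U\<^esub> u)))"
      unfolding trace_def using eu by (subst \<theta>.hom_finsum) (auto simp: o_def)
    also have "\<dots> = (\<Oplus>\<^bsub>V\<^esub>g\<in>H. \<theta> (act g (e \<otimes>\<^bsub>U\<^esub> u)))"
    proof (rule V.finsum_superset[OF finite_G HG, symmetric])
      fix g assume g: "g \<in> carrier G - H"
      then have "\<theta> (act g (e \<otimes>\<^bsub>U\<^esub> u)) = \<theta> (act g e) \<otimes>\<^bsub>V\<^esub> \<theta> (act g u)"
        using e u by (simp add: ring_hom_mult[OF act_hom])
      then show "\<theta> (act g (e \<otimes>\<^bsub>U\<^esub> u)) = \<zero>\<^bsub>V\<^esub>" using g u e_outside by simp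
    qed (use eu HG in auto)
    also have "\<dots> = (\<Oplus>\<^bsub>V\<^esub>g\<in>H. b)"
    proof (rule V.finsum_cong'[OF refl])
      fix h assume h: "h \<in> H"
      have "\<theta> (act h (e \<otimes>\<^bsub>U\<^esub> u)) = actV h (\<theta> (e \<otimes>\<^bsub>U\<^esub> u))" by (rule equivariant[OF h eu])
      also have "\<theta> (e \<otimes>\<^bsub>U\<^esub> u) = b" using e u bV by simp
      also have "actV h b = b" using b h by simp
      finally show "\<theta> (act h (e \<otimes>\<^bsub>U\<^esub> u)) = b" .
    qed (use bV in auto)
    also have "\<dots> = [card H] \<cdot>\<^bsub>V\<^esub> b" using bV by (simp add: V.add.finprod_const)
    also have "\<dots> = ([card H] \<cdot>\<^bsub>V\<^esub> \<one>\<^bsub>V\<^esub>) \<otimes>\<^bsub>V\<^esub> b" using bV by (simp add: V.add_pow_ldistr)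
    also have "[card H] \<cdot>\<^bsub>V\<^esub> \<one>\<^bsub>V\<^esub> = \<theta> ([card H] \<cdot>\<^bsub>U\<^esub> \<one>\<^bsub>U\<^esub>)"
    proof -
      have "[n] \<cdot>\<^bsub>V\<^esub> \<one>\<^bsub>V\<^esub> = \<theta> ([n] \<cdot>\<^bsub>U\<^esub> \<one>\<^bsub>U\<^esub>)" for n :: nat
        by (induction n) auto
      then show ?thesis .
    qed
    finally have tr: "\<theta> (trace (e \<otimes>\<^bsub>U\<^esub> u)) = \<theta> ([card H] \<cdot>\<^bsub>U\<^esub> \<one>\<^bsub>U\<^esub>) \<otimes>\<^bsub>V\<^esub> b" .
    define a where "a = \<nu> \<otimes>\<^bsub>Inv\<^esub> trace (e \<otimes>\<^bsub>U\<^esub> u)"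
    have a: "a \<in> carrier Inv" unfolding a_def using \<nu> trace_invariant[OF eu] by (intro Inv.m_closed)
    have \<nu>U: "\<nu> \<in> carrier U" using \<nu>(1) by simp
    have "\<theta> a = \<theta> \<nu> \<otimes>\<^bsub>V\<^esub> (\<theta> ([card H] \<cdot>\<^bsub>U\<^esub> \<one>\<^bsub>U\<^esub>) \<otimes>\<^bsub>V\<^esub> b)"
      unfolding a_def using \<nu>U eu by (simp flip: tr)
    also have "\<dots> = \<theta> (\<nu> \<otimes>\<^bsub>U\<^esub> [card H] \<cdot>\<^bsub>U\<^esub> \<one>\<^bsub>U\<^esub>) \<otimes>\<^bsub>V\<^esub> b"
      using \<nu>U bV by (simp add: V.m_assoc)
    also have "\<dots> = b" unfolding \<nu>(2) using bV by simp
    finally show "b \<in> \<theta> ` carrier Inv" using a by blast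
  qed
qed

end

section \<open>Linear actions on polynomial rings\<close>

lemma monomials_simps [simp]:
  "carrier (monomials m) = {\<mu>. set_mset \<mu> \<subseteq> {..<m}}"
  "\<mu> \<otimes>\<^bsub>monomials m\<^esub> \<nu> = \<mu> + \<nu>"
  "\<one>\<^bsub>monomials m\<^esub> = {#}"
  by (simp_all add: monomials_def)

lemma monomials_comm_monoid: "comm_monoid (monomials m)"
  by (rule comm_monoidI) (auto simp: ac_simps)

locale polynomial_ring = T: cring T for T :: "('t, 'u) ring_scheme" and m :: nat
begin

sublocale monoid_algebra T "monomials m"
  using T.is_cring monomials_comm_monoid by (rule monoid_algebra.intro)

lemma mpoly_ring_eq: "mpoly_ring T m = RM"
  by (simp add: mpoly_ring_def)

text \<open>
  Monomials are products of indeterminates, so equality on indeterminates is enough.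
\<close>
lemma poly_hom_unique:
  assumes T': "cring T'" and \<Lambda>: "\<Lambda> \<in> ring_hom RM T'" and \<Lambda>': "\<Lambda>' \<in> ring_hom RM T'"
    and const: "\<And>c. c \<in> carrier T \<Longrightarrow> \<Lambda> (single T {#} c) = \<Lambda>' (single T {#} c)"
    and var: "\<And>i. i < m \<Longrightarrow> \<Lambda> (single T {#i#} \<one>\<^bsub>T\<^esub>) = \<Lambda>' (single T {#i#} \<one>\<^bsub>T\<^esub>)"
    and f: "f \<in> carrier RM"
  shows "\<Lambda> f = \<Lambda>' f"
proof (rule hom_unique[OF T' \<Lambda> \<Lambda>' _ _ f])
  fix \<mu> assume "\<mu> \<in> carrier (monomials m)"
  then show "\<Lambda> (single T \<mu> \<one>\<^bsub>T\<^esub>) = \<Lambda>' (single T \<mu> \<one>\<^bsub>T\<^esub>)"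
  proof (induction \<mu>)
    case empty then show ?case by (simp add: const)
  next
    case (add i \<mu>)
    then have i: "i < m" and \<mu>: "\<mu> \<in> carrier (monomials m)" by auto
    have eq: "single T (add_mset i \<mu>) \<one>\<^bsub>T\<^esub> = single T {#i#} \<one>\<^bsub>T\<^esub> \<otimes>\<^bsub>RM\<^esub> single T \<mu> \<one>\<^bsub>T\<^esub>"
      using i \<mu> by (subst single_mult) auto
    have cl: "single T {#i#} \<one>\<^bsub>T\<^esub> \<in> carrier RM" "single T \<mu> \<one>\<^bsub>T\<^esub> \<in> carrier RM"
      using i \<mu> by (auto intro!: single_closed)
    show ?case
      unfolding eq ring_hom_mult[OF \<Lambda> cl] ring_hom_mult[OF \<Lambda>' cl] using var[OF i] add.IH[OF \<mu>] by simp
  qed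
qed (simp add: const)

end

lemma matrix_monoid_simps:
  "A \<in> carrier (matrix_monoid K m) \<longleftrightarrow> A \<in> {..<m} \<rightarrow>\<^sub>E {..<m} \<rightarrow>\<^sub>E carrier K"
  "i < m \<Longrightarrow> j < m \<Longrightarrow> (A \<otimes>\<^bsub>matrix_monoid K m\<^esub> B) i j = (\<Oplus>\<^bsub>K\<^esub>k\<in>{..<m}. A i k \<otimes>\<^bsub>K\<^esub> B k j)"
  by (simp_all add: matrix_monoid_def)

text \<open>
  A representation \<open>\<rho>\<close> over \<open>K\<close> and, for each group element, a map \<open>\<alpha> g\<close> on the coefficient ring.  Each
  \<open>\<alpha> g\<close> is assumed to be a ring endomorphism only where it is used, because on the local factor \<open>S\<^sub>1\<close>
  this holds only for \<open>g\<close> in the stabilizer.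
\<close>
locale linear_action = polynomial_ring T m + K: cring K + \<iota>: ring_hom_cring K T \<iota> + G: group G
  for T :: "('t, 'u) ring_scheme" and m :: nat and K :: "('k, 'v) ring_scheme" and \<iota> :: "'k \<Rightarrow> 't"
    and G :: "('g, 'w) monoid_scheme" +
  fixes \<rho> :: "'g \<Rightarrow> nat \<Rightarrow> nat \<Rightarrow> 'k" and \<alpha> :: "'g \<Rightarrow> 't \<Rightarrow> 't"
  assumes \<rho>: "\<rho> \<in> hom G (GL m K)"
begin

abbreviation "const \<equiv> single T {#}"
abbreviation "indet i \<equiv> single T {#i#} \<one>\<^bsub>T\<^esub>"
definition "W g i = (\<Oplus>\<^bsub>RM\<^esub>j\<in>{..<m}. single T {#j#} (\<iota> (\<rho> (inv\<^bsub>G\<^esub> g) i j)))"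
definition "monomial_image g \<mu> = (\<Otimes>\<^bsub>RM\<^esub>i\<in>{..<m}. W g i [^]\<^bsub>RM\<^esub> count \<mu> i)"
abbreviation "act \<equiv> product_action G T \<iota> \<alpha> m \<rho>"

lemma entry_closed [simp]:
  assumes "g \<in> carrier G" "i < m" "j < m"
  shows "\<rho> g i j \<in> carrier K"
proof -
  have "\<rho> g \<in> carrier (matrix_monoid K m)"
    using \<rho> assms(1) by (auto simp: hom_def units_of_def Units_def)
  then have "\<rho> g i \<in> {..<m} \<rightarrow>\<^sub>E carrier K" using assms(2) by (auto simp: matrix_monoid_simps)
  then show ?thesis using assms(3) by auto
qed

lemma entry_mult:
  assumes "g \<in> carrier G" "h \<in> carrier G" "i < m" "j < m"
  shows "\<rho> (g \<otimes>\<^bsub>G\<^esub> h) i j = (\<Oplus>\<^bsub>K\<^esub>k\<in>{..<m}. \<rho> g i k \<otimes>\<^bsub>K\<^esub> \<rho> h k j)"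
proof -
  have "\<rho> (g \<otimes>\<^bsub>G\<^esub> h) = \<rho> g \<otimes>\<^bsub>matrix_monoid K m\<^esub> \<rho> h"
    using \<rho> assms by (auto simp: hom_def units_of_def)
  then show ?thesis using assms by (simp add: matrix_monoid_simps)
qed

lemma var_closed [simp]: "i < m \<Longrightarrow> c \<in> carrier T \<Longrightarrow> single T {#i#} c \<in> carrier RM"
  by (rule single_closed) auto

lemma const_closed [simp]: "c \<in> carrier T \<Longrightarrow> const c \<in> carrier RM"
  by (rule single_closed) auto

lemma const_ring_hom: "const \<in> ring_hom T RM"
  using const_hom by simp

lemma W_closed [simp]: "g \<in> carrier G \<Longrightarrow> i < m \<Longrightarrow> W g i \<in> carrier RM"
  unfolding W_def by (intro RM.finsum_closed) auto

lemma monomial_image_closed [simp]: "g \<in> carrier G \<Longrightarrow> monomial_image g \<mu> \<in> carrier RM"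
  unfolding monomial_image_def by (intro RM.finprod_closed) auto

lemma monomial_image_var:
  assumes "g \<in> carrier G" "i < m"
  shows "monomial_image g {#i#} = W g i"
proof -
  have "monomial_image g {#i#} = (\<Otimes>\<^bsub>RM\<^esub>k\<in>{..<m}. if i = k then W g k else \<one>\<^bsub>RM\<^esub>)"
    unfolding monomial_image_def using assms by (intro RM.finprod_cong') auto
  also have "\<dots> = W g i" using assms by (intro RM.finprod_singleton) auto
  finally show ?thesis .
qed

lemma act_eq_lift: "act g = monoid_ring_lift T RM (\<lambda>c. const (\<alpha> g c)) (monomial_image g)"
  by (rule ext)
    (simp only: product_action_def Let_def monoid_ring_lift_def monomial_image_def W_def mpoly_ring_eq)

context
  fixes g assumes g: "g \<in> carrier G" and \<alpha>: "\<alpha> g \<in> ring_hom T T"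
begin

lemma const_\<alpha>_hom: "(\<lambda>c. const (\<alpha> g c)) \<in> ring_hom T RM"
  using ring_hom_trans[OF \<alpha> const_ring_hom] by (simp add: o_def)

lemma act_ring_hom: "act g \<in> ring_hom RM RM"
  unfolding act_eq_lift
proof (rule lift_hom[OF RM_is_cring const_\<alpha>_hom])
  fix \<mu> \<nu>
  have "monomial_image g (\<mu> \<otimes>\<^bsub>monomials m\<^esub> \<nu>)
    = (\<Otimes>\<^bsub>RM\<^esub>i\<in>{..<m}. W g i [^]\<^bsub>RM\<^esub> count \<mu> i \<otimes>\<^bsub>RM\<^esub> W g i [^]\<^bsub>RM\<^esub> count \<nu> i)"
    unfolding monomial_image_def using g by (intro RM.finprod_cong') (auto simp: RM.nat_pow_mult)
  then show "monomial_image g (\<mu> \<otimes>\<^bsub>monomials m\<^esub> \<nu>) = monomial_image g \<mu> \<otimes>\<^bsub>RM\<^esub> monomial_image g \<nu>"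
    unfolding monomial_image_def using g by (simp add: RM.finprod_multf)
  show "monomial_image g \<one>\<^bsub>monomials m\<^esub> = \<one>\<^bsub>RM\<^esub>"
    unfolding monomial_image_def using g by (simp add: RM.finprod_one)
qed (use g in auto)

lemma act_const:
  assumes "c \<in> carrier T"
  shows "act g (const c) = const (\<alpha> g c)"
proof -
  have "act g (const c) = const (\<alpha> g c) \<otimes>\<^bsub>RM\<^esub> monomial_image g {#}"
    unfolding act_eq_lift using g assms
    by (intro lift_single[OF RM_is_cring const_\<alpha>_hom]) auto
  moreover have "monomial_image g {#} = \<one>\<^bsub>RM\<^esub>"
    unfolding monomial_image_def using g by (simp add: RM.finprod_one)
  ultimately show ?thesis using assms \<alpha> by (auto simp: ring_hom_closed)
qed

lemma act_var:
  assumes "i < m"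
  shows "act g (indet i) = W g i"
proof -
  have "act g (indet i) = const (\<alpha> g \<one>\<^bsub>T\<^esub>) \<otimes>\<^bsub>RM\<^esub> monomial_image g {#i#}"
    unfolding act_eq_lift using g assms
    by (intro lift_single[OF RM_is_cring const_\<alpha>_hom]) auto
  moreover have "const (\<alpha> g \<one>\<^bsub>T\<^esub>) = \<one>\<^bsub>RM\<^esub>"
    using ring_hom_one[OF const_\<alpha>_hom] .
  ultimately show ?thesis using g assms by (simp add: monomial_image_var)
qed

end

lemma single_var_eq: "i < m \<Longrightarrow> c \<in> carrier T \<Longrightarrow> single T {#i#} c = const c \<otimes>\<^bsub>RM\<^esub> indet i"
  by (subst single_mult) auto

text \<open>
  The substitution for \<open>h\<close> followed by that for \<open>g\<close> has the matrix \<open>\<rho>(h\<^sup>-\<^sup>1) \<rho>(g\<^sup>-\<^sup>1) = \<rho>((g h)\<^sup>-\<^sup>1)\<close>; inverting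
  the group elements turns the contravariant substitution into a left action.  The coefficients of linear
  forms come from \<open>K\<close>, so \<open>\<alpha> g\<close> does not move them.
\<close>
lemma act_W:
  assumes g: "g \<in> carrier G" and h: "h \<in> carrier G" and \<alpha>: "\<alpha> g \<in> ring_hom T T"
    and fix_scalars: "\<And>k. k \<in> carrier K \<Longrightarrow> \<alpha> g (\<iota> k) = \<iota> k" and i: "i < m"
  shows "act g (W h i) = W (g \<otimes>\<^bsub>G\<^esub> h) i"
proof -
  interpret a: ring_hom_cring RM RM "act g"
    using act_ring_hom[OF g \<alpha>] RM_is_cring by (intro ring_hom_cringI2)
  interpret c: ring_hom_cring T RM const
    using const_ring_hom T.is_cring RM_is_cring by (intro ring_hom_cringI2)
  let ?a = "\<lambda>j. \<rho> (inv\<^bsub>G\<^esub> h) i j" and ?b = "\<lambda>j k. \<rho> (inv\<^bsub>G\<^esub> g) j k"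
  have ab: "?a j \<in> carrier K" "?b j k \<in> carrier K" if "j < m" "k < m" for j k
    using that i g h by auto
  have "act g (W h i) = (\<Oplus>\<^bsub>RM\<^esub>j\<in>{..<m}. act g (single T {#j#} (\<iota> (?a j))))"
    unfolding W_def using ab by (subst a.hom_finsum) (auto simp: o_def)
  also have "\<dots> = (\<Oplus>\<^bsub>RM\<^esub>j\<in>{..<m}. \<Oplus>\<^bsub>RM\<^esub>k\<in>{..<m}. single T {#k#} (\<iota> (?a j \<otimes>\<^bsub>K\<^esub> ?b j k)))"
  proof (rule RM.finsum_cong'[OF refl])
    fix j assume "j \<in> {..<m}"
    then have j: "j < m" by simp
    have "act g (single T {#j#} (\<iota> (?a j))) = const (\<iota> (?a j)) \<otimes>\<^bsub>RM\<^esub> W g j"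
    proof -
      have cl: "const (\<iota> (?a j)) \<in> carrier RM" "indet j \<in> carrier RM"
        using j ab[OF j j] by auto
      have "act g (single T {#j#} (\<iota> (?a j))) = act g (const (\<iota> (?a j)) \<otimes>\<^bsub>RM\<^esub> indet j)"
        using j ab[OF j j] by (intro arg_cong[OF single_var_eq]) auto
      also have "\<dots> = act g (const (\<iota> (?a j))) \<otimes>\<^bsub>RM\<^esub> act g (indet j)"
        by (rule a.hom_mult[OF cl])
      also have "act g (const (\<iota> (?a j))) = const (\<iota> (?a j))"
        using j ab[OF j j] act_const[OF g \<alpha>] fix_scalars by simp
      also have "act g (indet j) = W g j" by (rule act_var[OF g \<alpha> j])
      finally show ?thesis .
    qed
    also have "\<dots> = (\<Oplus>\<^bsub>RM\<^esub>k\<in>{..<m}. const (\<iota> (?a j)) \<otimes>\<^bsub>RM\<^esub> single T {#k#} (\<iota> (?b j k)))"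
      unfolding W_def using j ab by (intro RM.finsum_rdistr) auto
    also have "\<dots> = (\<Oplus>\<^bsub>RM\<^esub>k\<in>{..<m}. single T {#k#} (\<iota> (?a j \<otimes>\<^bsub>K\<^esub> ?b j k)))"
    proof (rule RM.finsum_cong'[OF refl])
      fix k assume "k \<in> {..<m}"
      then have k: "k < m" by simp
      show "const (\<iota> (?a j)) \<otimes>\<^bsub>RM\<^esub> single T {#k#} (\<iota> (?b j k)) = single T {#k#} (\<iota> (?a j \<otimes>\<^bsub>K\<^esub> ?b j k))"
        using ab[OF j k] k by (subst single_mult) auto
    qed (use j ab in auto)
    finally show "act g (single T {#j#} (\<iota> (?a j)))
      = (\<Oplus>\<^bsub>RM\<^esub>k\<in>{..<m}. single T {#k#} (\<iota> (?a j \<otimes>\<^bsub>K\<^esub> ?b j k)))" .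
  qed (use ab in \<open>auto intro!: RM.finsum_closed\<close>)
  also have "\<dots> = (\<Oplus>\<^bsub>RM\<^esub>k\<in>{..<m}. \<Oplus>\<^bsub>RM\<^esub>j\<in>{..<m}. single T {#k#} (\<iota> (?a j \<otimes>\<^bsub>K\<^esub> ?b j k)))"
    using ab by (intro RM.finsum_swap) auto
  also have "\<dots> = (\<Oplus>\<^bsub>RM\<^esub>k\<in>{..<m}. single T {#k#} (\<iota> (\<rho> (inv\<^bsub>G\<^esub> (g \<otimes>\<^bsub>G\<^esub> h)) i k)))"
  proof (rule RM.finsum_cong'[OF refl])
    fix k assume "k \<in> {..<m}"
    then have k: "k < m" by simp
    have "(\<Oplus>\<^bsub>RM\<^esub>j\<in>{..<m}. single T {#k#} (\<iota> (?a j \<otimes>\<^bsub>K\<^esub> ?b j k)))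
      = (\<Oplus>\<^bsub>RM\<^esub>j\<in>{..<m}. const (\<iota> (?a j \<otimes>\<^bsub>K\<^esub> ?b j k)) \<otimes>\<^bsub>RM\<^esub> indet k)"
      using ab k by (intro RM.finsum_cong' single_var_eq) auto
    also have "\<dots> = (\<Oplus>\<^bsub>RM\<^esub>j\<in>{..<m}. const (\<iota> (?a j \<otimes>\<^bsub>K\<^esub> ?b j k))) \<otimes>\<^bsub>RM\<^esub> indet k"
      using ab k by (intro RM.finsum_ldistr[symmetric]) auto
    also have "(\<Oplus>\<^bsub>RM\<^esub>j\<in>{..<m}. const (\<iota> (?a j \<otimes>\<^bsub>K\<^esub> ?b j k)))
      = const (\<iota> (\<Oplus>\<^bsub>K\<^esub>j\<in>{..<m}. ?a j \<otimes>\<^bsub>K\<^esub> ?b j k))"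
      using ab k by (subst \<iota>.hom_finsum, force, subst c.hom_finsum) (auto simp: o_def)
    also have "(\<Oplus>\<^bsub>K\<^esub>j\<in>{..<m}. ?a j \<otimes>\<^bsub>K\<^esub> ?b j k) = \<rho> (inv\<^bsub>G\<^esub> (g \<otimes>\<^bsub>G\<^esub> h)) i k"
      using g h i k by (simp add: G.inv_mult_group entry_mult)
    also have "const (\<iota> (\<rho> (inv\<^bsub>G\<^esub> (g \<otimes>\<^bsub>G\<^esub> h)) i k)) \<otimes>\<^bsub>RM\<^esub> indet k
      = single T {#k#} (\<iota> (\<rho> (inv\<^bsub>G\<^esub> (g \<otimes>\<^bsub>G\<^esub> h)) i k))"
      using g h i k by (intro single_var_eq[symmetric]) auto
    finally show "(\<Oplus>\<^bsub>RM\<^esub>j\<in>{..<m}. single T {#k#} (\<iota> (?a j \<otimes>\<^bsub>K\<^esub> ?b j k)))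
      = single T {#k#} (\<iota> (\<rho> (inv\<^bsub>G\<^esub> (g \<otimes>\<^bsub>G\<^esub> h)) i k))" .
  qed (use g h i in auto)
  finally show ?thesis unfolding W_def .
qed

lemma act_mult:
  assumes g: "g \<in> carrier G" and h: "h \<in> carrier G"
    and \<alpha>g: "\<alpha> g \<in> ring_hom T T" and \<alpha>h: "\<alpha> h \<in> ring_hom T T"
    and \<alpha>gh: "\<And>t. t \<in> carrier T \<Longrightarrow> \<alpha> (g \<otimes>\<^bsub>G\<^esub> h) t = \<alpha> g (\<alpha> h t)"
    and fix_scalars: "\<And>k. k \<in> carrier K \<Longrightarrow> \<alpha> g (\<iota> k) = \<iota> k"
    and f: "f \<in> carrier RM"
  shows "act (g \<otimes>\<^bsub>G\<^esub> h) f = act g (act h f)"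
proof (rule poly_hom_unique[OF RM_is_cring _ _ _ _ f])
  have gh: "g \<otimes>\<^bsub>G\<^esub> h \<in> carrier G" using g h by simp
  have \<alpha>gh_hom: "\<alpha> (g \<otimes>\<^bsub>G\<^esub> h) \<in> ring_hom T T"
    using \<alpha>gh \<alpha>g \<alpha>h by (simp add: ring_hom_def Pi_def)
  show "act (g \<otimes>\<^bsub>G\<^esub> h) \<in> ring_hom RM RM" by (rule act_ring_hom[OF gh \<alpha>gh_hom])
  show "(\<lambda>f. act g (act h f)) \<in> ring_hom RM RM"
    using ring_hom_trans[OF act_ring_hom[OF h \<alpha>h] act_ring_hom[OF g \<alpha>g]] by (simp add: o_def)
  show "act (g \<otimes>\<^bsub>G\<^esub> h) (const c) = act g (act h (const c))" if "c \<in> carrier T" for c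
    using that ring_hom_closed[OF \<alpha>h] by (simp add: act_const[OF gh \<alpha>gh_hom] act_const[OF g \<alpha>g] act_const[OF h \<alpha>h] \<alpha>gh)
  show "act (g \<otimes>\<^bsub>G\<^esub> h) (indet i) = act g (act h (indet i))" if "i < m" for i
    using that by (simp add: act_var[OF gh \<alpha>gh_hom] act_var[OF h \<alpha>h] act_W[OF g h \<alpha>g fix_scalars])
qed

end

text \<open>
  Both sides are ring homomorphisms in \<open>f\<close>; they agree on constants by \<open>compat\<close> and on indeterminates
  because the matrix entries for \<open>T'\<close> are the images of those for \<open>T\<close>.
\<close>
lemma act_map_coeffs:
  assumes A: "linear_action T m K \<iota> G \<rho>" and A': "linear_action T' m K (\<lambda>k. \<pi> (\<iota> k)) G \<rho>"
    and \<pi>: "\<pi> \<in> ring_hom T T'"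
    and g: "g \<in> carrier G" and \<alpha>: "\<alpha> g \<in> ring_hom T T" and \<alpha>': "\<alpha>' g \<in> ring_hom T' T'"
    and compat: "\<And>t. t \<in> carrier T \<Longrightarrow> \<pi> (\<alpha> g t) = \<alpha>' g (\<pi> t)"
    and f: "f \<in> carrier (mpoly_ring T m)"
  shows "(\<lambda>\<mu>. \<pi> (product_action G T \<iota> \<alpha> m \<rho> g f \<mu>))
    = product_action G T' (\<lambda>k. \<pi> (\<iota> k)) \<alpha>' m \<rho> g (\<lambda>\<mu>. \<pi> (f \<mu>))"
proof -
  interpret A: linear_action T m K \<iota> G \<rho> \<alpha> by fact
  interpret A': linear_action T' m K "\<lambda>k. \<pi> (\<iota> k)" G \<rho> \<alpha>' by fact
  let ?\<Theta> = "\<lambda>f \<mu>. \<pi> (f \<mu>)"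
  have \<Theta>: "?\<Theta> \<in> ring_hom A.RM A'.RM"
    by (rule A.map_coeffs_hom[OF A'.T.is_cring \<pi>])
  interpret \<Theta>: ring_hom_cring A.RM A'.RM ?\<Theta>
    using \<Theta> A.RM_is_cring A'.RM_is_cring by (intro ring_hom_cringI2)
  note single = A.map_coeffs_single[OF A'.T.is_cring \<pi>]
  note a = A.act_ring_hom[OF g \<alpha>] and a' = A'.act_ring_hom[OF g \<alpha>']
  have "(\<lambda>f. ?\<Theta> (A.act g f)) f = (\<lambda>f. A'.act g (?\<Theta> f)) f"
  proof (rule A.poly_hom_unique[OF A'.RM_is_cring])
    show "(\<lambda>f. ?\<Theta> (A.act g f)) \<in> ring_hom A.RM A'.RM"
      using ring_hom_trans[OF a \<Theta>] by (simp add: o_def)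
    show "(\<lambda>f. A'.act g (?\<Theta> f)) \<in> ring_hom A.RM A'.RM"
      using ring_hom_trans[OF \<Theta> a'] by (simp add: o_def)
    show "?\<Theta> (A.act g (A.const c)) = A'.act g (?\<Theta> (A.const c))" if "c \<in> carrier T" for c
      using that ring_hom_closed[OF \<pi>]
      by (simp add: A.act_const[OF g \<alpha>] A'.act_const[OF g \<alpha>'] single compat)
    show "?\<Theta> (A.act g (A.indet i)) = A'.act g (?\<Theta> (A.indet i))" if i: "i < m" for i
    proof -
      have "?\<Theta> (A.act g (A.indet i)) = ?\<Theta> (A.W g i)" using i by (simp add: A.act_var[OF g \<alpha>])
      also have "\<dots> = A'.W g i"
        unfolding A.W_def A'.W_def using i g
        by (subst \<Theta>.hom_finsum) (auto simp: o_def single)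
      also have "\<dots> = A'.act g (?\<Theta> (A.indet i))"
        using i by (simp add: A'.act_var[OF g \<alpha>'] single ring_hom_one[OF \<pi>])
      finally show ?thesis .
    qed
  qed (use f in \<open>simp add: A.mpoly_ring_eq\<close>)
  then show ?thesis by simp
qed

section \<open>Local factors, idempotents and stabilizers\<close>

text \<open>
  Krull's theorem, needed to turn uniqueness of the maximal ideal of a local ring into invertibility of the
  elements outside it.
\<close>
lemma (in ring) exists_maximalideal_above:
  assumes I: "ideal I R" and "\<one> \<notin> I"
  shows "\<exists>N. maximalideal N R \<and> I \<subseteq> N"
proof -
  let ?S = "{J. ideal J R \<and> I \<subseteq> J \<and> \<one> \<notin> J}"
  have "\<exists>N\<in>?S. \<forall>J\<in>?S. N \<subseteq> J \<longrightarrow> J = N"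
  proof (rule subset_Zorn_nonempty)
    show "?S \<noteq> {}" using assms by blast
    fix C assume C: "C \<noteq> {}" "subset.chain ?S C"
    then have "subset.chain {J. ideal J R} C" by (auto simp: subset_chain_def)
    then have "ideal (\<Union>C) R" using chain_Union_is_ideal[of C] C(1) by simp
    then show "\<Union>C \<in> ?S" using C by (auto simp: subset_chain_def)
  qed
  then obtain N where N: "ideal N R" "I \<subseteq> N" "\<one> \<notin> N"
    and max: "\<And>J. ideal J R \<Longrightarrow> I \<subseteq> J \<Longrightarrow> \<one> \<notin> J \<Longrightarrow> N \<subseteq> J \<Longrightarrow> J = N" by auto
  have "maximalideal N R"
  proof (rule maximalidealI[OF N(1)])
    show "carrier R \<noteq> N" using N(3) by auto
    fix J assume J: "ideal J R" "N \<subseteq> J" "J \<subseteq> carrier R"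
    show "J = N \<or> J = carrier R"
    proof (cases "\<one> \<in> J")
      case True then show ?thesis using ideal.one_imp_carrier[OF J(1)] by simp
    next
      case False then show ?thesis using max[OF J(1)] J N by blast
    qed
  qed
  then show ?thesis using N by blast
qed

lemma local_ring_unit:
  assumes A: "local_ring A" and M: "maximalideal M A" and x: "x \<in> carrier A" "x \<notin> M"
  shows "\<exists>y\<in>carrier A. y \<otimes>\<^bsub>A\<^esub> x = \<one>\<^bsub>A\<^esub>"
proof -
  interpret A: cring A using A by (simp add: local_ring_def)
  have "\<one>\<^bsub>A\<^esub> \<in> PIdl\<^bsub>A\<^esub> x"
  proof (rule ccontr)
    assume "\<one>\<^bsub>A\<^esub> \<notin> PIdl\<^bsub>A\<^esub> x"
    then obtain N where "maximalideal N A" "PIdl\<^bsub>A\<^esub> x \<subseteq> N"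
      using A.exists_maximalideal_above[OF A.cgenideal_ideal[OF x(1)]] by blast
    moreover have "N = M" using A M calculation(1) by (auto simp: local_ring_def)
    ultimately show False using A.cgenideal_self[OF x(1)] x(2) by blast
  qed
  then show ?thesis by (auto simp: cgenideal_def)
qed

text \<open>
  Of \<open>x\<close> and \<open>1 - x\<close> at least one is outside \<open>M\<close>, hence a unit; as their product is zero, the other vanishes.
\<close>
lemma local_ring_idempotent:
  assumes A: "local_ring A" and M: "maximalideal M A" and x: "x \<in> carrier A"
    and idem: "x \<otimes>\<^bsub>A\<^esub> (\<one>\<^bsub>A\<^esub> \<ominus>\<^bsub>A\<^esub> x) = \<zero>\<^bsub>A\<^esub>"
  shows "x \<notin> M \<Longrightarrow> x = \<one>\<^bsub>A\<^esub>" and "x \<in> M \<Longrightarrow> x = \<zero>\<^bsub>A\<^esub>"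
proof -
  interpret A: cring A using A by (simp add: local_ring_def)
  interpret M: maximalideal M A by fact
  have y: "\<one>\<^bsub>A\<^esub> \<ominus>\<^bsub>A\<^esub> x \<in> carrier A" using x by simp
  show "x = \<one>\<^bsub>A\<^esub>" if "x \<notin> M"
  proof -
    obtain u where u: "u \<in> carrier A" "u \<otimes>\<^bsub>A\<^esub> x = \<one>\<^bsub>A\<^esub>"
      using local_ring_unit[OF A M x \<open>x \<notin> M\<close>] by blast
    have "\<one>\<^bsub>A\<^esub> \<ominus>\<^bsub>A\<^esub> x = u \<otimes>\<^bsub>A\<^esub> (x \<otimes>\<^bsub>A\<^esub> (\<one>\<^bsub>A\<^esub> \<ominus>\<^bsub>A\<^esub> x))"
      using u x y by (simp flip: A.m_assoc)
    then have "\<one>\<^bsub>A\<^esub> \<ominus>\<^bsub>A\<^esub> x = \<zero>\<^bsub>A\<^esub>" using idem u by simp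
    then show ?thesis using x by simp
  qed
  show "x = \<zero>\<^bsub>A\<^esub>" if "x \<in> M"
  proof -
    have "\<one>\<^bsub>A\<^esub> \<ominus>\<^bsub>A\<^esub> x \<notin> M"
    proof
      assume "\<one>\<^bsub>A\<^esub> \<ominus>\<^bsub>A\<^esub> x \<in> M"
      then have "(\<one>\<^bsub>A\<^esub> \<ominus>\<^bsub>A\<^esub> x) \<oplus>\<^bsub>A\<^esub> x \<in> M" using that by (rule M.a_closed)
      also have "(\<one>\<^bsub>A\<^esub> \<ominus>\<^bsub>A\<^esub> x) \<oplus>\<^bsub>A\<^esub> x = \<one>\<^bsub>A\<^esub>" using x by algebra
      finally show False using M.one_imp_carrier M.I_notcarr by simp
    qed
    then obtain u where u: "u \<in> carrier A" "u \<otimes>\<^bsub>A\<^esub> (\<one>\<^bsub>A\<^esub> \<ominus>\<^bsub>A\<^esub> x) = \<one>\<^bsub>A\<^esub>"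
      using local_ring_unit[OF A M y] by blast
    have "x = u \<otimes>\<^bsub>A\<^esub> (\<one>\<^bsub>A\<^esub> \<ominus>\<^bsub>A\<^esub> x) \<otimes>\<^bsub>A\<^esub> x" using u x by simp
    also have "\<dots> = u \<otimes>\<^bsub>A\<^esub> (x \<otimes>\<^bsub>A\<^esub> (\<one>\<^bsub>A\<^esub> \<ominus>\<^bsub>A\<^esub> x))"
      using u(1) x y by (simp add: A.m_ac)
    finally show ?thesis using idem u by simp
  qed
qed

lemma RDirProd_list_Cons_simps:
  assumes "a \<in> carrier T" "b \<in> carrier T" "as \<in> carrier (RDirProd_list Ts)" "bs \<in> carrier (RDirProd_list Ts)"
  shows "(a # as) \<otimes>\<^bsub>RDirProd_list (T # Ts)\<^esub> (b # bs) = (a \<otimes>\<^bsub>T\<^esub> b) # (as \<otimes>\<^bsub>RDirProd_list Ts\<^esub> bs)"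
    and "(a # as) \<oplus>\<^bsub>RDirProd_list (T # Ts)\<^esub> (b # bs) = (a \<oplus>\<^bsub>T\<^esub> b) # (as \<oplus>\<^bsub>RDirProd_list Ts\<^esub> bs)"
    and "\<one>\<^bsub>RDirProd_list (T # Ts)\<^esub> = \<one>\<^bsub>T\<^esub> # \<one>\<^bsub>RDirProd_list Ts\<^esub>"
proof -
  have ab: "(a, as) \<in> carrier (RDirProd T (RDirProd_list Ts))" "(b, bs) \<in> carrier (RDirProd T (RDirProd_list Ts))"
    using assms by (auto simp: RDirProd_carrier)
  note hom = RDirProd_list_hom1[of T Ts]
  show "(a # as) \<otimes>\<^bsub>RDirProd_list (T # Ts)\<^esub> (b # bs) = (a \<otimes>\<^bsub>T\<^esub> b) # (as \<otimes>\<^bsub>RDirProd_list Ts\<^esub> bs)"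
    using ring_hom_mult[OF hom ab] by (simp add: RDirProd_def DirProd_def monoid.defs)
  show "(a # as) \<oplus>\<^bsub>RDirProd_list (T # Ts)\<^esub> (b # bs) = (a \<oplus>\<^bsub>T\<^esub> b) # (as \<oplus>\<^bsub>RDirProd_list Ts\<^esub> bs)"
    using ring_hom_add[OF hom ab] by (simp add: RDirProd_def DirProd_def monoid.defs)
  show "\<one>\<^bsub>RDirProd_list (T # Ts)\<^esub> = \<one>\<^bsub>T\<^esub> # \<one>\<^bsub>RDirProd_list Ts\<^esub>"
    using ring_hom_one[OF hom] by (simp add: RDirProd_def DirProd_def monoid.defs)
qed

text \<open>
  The element \<open>e\<close> is a preimage of the idempotent \<open>(1, 0, \<dots>, 0)\<close>: if \<open>\<pi> s = 0\<close>, then \<open>e s\<close> is zero in every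
  factor.
\<close>
lemma first_factor_of_quotient:
  assumes S: "cring S" and I: "ideal I S" and Ts: "\<And>T. T \<in> set (S1 # Ss) \<Longrightarrow> ring T"
    and \<psi>: "\<psi> \<in> ring_iso (S Quot I) (RDirProd_list (S1 # Ss))"
    and \<pi>: "\<pi> = (\<lambda>s. \<psi> (I +>\<^bsub>S\<^esub> s) ! 0)"
  shows "\<pi> \<in> ring_hom S S1" and "\<pi> ` carrier S = carrier S1" and "\<And>s. s \<in> I \<Longrightarrow> \<pi> s = \<zero>\<^bsub>S1\<^esub>"
    and "\<exists>e\<in>carrier S. \<pi> e = \<one>\<^bsub>S1\<^esub> \<and> (\<forall>s\<in>carrier S. \<pi> s = \<zero>\<^bsub>S1\<^esub> \<longrightarrow> e \<otimes>\<^bsub>S\<^esub> s \<in> I)"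
proof -
  interpret S: cring S by fact
  interpret I: ideal I S by fact
  interpret S1: ring S1 using Ts by simp
  let ?D = "RDirProd_list (S1 # Ss)" and ?D' = "RDirProd_list Ss"
  interpret D': ring ?D' using Ts by (intro RDirProd_list_is_ring) auto
  have "ring ?D" using Ts by (intro RDirProd_list_is_ring) (auto simp: nth_Cons split: nat.splits)
  then interpret D: ring ?D .
  define \<omega> where "\<omega> s = \<psi> (I +>\<^bsub>S\<^esub> s)" for s
  have \<omega>_hom: "\<omega> \<in> ring_hom S ?D"
    using ring_hom_trans[OF I.rcos_ring_hom] \<psi> unfolding ring_iso_def \<omega>_def by (auto simp: o_def)
  interpret \<omega>: ring_hom_ring S ?D \<omega>
    using S.ring_axioms D.ring_axioms \<omega>_hom by (rule ring_hom_ringI2)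
  have bij: "bij_betw \<psi> (carrier (S Quot I)) (carrier ?D)" using \<psi> by (simp add: ring_iso_def)
  have \<omega>_surj: "\<exists>s\<in>carrier S. \<omega> s = x" if x: "x \<in> carrier ?D" for x
  proof -
    obtain c where c: "c \<in> carrier (S Quot I)" "x = \<psi> c" using bij x unfolding bij_betw_def by blast
    then obtain s where "s \<in> carrier S" "c = I +>\<^bsub>S\<^esub> s"
      unfolding FactRing_def A_RCOSETS_def' partial_object.simps by blast
    then show ?thesis using c by (auto simp: \<omega>_def)
  qed
  have \<omega>_ker: "s \<in> I" if s: "s \<in> carrier S" "\<omega> s = \<zero>\<^bsub>?D\<^esub>" for s
  proof -
    have cl: "I +>\<^bsub>S\<^esub> t \<in> carrier (S Quot I)" if "t \<in> carrier S" for t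
      using that unfolding FactRing_def A_RCOSETS_def' partial_object.simps by blast
    have "\<psi> (I +>\<^bsub>S\<^esub> s) = \<psi> (I +>\<^bsub>S\<^esub> \<zero>\<^bsub>S\<^esub>)" using \<omega>.hom_zero s by (simp add: \<omega>_def)
    then have "I +>\<^bsub>S\<^esub> s = I +>\<^bsub>S\<^esub> \<zero>\<^bsub>S\<^esub>"
      using bij cl[OF s(1)] cl[OF S.zero_closed] unfolding bij_betw_def inj_on_def by blast
    then have "s \<ominus>\<^bsub>S\<^esub> \<zero>\<^bsub>S\<^esub> \<in> I"
      using s S.quotient_eq_iff_same_a_r_cos[OF I, of s "\<zero>\<^bsub>S\<^esub>"] by simp
    then show ?thesis using s by (simp add: a_minus_def)
  qed
  have \<omega>_I: "\<omega> s = \<zero>\<^bsub>?D\<^esub>" if s: "s \<in> I" for s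
  proof -
    have "I +>\<^bsub>S\<^esub> s = I +>\<^bsub>S\<^esub> \<zero>\<^bsub>S\<^esub>"
      using S.a_rcos_zero[OF I s] S.a_rcos_zero[OF I I.zero_closed] by simp
    then show ?thesis using \<omega>.hom_zero by (simp add: \<omega>_def)
  qed
  have cons: "\<exists>as\<in>carrier ?D'. x = (x ! 0) # as \<and> x ! 0 \<in> carrier S1" if "x \<in> carrier ?D" for x
    using that by (auto simp: RDirProd_list_carrier)
  have D_cons: "a # as \<in> carrier ?D" if "a \<in> carrier S1" "as \<in> carrier ?D'" for a as
    using that by (auto simp: RDirProd_list_carrier)
  have \<pi>_eq: "\<pi> s = \<omega> s ! 0" for s by (simp add: \<pi> \<omega>_def)
  show "\<pi> \<in> ring_hom S S1"
  proof (rule ring_hom_memI)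
    fix s assume "s \<in> carrier S"
    then show "\<pi> s \<in> carrier S1" using cons[of "\<omega> s"] \<omega>.hom_closed by (auto simp: \<pi>_eq)
  next
    fix s t assume st: "s \<in> carrier S" "t \<in> carrier S"
    obtain as where as: "as \<in> carrier ?D'" "\<omega> s = \<pi> s # as" "\<pi> s \<in> carrier S1"
      using cons[OF \<omega>.hom_closed[OF st(1)]] by (auto simp: \<pi>_eq)
    obtain bs where bs: "bs \<in> carrier ?D'" "\<omega> t = \<pi> t # bs" "\<pi> t \<in> carrier S1"
      using cons[OF \<omega>.hom_closed[OF st(2)]] by (auto simp: \<pi>_eq)
    show "\<pi> (s \<otimes>\<^bsub>S\<^esub> t) = \<pi> s \<otimes>\<^bsub>S1\<^esub> \<pi> t"
      unfolding \<pi>_eq[of "s \<otimes>\<^bsub>S\<^esub> t"] \<omega>.hom_mult[OF st] as(2) bs(2)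
      using as bs by (simp add: RDirProd_list_Cons_simps)
    show "\<pi> (s \<oplus>\<^bsub>S\<^esub> t) = \<pi> s \<oplus>\<^bsub>S1\<^esub> \<pi> t"
      unfolding \<pi>_eq[of "s \<oplus>\<^bsub>S\<^esub> t"] \<omega>.hom_add[OF st] as(2) bs(2)
      using as bs by (simp add: RDirProd_list_Cons_simps)
  next
    show "\<pi> \<one>\<^bsub>S\<^esub> = \<one>\<^bsub>S1\<^esub>"
      unfolding \<pi>_eq \<omega>.hom_one
      using RDirProd_list_Cons_simps(3)[OF S1.one_closed S1.one_closed D'.one_closed D'.one_closed] by simp
  qed
  then show "\<pi> ` carrier S = carrier S1"
  proof (intro equalityI subsetI)
    fix a assume a: "a \<in> carrier S1"
    then obtain s where "s \<in> carrier S" "\<omega> s = a # \<zero>\<^bsub>?D'\<^esub>"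
      using \<omega>_surj[OF D_cons[OF a D'.zero_closed]] by blast
    then show "a \<in> \<pi> ` carrier S" by (auto simp: \<pi>_eq intro!: image_eqI[of _ _ s])
  qed (auto dest: ring_hom_closed)
  show "\<pi> s = \<zero>\<^bsub>S1\<^esub>" if "s \<in> I" for s
    unfolding \<pi>_eq \<omega>_I[OF that] RDirProd_list_zero' by simp
  obtain e where e: "e \<in> carrier S" "\<omega> e = \<one>\<^bsub>S1\<^esub> # \<zero>\<^bsub>?D'\<^esub>"
    using \<omega>_surj[OF D_cons[OF S1.one_closed D'.zero_closed]] by blast
  have "e \<otimes>\<^bsub>S\<^esub> s \<in> I" if s: "s \<in> carrier S" "\<pi> s = \<zero>\<^bsub>S1\<^esub>" for s
  proof (rule \<omega>_ker)
    obtain as where as: "as \<in> carrier ?D'" "\<omega> s = \<pi> s # as"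
      using cons[OF \<omega>.hom_closed[OF s(1)]] by (auto simp: \<pi>_eq)
    have "\<omega> (e \<otimes>\<^bsub>S\<^esub> s) = (\<one>\<^bsub>S1\<^esub> # \<zero>\<^bsub>?D'\<^esub>) \<otimes>\<^bsub>?D\<^esub> (\<zero>\<^bsub>S1\<^esub> # as)"
      using \<omega>.hom_mult[OF e(1) s(1)] e(2) as(2) s(2) by simp
    also have "\<dots> = \<zero>\<^bsub>?D\<^esub>"
      using as by (simp add: RDirProd_list_Cons_simps RDirProd_list_zero')
    finally show "\<omega> (e \<otimes>\<^bsub>S\<^esub> s) = \<zero>\<^bsub>?D\<^esub>" .
  qed (use e s in auto)
  moreover have "\<pi> e = \<one>\<^bsub>S1\<^esub>" using e by (simp add: \<pi>_eq)
  ultimately show "\<exists>e\<in>carrier S. \<pi> e = \<one>\<^bsub>S1\<^esub> \<and> (\<forall>s\<in>carrier S. \<pi> s = \<zero>\<^bsub>S1\<^esub> \<longrightarrow> e \<otimes>\<^bsub>S\<^esub> s \<in> I)"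
    using e by blast
qed

text \<open>
  The local factor \<open>S\<^sub>1\<close> of \<open>S/I\<close> for a \<open>G\<close>-stable ideal \<open>I\<close>, with projection \<open>\<pi>\<close> and a lift \<open>e\<close> of the
  idempotent that cuts it out.  The set \<open>Q\<close> below is the point of \<open>Spec S\<close> that belongs to \<open>S\<^sub>1\<close>.
\<close>
locale local_component = group_of_endomorphisms G S \<beta>
  for G :: "('g, 'w) monoid_scheme" and S :: "('s, 'v) ring_scheme" and \<beta> +
  fixes I S1 \<pi> e M
  assumes one_acts: "\<And>s. s \<in> carrier S \<Longrightarrow> \<beta> \<one>\<^bsub>G\<^esub> s = s"
    and I: "ideal I S" and I_stable: "\<And>g s. g \<in> carrier G \<Longrightarrow> s \<in> I \<Longrightarrow> \<beta> g s \<in> I"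
    and S1: "local_ring S1" and M: "maximalideal M S1"
    and \<pi>_hom: "\<pi> \<in> ring_hom S S1" and \<pi>_surj: "\<pi> ` carrier S = carrier S1"
    and \<pi>_I: "\<And>s. s \<in> I \<Longrightarrow> \<pi> s = \<zero>\<^bsub>S1\<^esub>"
    and e: "e \<in> carrier S" "\<pi> e = \<one>\<^bsub>S1\<^esub>"
    and e_ker: "\<And>s. s \<in> carrier S \<Longrightarrow> \<pi> s = \<zero>\<^bsub>S1\<^esub> \<Longrightarrow> e \<otimes>\<^bsub>S\<^esub> s \<in> I"
begin

definition "Q = {s \<in> carrier S. \<pi> s \<in> M}"

sublocale S1: cring S1 using S1 by (simp add: local_ring_def)
sublocale M: maximalideal M S1 by (rule M)
sublocale \<pi>: ring_hom_cring S S1 \<pi>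
  using \<pi>_hom U.is_cring S1.is_cring by (intro ring_hom_cringI2)

lemma one_notin_M: "\<one>\<^bsub>S1\<^esub> \<notin> M"
  using M.one_imp_carrier M.I_notcarr by auto

lemma \<beta>_inverse:
  assumes "g \<in> carrier G" "s \<in> carrier S"
  shows "\<beta> g (\<beta> (inv\<^bsub>G\<^esub> g) s) = s" "\<beta> (inv\<^bsub>G\<^esub> g) (\<beta> g s) = s"
  using assms act_mult[of g "inv\<^bsub>G\<^esub> g" s] act_mult[of "inv\<^bsub>G\<^esub> g" g s] one_acts by auto

lemma translate_idempotent:
  assumes g: "g \<in> carrier G"
  shows "\<pi> (\<beta> g e) \<otimes>\<^bsub>S1\<^esub> (\<one>\<^bsub>S1\<^esub> \<ominus>\<^bsub>S1\<^esub> \<pi> (\<beta> g e)) = \<zero>\<^bsub>S1\<^esub>"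
proof -
  interpret g: ring_hom_cring S S "\<beta> g" using g by (rule act_cring)
  have "\<pi> (\<one>\<^bsub>S\<^esub> \<ominus>\<^bsub>S\<^esub> e) = \<zero>\<^bsub>S1\<^esub>" using e by (simp add: a_minus_def S1.r_neg)
  then have "\<pi> (\<beta> g (e \<otimes>\<^bsub>S\<^esub> (\<one>\<^bsub>S\<^esub> \<ominus>\<^bsub>S\<^esub> e))) = \<zero>\<^bsub>S1\<^esub>"
    using \<pi>_I[OF I_stable[OF g e_ker]] e(1) by (simp only: U.minus_closed U.one_closed)
  then show ?thesis using e g by (simp add: a_minus_def)
qed

text \<open>
  If \<open>\<pi> s = 0\<close>, then \<open>e s \<in> I\<close> and so \<open>(g e)(g s) \<in> I\<close>; where \<open>g e\<close> maps to \<open>1\<close>, this says \<open>\<pi>(g s) = 0\<close>.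
\<close>
lemma translate_kernel:
  assumes g: "g \<in> carrier G" and ge: "\<pi> (\<beta> g e) = \<one>\<^bsub>S1\<^esub>"
    and s: "s \<in> carrier S" "\<pi> s = \<zero>\<^bsub>S1\<^esub>"
  shows "\<pi> (\<beta> g s) = \<zero>\<^bsub>S1\<^esub>"
proof -
  interpret g: ring_hom_cring S S "\<beta> g" using g by (rule act_cring)
  have "\<pi> (\<beta> g (e \<otimes>\<^bsub>S\<^esub> s)) = \<zero>\<^bsub>S1\<^esub>" by (rule \<pi>_I[OF I_stable[OF g e_ker[OF s]]])
  then show ?thesis using e g s ge by simp
qed

lemma stabilizer_fixes_e:
  assumes g: "g \<in> carrier G" and stab: "\<beta> g ` Q = Q"
  shows "\<pi> (\<beta> g e) = \<one>\<^bsub>S1\<^esub>"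
proof (rule local_ring_idempotent(1)[OF S1 M _ translate_idempotent[OF g]])
  show "\<pi> (\<beta> g e) \<in> carrier S1" using e g by simp
  show "\<pi> (\<beta> g e) \<notin> M"
  proof
    assume "\<pi> (\<beta> g e) \<in> M"
    then have "\<beta> g e \<in> \<beta> g ` Q" unfolding stab using e g by (simp add: Q_def)
    then obtain s where s: "s \<in> Q" "\<beta> g e = \<beta> g s" by blast
    have "e = \<beta> (inv\<^bsub>G\<^esub> g) (\<beta> g e)" using \<beta>_inverse(2)[OF g e(1)] by (rule sym)
    also have "\<dots> = s" unfolding s(2) using s(1) by (intro \<beta>_inverse(2)[OF g]) (simp add: Q_def)
    finally have "e \<in> Q" using s(1) by simp
    then show False using e one_notin_M by (simp add: Q_def)
  qed
qed

text \<open>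
  If \<open>Q \<subseteq> g Q\<close>, the sets \<open>g\<^sup>n Q\<close> increase with \<open>n\<close>; as \<open>g\<close> has finite order, this forces \<open>g Q = Q\<close>.
\<close>
lemma iterate_image_subset:
  assumes g: "g \<in> carrier G" and sub: "Q \<subseteq> \<beta> g ` Q"
  shows "\<beta> g ` Q \<subseteq> \<beta> (g [^]\<^bsub>G\<^esub> Suc n) ` Q"
proof (induction n)
  case (Suc n)
  let ?k = "g [^]\<^bsub>G\<^esub> Suc n"
  have k: "?k \<in> carrier G" using g by blast
  have "\<beta> (g [^]\<^bsub>G\<^esub> Suc (Suc n)) s = \<beta> ?k (\<beta> g s)" if "s \<in> Q" for s
    using act_mult[OF k g, of s] that by (simp add: Q_def)
  then have "\<beta> (g [^]\<^bsub>G\<^esub> Suc (Suc n)) ` Q = \<beta> ?k ` \<beta> g ` Q" by (simp add: image_image)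
  moreover have "\<beta> ?k ` Q \<subseteq> \<beta> ?k ` \<beta> g ` Q" by (rule image_mono[OF sub])
  ultimately show ?case using Suc.IH by (simp only: subset_trans)
qed (use g in simp)

text \<open>
  Otherwise \<open>\<pi>(g e) = 1\<close>, so \<open>g\<close> preserves \<open>ker \<pi>\<close> and induces an endomorphism of \<open>S\<^sub>1\<close>.  It maps units to
  units, so \<open>g\<close> maps the complement of \<open>Q\<close> into itself, that is, \<open>Q \<subseteq> g Q\<close>; finiteness of \<open>G\<close> gives
  \<open>g Q = Q\<close>.
\<close>
lemma outside_stabilizer_kills_e:
  assumes g: "g \<in> carrier G" and not_stab: "\<beta> g ` Q \<noteq> Q"
  shows "\<pi> (\<beta> g e) = \<zero>\<^bsub>S1\<^esub>"
proof (rule local_ring_idempotent(2)[OF S1 M _ translate_idempotent[OF g]])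
  show "\<pi> (\<beta> g e) \<in> carrier S1" using e g by simp
  show "\<pi> (\<beta> g e) \<in> M"
  proof (rule ccontr)
    interpret g: ring_hom_cring S S "\<beta> g" using g by (rule act_cring)
    assume "\<pi> (\<beta> g e) \<notin> M"
    then have ge: "\<pi> (\<beta> g e) = \<one>\<^bsub>S1\<^esub>"
      using e g by (intro local_ring_idempotent(1)[OF S1 M _ translate_idempotent[OF g]]) auto
    have outside: "\<pi> (\<beta> g s) \<notin> M" if s: "s \<in> carrier S" "\<pi> s \<notin> M" for s
    proof
      assume gs: "\<pi> (\<beta> g s) \<in> M"
      obtain y where y: "y \<in> carrier S1" "y \<otimes>\<^bsub>S1\<^esub> \<pi> s = \<one>\<^bsub>S1\<^esub>"
        using local_ring_unit[OF S1 M _ s(2)] s(1) by auto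
      have "y \<in> \<pi> ` carrier S" using y(1) by (simp only: \<pi>_surj)
      then obtain t where t: "t \<in> carrier S" "y = \<pi> t" by (metis imageE)
      have "\<pi> (t \<otimes>\<^bsub>S\<^esub> s \<ominus>\<^bsub>S\<^esub> \<one>\<^bsub>S\<^esub>) = \<zero>\<^bsub>S1\<^esub>"
        using s t y by (simp add: a_minus_def S1.r_neg)
      then have "\<pi> (\<beta> g (t \<otimes>\<^bsub>S\<^esub> s \<ominus>\<^bsub>S\<^esub> \<one>\<^bsub>S\<^esub>)) = \<zero>\<^bsub>S1\<^esub>"
        using s t by (intro translate_kernel[OF g ge]) auto
      then have "\<pi> (\<beta> g t) \<otimes>\<^bsub>S1\<^esub> \<pi> (\<beta> g s) \<ominus>\<^bsub>S1\<^esub> \<one>\<^bsub>S1\<^esub> = \<zero>\<^bsub>S1\<^esub>"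
        using s t g by (simp add: a_minus_def)
      then have "\<pi> (\<beta> g t) \<otimes>\<^bsub>S1\<^esub> \<pi> (\<beta> g s) = \<one>\<^bsub>S1\<^esub>" using s t g by simp
      moreover have "\<pi> (\<beta> g t) \<otimes>\<^bsub>S1\<^esub> \<pi> (\<beta> g s) \<in> M"
        using gs t g by (intro M.I_l_closed) auto
      ultimately show False using one_notin_M by simp
    qed
    have sub: "Q \<subseteq> \<beta> g ` Q"
    proof
      fix q assume q: "q \<in> Q"
      then have qS: "q \<in> carrier S" by (simp add: Q_def)
      let ?s = "\<beta> (inv\<^bsub>G\<^esub> g) q"
      have "?s \<in> carrier S" "\<beta> g ?s = q" using g qS \<beta>_inverse(1)[OF g qS] by auto
      moreover from this have "?s \<in> Q" using outside[of ?s] q by (auto simp: Q_def)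
      ultimately show "q \<in> \<beta> g ` Q" by (metis imageI)
    qed
    have "order G > 0" using finite_G G.order_gt_0_iff_finite by simp
    then obtain n where n: "order G = Suc n" by (cases "order G") auto
    have "\<beta> \<one>\<^bsub>G\<^esub> ` Q = Q" using one_acts by (force simp: Q_def)
    then have "\<beta> g ` Q \<subseteq> Q"
      using iterate_image_subset[OF g sub, of n] G.pow_order_eq_1[OF g] n by simp
    then show False using sub not_stab by blast
  qed
qed

lemma stabilizer_preserves_kernel:
  assumes "g \<in> carrier G" "\<beta> g ` Q = Q" "s \<in> carrier S" "\<pi> s = \<zero>\<^bsub>S1\<^esub>"
  shows "\<pi> (\<beta> g s) = \<zero>\<^bsub>S1\<^esub>"
  using assms by (intro translate_kernel stabilizer_fixes_e)

lemma induced_action_apply: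
  assumes g: "g \<in> carrier G" "\<beta> g ` Q = Q" and s: "s \<in> carrier S"
  shows "induced_action S \<pi> \<beta> g (\<pi> s) = \<pi> (\<beta> g s)"
proof -
  interpret g: ring_hom_cring S S "\<beta> g" using g(1) by (rule act_cring)
  have "\<pi> (\<beta> g t) = \<pi> (\<beta> g s)" if t: "t \<in> carrier S" "\<pi> s = \<pi> t" for t
  proof -
    have "\<pi> (t \<ominus>\<^bsub>S\<^esub> s) = \<zero>\<^bsub>S1\<^esub>" using t s by (simp add: a_minus_def S1.r_neg)
    then have "\<pi> (\<beta> g (t \<ominus>\<^bsub>S\<^esub> s)) = \<zero>\<^bsub>S1\<^esub>"
      using t s by (intro stabilizer_preserves_kernel[OF g]) auto
    then have "\<pi> (\<beta> g t) \<ominus>\<^bsub>S1\<^esub> \<pi> (\<beta> g s) = \<zero>\<^bsub>S1\<^esub>" using t s g by (simp add: a_minus_def)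
    then show ?thesis using t s g by simp
  qed
  then show ?thesis unfolding induced_action_def using s by (intro the_equality) blast+
qed

lemma induced_action_hom:
  assumes g: "g \<in> carrier G" "\<beta> g ` Q = Q"
  shows "induced_action S \<pi> \<beta> g \<in> ring_hom S1 S1"
proof -
  interpret g: ring_hom_cring S S "\<beta> g" using g(1) by (rule act_cring)
  have rep: "\<exists>s\<in>carrier S. x = \<pi> s" if "x \<in> carrier S1" for x
  proof -
    have "x \<in> \<pi> ` carrier S" using that by (simp only: \<pi>_surj)
    then show ?thesis by (metis imageE)
  qed
  note app = induced_action_apply[OF g]
  show ?thesis
  proof (rule ring_hom_memI)
    fix x assume "x \<in> carrier S1"
    then show "induced_action S \<pi> \<beta> g x \<in> carrier S1" using rep app g by fastforce
  next
    fix x y assume "x \<in> carrier S1" "y \<in> carrier S1"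
    then obtain s t where st: "s \<in> carrier S" "x = \<pi> s" "t \<in> carrier S" "y = \<pi> t" using rep by meson
    show "induced_action S \<pi> \<beta> g (x \<otimes>\<^bsub>S1\<^esub> y) = induced_action S \<pi> \<beta> g x \<otimes>\<^bsub>S1\<^esub> induced_action S \<pi> \<beta> g y"
      using st g by (simp add: app flip: \<pi>.hom_mult)
    show "induced_action S \<pi> \<beta> g (x \<oplus>\<^bsub>S1\<^esub> y) = induced_action S \<pi> \<beta> g x \<oplus>\<^bsub>S1\<^esub> induced_action S \<pi> \<beta> g y"
      using st g by (simp add: app flip: \<pi>.hom_add)
  next
    show "induced_action S \<pi> \<beta> g \<one>\<^bsub>S1\<^esub> = \<one>\<^bsub>S1\<^esub>"
      using app[OF U.one_closed] by simp
  qed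
qed

lemma stabilizer_is_subgroup: "subgroup {g \<in> carrier G. \<beta> g ` Q = Q} G"
proof (rule G.subgroupI)
  have QS: "s \<in> carrier S" if "s \<in> Q" for s using that by (simp add: Q_def)
  have "\<beta> \<one>\<^bsub>G\<^esub> ` Q = Q" using one_acts QS by force
  then show "{g \<in> carrier G. \<beta> g ` Q = Q} \<noteq> {}" by blast
  fix g assume g: "g \<in> {g \<in> carrier G. \<beta> g ` Q = Q}"
  then have "\<beta> (inv\<^bsub>G\<^esub> g) ` \<beta> g ` Q = \<beta> (inv\<^bsub>G\<^esub> g) ` Q" by simp
  moreover have "\<beta> (inv\<^bsub>G\<^esub> g) ` \<beta> g ` Q = Q"
  proof -
    have "\<beta> (inv\<^bsub>G\<^esub> g) (\<beta> g s) = s" if "s \<in> Q" for s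
      using \<beta>_inverse(2)[of g s] QS[OF that] g by blast
    then show ?thesis by (simp add: image_image)
  qed
  ultimately show "inv\<^bsub>G\<^esub> g \<in> {g \<in> carrier G. \<beta> g ` Q = Q}" using g by simp
  fix h assume h: "h \<in> {g \<in> carrier G. \<beta> g ` Q = Q}"
  have "\<beta> (g \<otimes>\<^bsub>G\<^esub> h) ` Q = \<beta> g ` \<beta> h ` Q"
  proof -
    have "\<beta> (g \<otimes>\<^bsub>G\<^esub> h) s = \<beta> g (\<beta> h s)" if "s \<in> Q" for s
      using act_mult[of g h s] QS[OF that] g h by blast
    then show ?thesis by (simp add: image_image)
  qed
  then show "g \<otimes>\<^bsub>G\<^esub> h \<in> {g \<in> carrier G. \<beta> g ` Q = Q}" using g h by simp
qed auto

text \<open>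
  The product is invariant under \<open>G\<close>, which permutes its factors, and it lies in \<open>Q\<close> because the factor
  \<open>1 - e\<close> does.
\<close>
lemma orbit_product_mem:
  assumes Q: "primeideal Q S" and QI: "Q \<inter> carrier Inv \<subseteq> I"
  shows "(\<Otimes>\<^bsub>S\<^esub>g\<in>carrier G. \<one>\<^bsub>S\<^esub> \<ominus>\<^bsub>S\<^esub> \<beta> g e) \<in> I"
proof -
  interpret Q: primeideal Q S by fact
  let ?f = "\<lambda>g. \<one>\<^bsub>S\<^esub> \<ominus>\<^bsub>S\<^esub> \<beta> g e"
  have f: "?f g \<in> carrier S" if "g \<in> carrier G" for g using that e by simp
  define E where "E = (\<Otimes>\<^bsub>S\<^esub>g\<in>carrier G. ?f g)"
  have E: "E \<in> carrier S" unfolding E_def using f by (intro U.finprod_closed) auto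
  have "\<beta> h E = E" if h: "h \<in> carrier G" for h
  proof -
    interpret h: ring_hom_cring S S "\<beta> h" using h by (rule act_cring)
    have "\<beta> h E = (\<Otimes>\<^bsub>S\<^esub>g\<in>carrier G. \<beta> h (?f g))"
      unfolding E_def using f by (subst h.hom_finprod) (auto simp: o_def)
    also have "\<dots> = (\<Otimes>\<^bsub>S\<^esub>g\<in>carrier G. ?f (h \<otimes>\<^bsub>G\<^esub> g))"
      using e h by (intro U.finprod_cong') (auto simp: act_mult a_minus_def)
    also have "\<dots> = (\<Otimes>\<^bsub>S\<^esub>g\<in>(\<otimes>\<^bsub>G\<^esub>) h ` carrier G. ?f g)"
      using f h inj_on_translation by (subst U.finprod_reindex) auto
    also have "\<dots> = E" unfolding translation_image[OF h] E_def ..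
    finally show ?thesis .
  qed
  then have "E \<in> carrier Inv" using E by simp
  moreover have "E \<in> Q"
  proof -
    have "\<pi> (\<one>\<^bsub>S\<^esub> \<ominus>\<^bsub>S\<^esub> e) = \<zero>\<^bsub>S1\<^esub>" using e by (simp add: a_minus_def S1.r_neg)
    then have "\<one>\<^bsub>S\<^esub> \<ominus>\<^bsub>S\<^esub> e \<in> Q"
      unfolding Q_def using U.minus_closed[OF U.one_closed e(1)] M.zero_closed by (metis (lifting) mem_Collect_eq)
    then have "?f \<one>\<^bsub>G\<^esub> \<in> Q" by (simp only: one_acts[OF e(1)])
    moreover have "(\<Otimes>\<^bsub>S\<^esub>g\<in>carrier G - {\<one>\<^bsub>G\<^esub>}. ?f g) \<in> carrier S"
      using f by (intro U.finprod_closed) auto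
    ultimately have "?f \<one>\<^bsub>G\<^esub> \<otimes>\<^bsub>S\<^esub> (\<Otimes>\<^bsub>S\<^esub>g\<in>carrier G - {\<one>\<^bsub>G\<^esub>}. ?f g) \<in> Q"
      by (rule Q.I_r_closed)
    also have "?f \<one>\<^bsub>G\<^esub> \<otimes>\<^bsub>S\<^esub> (\<Otimes>\<^bsub>S\<^esub>g\<in>carrier G - {\<one>\<^bsub>G\<^esub>}. ?f g)
      = (\<Otimes>\<^bsub>S\<^esub>g\<in>insert \<one>\<^bsub>G\<^esub> (carrier G - {\<one>\<^bsub>G\<^esub>}). ?f g)"
      using f finite_G by (intro U.finprod_insert[symmetric]) auto
    also have "\<dots> = E" unfolding E_def by (simp add: insert_absorb)
    finally show ?thesis .
  qed
  ultimately show ?thesis using QI unfolding E_def by blast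
qed

end

section \<open>The fiber ring of the quotient by a product action\<close>

lemma scalar_hom:
  assumes "algebra K S"
  shows "(\<lambda>k. k \<odot>\<^bsub>S\<^esub> \<one>\<^bsub>S\<^esub>) \<in> ring_hom K S"
proof -
  interpret algebra K S by fact
  show ?thesis
    by (rule ring_hom_memI) (auto simp: smult_l_distr smult_assoc1 smult_assoc2)
qed

theorem theorem6p1:
  fixes K :: "('k, 'u) ring_scheme"
    and S :: "('k, 's, 'v) module_scheme"
    and G :: "('g, 'w) monoid_scheme"
    and \<beta> :: "'g \<Rightarrow> 's \<Rightarrow> 's"
    and \<rho> :: "'g \<Rightarrow> nat \<Rightarrow> nat \<Rightarrow> 'k"
    and m :: nat
    and P Q :: "'s set"
    and S1 :: "('t, 'x) ring_scheme"
    and Ss :: "('t, 'x) ring_scheme list"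
    and \<psi> :: "'s set \<Rightarrow> 't list"
  assumes "field K" and "algebra K S"
    and "group G" and "finite (carrier G)"
    and nonmodular: "[order G] \<cdot>\<^bsub>K\<^esub> \<one>\<^bsub>K\<^esub> \<noteq> \<zero>\<^bsub>K\<^esub>"
    and "faithful_action G (carrier S) \<beta>"
    and "\<And>g. g \<in> carrier G \<Longrightarrow> \<beta> g \<in> ring_hom S S"
    and "\<And>g k s. g \<in> carrier G \<Longrightarrow> k \<in> carrier K \<Longrightarrow> s \<in> carrier S \<Longrightarrow>
           \<beta> g (k \<odot>\<^bsub>S\<^esub> s) = k \<odot>\<^bsub>S\<^esub> \<beta> g s"
    and R: "R = invariant_ring S (carrier G) \<beta>"
    and "maximalideal P R"
    and "primeideal Q S" and "Q \<inter> carrier R = P"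
    and "\<And>T. T \<in> set (S1 # Ss) \<Longrightarrow> local_ring T"
    and "\<psi> \<in> ring_iso (S Quot (Idl\<^bsub>S\<^esub> P)) (RDirProd_list (S1 # Ss))"
    and \<pi>: "\<pi> = (\<lambda>s. \<psi> ((Idl\<^bsub>S\<^esub> P) +>\<^bsub>S\<^esub> s) ! 0)"
    and "\<exists>M. maximalideal M S1 \<and> Q = {s \<in> carrier S. \<pi> s \<in> M}"
    and H: "H = stabilizer G (\<lambda>g. image (\<beta> g)) Q"
    and "\<rho> \<in> hom G (GL m K)"
    and A: "A = invariant_ring (mpoly_ring S m) (carrier G)
              (product_action G S (\<lambda>k. k \<odot>\<^bsub>S\<^esub> \<one>\<^bsub>S\<^esub>) \<beta> m \<rho>)"
    and B: "B = invariant_ring (mpoly_ring S1 m) H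
              (product_action G S1 (\<lambda>k. \<pi> (k \<odot>\<^bsub>S\<^esub> \<one>\<^bsub>S\<^esub>)) (induced_action S \<pi> \<beta>) m \<rho>)"
  shows "\<exists>\<Phi> \<in> ring_iso (fiber_ring R A (single S {#}) P) B.
           \<forall>r\<in>carrier R. \<Phi> (fiber_scalar R A (single S {#}) P (P +>\<^bsub>R\<^esub> r)) = single S1 {#} (\<pi> r)"
proof -
  interpret K: field K by fact
  interpret \<beta>: faithful_action G "carrier S" \<beta> by fact
  interpret S: group_of_endomorphisms G S \<beta>
  proof (intro group_of_endomorphisms.intro group_of_endomorphisms_axioms.intro)
    show "\<beta> (g \<otimes>\<^bsub>G\<^esub> h) s = \<beta> g (\<beta> h s)"
      if "g \<in> carrier G" "h \<in> carrier G" "s \<in> carrier S" for g h s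
      using \<beta>.composition_rule[OF that(3,1,2)] .
  qed (use assms algebra.axioms(2)[OF assms(2)] in auto)
  define \<iota> where "\<iota> k = k \<odot>\<^bsub>S\<^esub> \<one>\<^bsub>S\<^esub>" for k
  have \<iota>_hom: "\<iota> \<in> ring_hom K S"
    unfolding \<iota>_def by (rule scalar_hom) fact
  interpret \<iota>: ring_hom_cring K S \<iota>
    using \<iota>_hom K.is_cring S.U.is_cring by (intro ring_hom_cringI2)
  have \<beta>_\<iota>: "\<beta> g (\<iota> k) = \<iota> k" if "g \<in> carrier G" "k \<in> carrier K" for g k
    using that assms(8)[of g k "\<one>\<^bsub>S\<^esub>"] ring_hom_one[OF S.act_hom[OF that(1)]] by (simp add: \<iota>_def)

  interpret P: maximalideal P R by fact
  have P_sub: "P \<subseteq> carrier S.Inv" using P.a_subset unfolding R .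
  then have PS: "P \<subseteq> carrier S" by auto
  let ?I = "Idl\<^bsub>S\<^esub> P"
  have I: "ideal ?I S" by (rule S.U.genideal_ideal[OF PS])
  have rings: "ring T" if "T \<in> set (S1 # Ss)" for T
    using assms(13)[OF that] by (auto simp: local_ring_def cring_def)
  note first = first_factor_of_quotient[OF S.U.is_cring I rings assms(14) \<pi>]
  \<comment> \<open>The lift \<open>e\<close> of the idempotent of the factor \<open>S\<^sub>1\<close>.\<close>
  from first(4) obtain e where e: "e \<in> carrier S" "\<pi> e = \<one>\<^bsub>S1\<^esub>"
    and e_ker: "\<And>s. s \<in> carrier S \<Longrightarrow> \<pi> s = \<zero>\<^bsub>S1\<^esub> \<Longrightarrow> e \<otimes>\<^bsub>S\<^esub> s \<in> ?I" by blast
  from assms(16) obtain M where M: "maximalideal M S1" and Q: "Q = {s \<in> carrier S. \<pi> s \<in> M}" by blast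
  interpret L: local_component G S \<beta> ?I S1 \<pi> e M
  proof (intro local_component.intro local_component_axioms.intro)
    show "group_of_endomorphisms G S \<beta>" ..
    show "\<beta> \<one>\<^bsub>G\<^esub> s = s" if "s \<in> carrier S" for s
      using that \<beta>.id_eq_one by (metis restrict_apply')
    show "local_ring S1" using assms(13) by simp
    show "\<beta> g s \<in> ?I" if "g \<in> carrier G" "s \<in> ?I" for g s
      using S.act_preserves_extended_ideal[OF P_sub that] .
  qed (use I M first(1-3) e e_ker in auto)
  have LQ: "L.Q = Q" by (simp add: L.Q_def Q)
  have H_eq: "H = {g \<in> carrier G. \<beta> g ` L.Q = L.Q}" by (simp add: H stabilizer_def LQ)
  have HG: "H \<subseteq> carrier G" by (auto simp: H_eq)
  have H_subgroup: "subgroup H G" unfolding H_eq by (rule L.stabilizer_is_subgroup)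

  define \<beta>1 where "\<beta>1 = induced_action S \<pi> \<beta>"
  have \<beta>1: "\<beta>1 h \<in> ring_hom S1 S1" "\<And>s. s \<in> carrier S \<Longrightarrow> \<beta>1 h (\<pi> s) = \<pi> (\<beta> h s)"
    if "h \<in> H" for h
    using that unfolding H_eq \<beta>1_def by (auto intro: L.induced_action_hom L.induced_action_apply)

  interpret A: linear_action S m K \<iota> G \<rho> \<beta>
    using K.is_cring S.U.is_cring S.G.group_axioms \<iota>.ring_hom_cring_axioms assms(18)
    by (intro linear_action.intro linear_action_axioms.intro polynomial_ring.intro)
  have \<pi>\<iota>: "ring_hom_cring K S1 (\<lambda>k. \<pi> (\<iota> k))"
    using ring_hom_trans[OF \<iota>_hom L.\<pi>_hom] K.is_cring L.S1.is_cring
    by (intro ring_hom_cringI2) (auto simp: o_def)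
  interpret A1: linear_action S1 m K "\<lambda>k. \<pi> (\<iota> k)" G \<rho> \<beta>1
    using K.is_cring L.S1.is_cring S.G.group_axioms \<pi>\<iota> assms(18)
    by (intro linear_action.intro linear_action_axioms.intro polynomial_ring.intro)
  interpret U: group_of_endomorphisms G A.RM A.act
  proof (intro group_of_endomorphisms.intro group_of_endomorphisms_axioms.intro)
    show "A.act g \<in> ring_hom A.RM A.RM" if "g \<in> carrier G" for g
      using A.act_ring_hom[OF that S.act_hom[OF that]] .
    show "A.act (g \<otimes>\<^bsub>G\<^esub> h) f = A.act g (A.act h f)"
      if "g \<in> carrier G" "h \<in> carrier G" "f \<in> carrier A.RM" for g h f
      using that S.act_hom S.act_mult \<beta>_\<iota> by (intro A.act_mult) auto
  qed (use S.finite_G S.G.group_axioms A.RM_is_cring in auto)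
  have A_eq: "A = U.Inv" unfolding A A.mpoly_ring_eq \<iota>_def ..
  have B_eq: "B = invariant_ring A1.RM H A1.act" unfolding B A1.mpoly_ring_eq \<iota>_def \<beta>1_def ..
  define \<theta> where "\<theta> f = (\<lambda>\<mu>. \<pi> (f \<mu>))" for f :: "nat multiset \<Rightarrow> 's"
  have \<theta>_hom: "\<theta> \<in> ring_hom A.RM A1.RM"
    using A.map_coeffs_hom[OF L.S1.is_cring L.\<pi>_hom] by (simp add: \<theta>_def[abs_def])
  have \<theta>_const: "\<theta> (A.const s) = A1.const (\<pi> s)" for s
    unfolding \<theta>_def by (rule A.map_coeffs_single[OF L.S1.is_cring L.\<pi>_hom])
  interpret const: ring_hom_cring S A.RM A.const
    using A.const_ring_hom S.U.is_cring A.RM_is_cring by (intro ring_hom_cringI2)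
  have act_const: "A.act g (A.const s) = A.const (\<beta> g s)" if "g \<in> carrier G" "s \<in> carrier S" for g s
    using A.act_const[OF that(1) S.act_hom[OF that(1)] that(2)] .
  \<comment> \<open>Inverses of integers in \<open>K\<close> give invariant constants in the polynomial ring.\<close>
  have inverse: "\<exists>\<nu>\<in>carrier U.Inv. \<nu> \<otimes>\<^bsub>A.RM\<^esub> [n] \<cdot>\<^bsub>A.RM\<^esub> \<one>\<^bsub>A.RM\<^esub> = \<one>\<^bsub>A.RM\<^esub>"
    if "[n] \<cdot>\<^bsub>K\<^esub> \<one>\<^bsub>K\<^esub> \<noteq> \<zero>\<^bsub>K\<^esub>" for n :: nat
  proof -
    define k where "k = inv\<^bsub>K\<^esub> ([n] \<cdot>\<^bsub>K\<^esub> \<one>\<^bsub>K\<^esub>)"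
    have k: "k \<in> carrier K" "k \<otimes>\<^bsub>K\<^esub> [n] \<cdot>\<^bsub>K\<^esub> \<one>\<^bsub>K\<^esub> = \<one>\<^bsub>K\<^esub>"
      using that unfolding k_def by (auto simp: K.field_Units)
    have "A.const (\<iota> ([n] \<cdot>\<^bsub>K\<^esub> \<one>\<^bsub>K\<^esub>)) = [n] \<cdot>\<^bsub>A.RM\<^esub> \<one>\<^bsub>A.RM\<^esub>" by (induction n) auto
    moreover have "A.const (\<iota> (k \<otimes>\<^bsub>K\<^esub> [n] \<cdot>\<^bsub>K\<^esub> \<one>\<^bsub>K\<^esub>))
        = A.const (\<iota> k) \<otimes>\<^bsub>A.RM\<^esub> A.const (\<iota> ([n] \<cdot>\<^bsub>K\<^esub> \<one>\<^bsub>K\<^esub>))"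
      using k(1) K.add.nat_pow_closed[OF K.one_closed, of n]
      by (simp only: \<iota>.hom_mult const.hom_mult \<iota>.hom_closed)
    ultimately have "A.const (\<iota> k) \<otimes>\<^bsub>A.RM\<^esub> [n] \<cdot>\<^bsub>A.RM\<^esub> \<one>\<^bsub>A.RM\<^esub> = A.const (\<iota> \<one>\<^bsub>K\<^esub>)"
      unfolding k(2) by (simp only:)
    then have "A.const (\<iota> k) \<otimes>\<^bsub>A.RM\<^esub> [n] \<cdot>\<^bsub>A.RM\<^esub> \<one>\<^bsub>A.RM\<^esub> = \<one>\<^bsub>A.RM\<^esub>"
      by (simp only: \<iota>.hom_one const.hom_one)
    moreover have "A.const (\<iota> k) \<in> carrier U.Inv" using k act_const \<beta>_\<iota> by auto
    ultimately show ?thesis by blast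
  qed
  \<comment> \<open>The order of \<open>H\<close> divides that of \<open>G\<close>, so \<open>H\<close> is nonmodular as well.\<close>
  have "[card H] \<cdot>\<^bsub>K\<^esub> \<one>\<^bsub>K\<^esub> \<noteq> \<zero>\<^bsub>K\<^esub>"
  proof
    assume zero: "[card H] \<cdot>\<^bsub>K\<^esub> \<one>\<^bsub>K\<^esub> = \<zero>\<^bsub>K\<^esub>"
    have "card (rcosets\<^bsub>G\<^esub> H) * card H = order G"
      using H_subgroup by (rule S.G.lagrange)
    then have "[order G] \<cdot>\<^bsub>K\<^esub> \<one>\<^bsub>K\<^esub> = [card (rcosets\<^bsub>G\<^esub> H)] \<cdot>\<^bsub>K\<^esub> ([card H] \<cdot>\<^bsub>K\<^esub> \<one>\<^bsub>K\<^esub>)"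
      by (metis K.add.nat_pow_pow K.one_closed mult.commute)
    then show False using nonmodular zero by simp
  qed
  from inverse[OF this] obtain \<nu>H where \<nu>H: "\<nu>H \<in> carrier U.Inv"
    "\<nu>H \<otimes>\<^bsub>A.RM\<^esub> [card H] \<cdot>\<^bsub>A.RM\<^esub> \<one>\<^bsub>A.RM\<^esub> = \<one>\<^bsub>A.RM\<^esub>" by blast
  from inverse[OF nonmodular] obtain \<nu>G where \<nu>G: "\<nu>G \<in> carrier U.Inv"
    "\<nu>G \<otimes>\<^bsub>A.RM\<^esub> [order G] \<cdot>\<^bsub>A.RM\<^esub> \<one>\<^bsub>A.RM\<^esub> = \<one>\<^bsub>A.RM\<^esub>" by blast

  have \<theta>_Inv: "\<theta> ` carrier U.Inv = carrier (invariant_ring A1.RM H A1.act)"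
  proof (rule U.invariants_onto_local_invariants[OF A1.RM_is_cring H_subgroup _ \<theta>_hom])
    show "A1.act h \<in> ring_hom A1.RM A1.RM" if "h \<in> H" for h
      using that HG \<beta>1(1) by (intro A1.act_ring_hom) auto
    show "\<theta> ` carrier A.RM = carrier A1.RM"
      using A.map_coeffs_surj[OF L.S1.is_cring L.\<pi>_hom L.\<pi>_surj] by (simp add: \<theta>_def[abs_def])
    show "\<theta> (A.act h f) = A1.act h (\<theta> f)" if h: "h \<in> H" and f: "f \<in> carrier A.RM" for h f
    proof -
      have hG: "h \<in> carrier G" using h HG by blast
      show ?thesis
        unfolding \<theta>_def
      proof (rule act_map_coeffs[OF A.linear_action_axioms A1.linear_action_axioms L.\<pi>_hom hG])
        show "f \<in> carrier (mpoly_ring S m)" using f by (simp add: A.mpoly_ring_eq)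
      qed (use S.act_hom[OF hG] \<beta>1[OF h] in auto)
    qed
    show "A.const e \<in> carrier A.RM" using e by simp
    show "\<theta> (A.const e) = \<one>\<^bsub>A1.RM\<^esub>" unfolding \<theta>_const e(2) A1.RM_simps(3) by simp
    show "\<theta> (A.act g (A.const e)) = \<zero>\<^bsub>A1.RM\<^esub>" if g: "g \<in> carrier G - H" for g
    proof -
      have "\<pi> (\<beta> g e) = \<zero>\<^bsub>S1\<^esub>" using g by (intro L.outside_stabilizer_kills_e) (auto simp: H_eq)
      moreover have "\<theta> (A.act g (A.const e)) = A1.const (\<pi> (\<beta> g e))"
        using g e by (simp add: act_const \<theta>_const)
      ultimately show ?thesis by (auto simp: A1.RM_simps(2) single_def)
    qed
  qed fact+

  have const_P: "A.const ` P \<subseteq> carrier U.Inv"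
  proof
    fix f :: "nat multiset \<Rightarrow> 's" assume "f \<in> A.const ` P"
    then obtain p where p: "p \<in> P" "f = A.const p" by blast
    then have "p \<in> carrier S.Inv" using P_sub by blast
    then show "f \<in> carrier U.Inv" using p act_const by auto
  qed
  have kernel: "a \<in> Idl\<^bsub>U.Inv\<^esub> (A.const ` P)" if a: "a \<in> carrier U.Inv" "\<theta> a = \<zero>\<^bsub>A1.RM\<^esub>" for a
  proof -
    have aU: "a \<in> carrier A.RM" using a(1) by simp
    have "\<pi> (a \<mu>) = \<zero>\<^bsub>S1\<^esub>" for \<mu> using fun_cong[OF a(2), of \<mu>] by (simp add: \<theta>_def A1.RM_simps(2))
    then have "e \<otimes>\<^bsub>S\<^esub> a \<mu> \<in> ?I" for \<mu> using aU by (intro e_ker) auto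
    then have ea: "A.const e \<otimes>\<^bsub>A.RM\<^esub> a \<in> Idl\<^bsub>A.RM\<^esub> (A.const ` P)"
      using A.const_mult_mem_extended_ideal[OF PS e(1) aU] by simp
    \<comment> \<open>The orbit product of the constant \<open>e\<close> is the constant of the orbit product in \<open>S\<close>, which lies in \<open>Q \<inter> R = P\<close>.\<close>
    have "(\<Otimes>\<^bsub>A.RM\<^esub>g\<in>carrier G. \<one>\<^bsub>A.RM\<^esub> \<ominus>\<^bsub>A.RM\<^esub> A.act g (A.const e))
      = (\<Otimes>\<^bsub>A.RM\<^esub>g\<in>carrier G. A.const (\<one>\<^bsub>S\<^esub> \<ominus>\<^bsub>S\<^esub> \<beta> g e))"
      using e act_const by (intro A.RM.finprod_cong') (auto simp: a_minus_def)
    also have "\<dots> = A.const (\<Otimes>\<^bsub>S\<^esub>g\<in>carrier G. \<one>\<^bsub>S\<^esub> \<ominus>\<^bsub>S\<^esub> \<beta> g e)"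
      using e by (subst const.hom_finprod) (auto simp: o_def)
    also have "\<dots> \<in> Idl\<^bsub>A.RM\<^esub> (A.const ` P)"
    proof -
      have "L.Q \<inter> carrier S.Inv \<subseteq> ?I"
        using assms(12) S.U.genideal_self[OF PS] unfolding LQ R by blast
      moreover have "primeideal L.Q S" unfolding LQ by fact
      ultimately have "(\<Otimes>\<^bsub>S\<^esub>g\<in>carrier G. \<one>\<^bsub>S\<^esub> \<ominus>\<^bsub>S\<^esub> \<beta> g e) \<in> ?I"
        by (intro L.orbit_product_mem)
      then show ?thesis using A.const_mem_extended_ideal[OF PS] by simp
    qed
    finally have "a \<in> Idl\<^bsub>A.RM\<^esub> (A.const ` P)"
      using e by (intro U.mem_ideal_of_orbit_product[OF const_P _ a(1) ea]) auto
    then show ?thesis by (rule U.extended_ideal_invariants[OF const_P \<nu>G a(1)])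
  qed

  have R_cring: "cring R" unfolding R by (rule S.Inv.is_cring)
  have const_R: "A.const \<in> ring_hom R A"
    unfolding R A_eq by (rule ring_hom_memI) (use act_const in auto)
  interpret F: algebra_fiber R A A.const P
    unfolding algebra_fiber_def
    using R_cring U.Inv.is_cring const_R P.is_ideal by (auto intro: ring_hom_cringI2 simp: A_eq)
  have B_cring: "cring B"
    unfolding B_eq using HG \<beta>1(1) by (intro invariant_ring_is_cring A1.RM_is_cring A1.act_ring_hom) auto
  have \<theta>_AB: "\<theta> \<in> ring_hom A B"
  proof (rule ring_hom_memI)
    show "\<theta> a \<in> carrier B" if "a \<in> carrier A" for a
      using that \<theta>_Inv unfolding A_eq B_eq by blast
  qed (use \<theta>_hom in \<open>auto simp: A_eq B_eq ring_hom_mult ring_hom_add ring_hom_one\<close>)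
  have "\<exists>\<Phi> \<in> ring_iso (fiber_ring R A A.const P) B.
    \<forall>r\<in>carrier R. \<Phi> (fiber_scalar R A A.const P (P +>\<^bsub>R\<^esub> r)) = \<theta> (A.const r)"
  proof (rule F.fiber_ring_iso[OF B_cring \<theta>_AB])
    show "\<theta> ` carrier A = carrier B" unfolding A_eq B_eq by (rule \<theta>_Inv)
    show "\<theta> (A.const p) = \<zero>\<^bsub>B\<^esub>" if "p \<in> P" for p
    proof -
      have "\<pi> p = \<zero>\<^bsub>S1\<^esub>" using S.U.genideal_self[OF PS] that by (intro L.\<pi>_I) blast
      then show ?thesis unfolding \<theta>_const B_eq by (auto simp: A1.RM_simps(2) single_def)
    qed
    show "a \<in> Idl\<^bsub>A\<^esub> (A.const ` P)" if "a \<in> carrier A" "\<theta> a = \<zero>\<^bsub>B\<^esub>" for a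
      using kernel[of a] that by (simp only: A_eq B_eq invariant_ring_simps)
  qed
  then show ?thesis unfolding \<theta>_const .
qed

end
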